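(* Let $M,M_0$ be Riemannian manifolds, and let $\gamma:[0,l]\to M$ and $\gamma_0:[0,l]\to M_0$ be normal geodesics. Assume that for every $t\in[0,l]$, every $X\in M_{\gamma(t)}$ linearly independent of $\gamma'(t)$ and every $X_0\in (M_0)_{\gamma_0(t)}$ linearly independent of $\gamma_0'(t)$, the sectional curvatures satisfy $K(\gamma'(t),X)\leq K(\gamma_0'(t),X_0)$. Let $V,V_0$ be Jacobi fields along $\gamma,\gamma_0$ respectively satisfying $\|V(0)\|\geq\|V_0(0)\|>0$, $\langle\gamma'(0),V(0)\rangle=\langle\gamma_0'(0),V_0(0)\rangle$ and $\langle\gamma'(0),V'(0)\rangle=\langle\gamma_0'(0),V_0'(0)\rangle$. Suppose there are symmetric linear transformations $B$ on $\gamma'(0)^\perp$ and $B_0$ on $\gamma_0'(0)^\perp$, with the minimum eigenvalue of $B$ greater than or equal to the maximum eigenvalue of $B_0$, such that $\widehat{V'(0)}=B(\widehat{V(0)})$ and $\widehat{V_0'(0)}=B_0(\widehat{V_0(0)})$, and suppose there is no focal point of $\gamma_0(0)$ with respect to $B_0$ on $\gamma_0$. Then for all $t\in[0,l]$ $$\|V(t)\|\geq\|V_0(t)\|.$$ Moreover, if $\|V(t_0)\|=\|V_0(t_0)\|$ for some $t_0\in(0,l]$, then on $[0,t_0]$ one has $\|\widehat V\|=\|\widehat{V_0}\|$ and $\|V\|=\|V_0\|$; and if in addition $\|\widehat{V(0)}\|\neq 0$, then on $[0,t_0]$ one has $K(\gamma',V)=K(\gamma_0',V_0)$, and $\frac{\widehat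 V}{\|\widehat V\|}$ and $\frac{\widehat{V_0}}{\|\widehat V\|}$ are parallel vector fields along $\gamma$ and $\gamma_0$ respectively.
   Context: $M_x$ denotes the tangent space of $M$ at $x$. $M$ and $M_0$ have dimension at least $2$; their dimensions need not be related to each other. A normal geodesic is a geodesic parametrized by arc length, with $l>0$. A prime on a vector field along a geodesic denotes covariant derivative along it. $\gamma'(0)^\perp$ is the orthogonal complement of $\gamma'(0)$ in $M_{\gamma(0)}$ (similarly for $\gamma_0$). $K(X,Y)$ is the sectional curvature of the plane spanned by $X,Y$. For a smooth vector field $V$ along a normal geodesic $\gamma$, $\widehat{V(t)}=V(t)-\langle V(t),\gamma'(t)\rangle\gamma'(t)$ is the component perpendicular to $\gamma'(t)$; likewise $\widehat{V'(t)}=V'(t)-\langle V'(t),\gamma'(t)\rangle\gamma'(t)$, and $(\widehat{V(t)})'=\widehat{V'(t)}$. The same notation is used along $\gamma_0$ with $\gamma_0'$. Focal points: for the symmetric linear transformation $B_0$ on $\gamma_0'(0)^\perp$ and $t\in(0,l]$, $\gamma_0(t)$ is a focal point of $\gamma_0(0)$ with respect to $B_0$ on $\gamma_0$ if there is a Jacobi field $J$ along $\gamma_0|_{[0,t]}$ with $J(t)=0$, $0\neq J(0)\in\gamma_0'(0)^\perp$ and $J'(0)=B_0(J(0))$. "No focal point on $\gamma_0$" means that no $t\in(0,l]$ has this property. *)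

theory Defs
  imports "HOL-Analysis.Analysis"
begin

text \<open>
  \<open>smooth_on f S\<close> is only used for sets \<open>S\<close> on which derivatives within \<open>S\<close> are unique: open
  subsets of a Euclidean space, and relatively open subsets of an interval \<open>{0..l}\<close> with \<open>l > 0\<close>
  (with one-sided derivatives at \<open>0\<close> and \<open>l\<close>).
\<close>

primrec Ck_on :: "nat \<Rightarrow> ('a::real_normed_vector \<Rightarrow> 'b::real_normed_vector) \<Rightarrow> 'a set \<Rightarrow> bool" where
  "Ck_on 0 f S = continuous_on S f"
| "Ck_on (Suc k) f S =
     (f differentiable_on S \<and> (\<forall>v. Ck_on k (\<lambda>x. frechet_derivative f (at x within S) v) S))"

definition smooth_on :: "('a::real_normed_vector \<Rightarrow> 'b::real_normed_vector) \<Rightarrow> 'a set \<Rightarrow> bool" where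
  "smooth_on f S \<longleftrightarrow> (\<forall>k. Ck_on k f S)"

type_synonym ('m, 'e) chart = "'m set \<times> ('m \<Rightarrow> 'e)"

abbreviation chart_dom :: "('m, 'e) chart \<Rightarrow> 'm set" where "chart_dom \<equiv> fst"
abbreviation chart_map :: "('m, 'e) chart \<Rightarrow> 'm \<Rightarrow> 'e" where "chart_map \<equiv> snd"

definition chart_img :: "('m, 'e) chart \<Rightarrow> 'e set" where
  "chart_img c = chart_map c ` chart_dom c"

definition chart_inv :: "('m, 'e) chart \<Rightarrow> 'e \<Rightarrow> 'm" where
  "chart_inv c = inv_into (chart_dom c) (chart_map c)"

text \<open>
  A tangent vector at a point \<open>p\<close> is the family of its coordinate vectors in all charts around \<open>p\<close>
  (and zero in the other charts), where the coordinate vectors are related by the derivatives of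
  the coordinate changes; see \<open>tangent_space\<close> below. The vector operations are pointwise.
\<close>

datatype ('m, 'e) tvec = Tvec (coords: "('m, 'e) chart \<Rightarrow> 'e")

instantiation tvec :: (type, real_vector) real_vector
begin

definition "0 = Tvec (\<lambda>c. 0)"
definition "X + Y = Tvec (\<lambda>c. coords X c + coords Y c)"
definition "X - Y = Tvec (\<lambda>c. coords X c - coords Y c)"
definition "- X = Tvec (\<lambda>c. - coords X c)"
definition "a *\<^sub>R X = Tvec (\<lambda>c. a *\<^sub>R coords X c)"

instance
  by standard
    (simp_all add: zero_tvec_def plus_tvec_def minus_tvec_def uminus_tvec_def scaleR_tvec_def
      algebra_simps)

end

record ('m, 'e) riem =
  mtop :: "'m topology"
  atlas :: "('m, 'e) chart set"
  rmetric :: "'m \<Rightarrow> ('m, 'e) tvec \<Rightarrow> ('m, 'e) tvec \<Rightarrow> real"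

definition charts_at :: "('m, 'e) riem \<Rightarrow> 'm \<Rightarrow> ('m, 'e) chart set" where
  "charts_at M p = {c \<in> atlas M. p \<in> chart_dom c}"

definition smooth_manifold :: "('m, 'e::euclidean_space) riem \<Rightarrow> bool" where
  "smooth_manifold M \<longleftrightarrow>
     Hausdorff_space (mtop M) \<and> second_countable (mtop M) \<and>
     (\<Union>c\<in>atlas M. chart_dom c) = topspace (mtop M) \<and>
     (\<forall>c\<in>atlas M. openin (mtop M) (chart_dom c) \<and> open (chart_img c) \<and>
        homeomorphic_map (subtopology (mtop M) (chart_dom c)) (top_of_set (chart_img c)) (chart_map c)) \<and>
     (\<forall>c\<in>atlas M. \<forall>d\<in>atlas M.
        smooth_on (chart_map d \<circ> chart_inv c) (chart_map c ` (chart_dom c \<inter> chart_dom d)))"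

definition tangent_space :: "('m, 'e::euclidean_space) riem \<Rightarrow> 'm \<Rightarrow> ('m, 'e) tvec set" where
  "tangent_space M p = {X.
     (\<forall>c\<in>charts_at M p. \<forall>d\<in>charts_at M p.
        coords X d =
          frechet_derivative (chart_map d \<circ> chart_inv c) (at (chart_map c p)) (coords X c)) \<and>
     (\<forall>c. c \<notin> charts_at M p \<longrightarrow> coords X c = 0)}"

definition tangent_of_coords ::
  "('m, 'e::euclidean_space) riem \<Rightarrow> ('m, 'e) chart \<Rightarrow> 'm \<Rightarrow> 'e \<Rightarrow> ('m, 'e) tvec" where
  "tangent_of_coords M c p v = Tvec (\<lambda>d.
     if d \<in> charts_at M p
     then frechet_derivative (chart_map d \<circ> chart_inv c) (at (chart_map c p)) v else 0)"

definition metric_coeff ::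
  "('m, 'e::euclidean_space) riem \<Rightarrow> ('m, 'e) chart \<Rightarrow> 'e \<Rightarrow> 'e \<Rightarrow> 'e \<Rightarrow> real" where
  "metric_coeff M c x v w = rmetric M (chart_inv c x)
     (tangent_of_coords M c (chart_inv c x) v) (tangent_of_coords M c (chart_inv c x) w)"

definition inner_product_on :: "'v::real_vector set \<Rightarrow> ('v \<Rightarrow> 'v \<Rightarrow> real) \<Rightarrow> bool" where
  "inner_product_on S g \<longleftrightarrow>
     (\<forall>X\<in>S. \<forall>Y\<in>S. \<forall>Z\<in>S. g (X + Y) Z = g X Z + g Y Z) \<and>
     (\<forall>a. \<forall>X\<in>S. \<forall>Y\<in>S. g (a *\<^sub>R X) Y = a * g X Y) \<and>
     (\<forall>X\<in>S. \<forall>Y\<in>S. g X Y = g Y X) \<and>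
     (\<forall>X\<in>S. X \<noteq> 0 \<longrightarrow> g X X > 0)"

definition riemannian_manifold :: "('m, 'e::euclidean_space) riem \<Rightarrow> bool" where
  "riemannian_manifold M \<longleftrightarrow> smooth_manifold M \<and>
     (\<forall>p\<in>topspace (mtop M). inner_product_on (tangent_space M p) (rmetric M p)) \<and>
     (\<forall>c\<in>atlas M. \<forall>v w. smooth_on (\<lambda>x. metric_coeff M c x v w) (chart_img c))"

definition rnorm :: "('m, 'e) riem \<Rightarrow> 'm \<Rightarrow> ('m, 'e) tvec \<Rightarrow> real" where
  "rnorm M p X = sqrt (rmetric M p X X)"

text \<open>
  The Christoffel symbols of the Levi-Civita connection in a chart, as a bilinear map on coordinate
  vectors: \<open>\<Gamma>(u, v)\<close> is the coordinate representation of \<open>\<nabla>\<^sub>u v\<close> for the coordinate fields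
  \<open>u\<close> and \<open>v\<close>, given by the Koszul formula (whose bracket terms vanish).
\<close>

definition christoffel ::
  "('m, 'e::euclidean_space) riem \<Rightarrow> ('m, 'e) chart \<Rightarrow> 'e \<Rightarrow> 'e \<Rightarrow> 'e \<Rightarrow> 'e" where
  "christoffel M c x u v = (THE z. \<forall>w.
     metric_coeff M c x z w =
       (frechet_derivative (\<lambda>y. metric_coeff M c y v w) (at x) u
        + frechet_derivative (\<lambda>y. metric_coeff M c y u w) (at x) v
        - frechet_derivative (\<lambda>y. metric_coeff M c y u v) (at x) w) / 2)"

text \<open>
  Sign convention: \<open>R(X, Y)Z = \<nabla>\<^sub>X \<nabla>\<^sub>Y Z - \<nabla>\<^sub>Y \<nabla>\<^sub>X Z - \<nabla>\<^bsub>[X, Y]\<^esub> Z\<close>,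
  evaluated on coordinate fields.
\<close>

definition curvature_coeff ::
  "('m, 'e::euclidean_space) riem \<Rightarrow> ('m, 'e) chart \<Rightarrow> 'e \<Rightarrow> 'e \<Rightarrow> 'e \<Rightarrow> 'e \<Rightarrow> 'e" where
  "curvature_coeff M c x u v w =
     frechet_derivative (\<lambda>y. christoffel M c y v w) (at x) u
     - frechet_derivative (\<lambda>y. christoffel M c y u w) (at x) v
     + christoffel M c x u (christoffel M c x v w)
     - christoffel M c x v (christoffel M c x u w)"

definition curvature ::
  "('m, 'e::euclidean_space) riem \<Rightarrow> 'm \<Rightarrow> ('m, 'e) tvec \<Rightarrow> ('m, 'e) tvec \<Rightarrow> ('m, 'e) tvec
    \<Rightarrow> ('m, 'e) tvec" where
  "curvature M p X Y Z = Tvec (\<lambda>c.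
     if c \<in> charts_at M p
     then curvature_coeff M c (chart_map c p) (coords X c) (coords Y c) (coords Z c) else 0)"

definition sectional_curvature ::
  "('m, 'e::euclidean_space) riem \<Rightarrow> 'm \<Rightarrow> ('m, 'e) tvec \<Rightarrow> ('m, 'e) tvec \<Rightarrow> real" where
  "sectional_curvature M p X Y =
     rmetric M p (curvature M p X Y Y) X /
       (rmetric M p X X * rmetric M p Y Y - (rmetric M p X Y)\<^sup>2)"

text \<open>Curves are restricted to \<open>{0..l}\<close>; all derivatives are taken within this interval.\<close>

definition smooth_curve :: "('m, 'e::euclidean_space) riem \<Rightarrow> real \<Rightarrow> (real \<Rightarrow> 'm) \<Rightarrow> bool" where
  "smooth_curve M l \<gamma> \<longleftrightarrow>
     continuous_map (top_of_set {0..l}) (mtop M) \<gamma> \<and>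
     (\<forall>c\<in>atlas M. smooth_on (chart_map c \<circ> \<gamma>) {t\<in>{0..l}. \<gamma> t \<in> chart_dom c})"

definition velocity ::
  "('m, 'e::euclidean_space) riem \<Rightarrow> real \<Rightarrow> (real \<Rightarrow> 'm) \<Rightarrow> real \<Rightarrow> ('m, 'e) tvec" where
  "velocity M l \<gamma> t = Tvec (\<lambda>c.
     if c \<in> charts_at M (\<gamma> t)
     then vector_derivative (chart_map c \<circ> \<gamma>) (at t within {0..l}) else 0)"

definition vector_field_along ::
  "('m, 'e::euclidean_space) riem \<Rightarrow> real \<Rightarrow> (real \<Rightarrow> 'm) \<Rightarrow> (real \<Rightarrow> ('m, 'e) tvec) \<Rightarrow> bool" where
  "vector_field_along M l \<gamma> V \<longleftrightarrow>
     (\<forall>t\<in>{0..l}. V t \<in> tangent_space M (\<gamma> t)) \<and>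
     (\<forall>c\<in>atlas M. smooth_on (\<lambda>t. coords (V t) c) {t\<in>{0..l}. \<gamma> t \<in> chart_dom c})"

definition cov_deriv ::
  "('m, 'e::euclidean_space) riem \<Rightarrow> real \<Rightarrow> (real \<Rightarrow> 'm) \<Rightarrow> (real \<Rightarrow> ('m, 'e) tvec)
    \<Rightarrow> real \<Rightarrow> ('m, 'e) tvec" where
  "cov_deriv M l \<gamma> V t = Tvec (\<lambda>c.
     if c \<in> charts_at M (\<gamma> t)
     then vector_derivative (\<lambda>s. coords (V s) c) (at t within {0..l})
       + christoffel M c (chart_map c (\<gamma> t)) (coords (velocity M l \<gamma> t) c) (coords (V t) c)
     else 0)"

definition parallel_along ::
  "('m, 'e::euclidean_space) riem \<Rightarrow> real \<Rightarrow> (real \<Rightarrow> 'm) \<Rightarrow> (real \<Rightarrow> ('m, 'e) tvec) \<Rightarrow> bool" where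
  "parallel_along M l \<gamma> V \<longleftrightarrow>
     vector_field_along M l \<gamma> V \<and> (\<forall>t\<in>{0..l}. cov_deriv M l \<gamma> V t = 0)"

definition normal_geodesic :: "('m, 'e::euclidean_space) riem \<Rightarrow> real \<Rightarrow> (real \<Rightarrow> 'm) \<Rightarrow> bool" where
  "normal_geodesic M l \<gamma> \<longleftrightarrow> 0 < l \<and> smooth_curve M l \<gamma> \<and>
     (\<forall>t\<in>{0..l}. cov_deriv M l \<gamma> (velocity M l \<gamma>) t = 0) \<and>
     (\<forall>t\<in>{0..l}. rnorm M (\<gamma> t) (velocity M l \<gamma> t) = 1)"

definition jacobi_field ::
  "('m, 'e::euclidean_space) riem \<Rightarrow> real \<Rightarrow> (real \<Rightarrow> 'm) \<Rightarrow> (real \<Rightarrow> ('m, 'e) tvec) \<Rightarrow> bool" where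
  "jacobi_field M l \<gamma> J \<longleftrightarrow> vector_field_along M l \<gamma> J \<and>
     (\<forall>t\<in>{0..l}. cov_deriv M l \<gamma> (cov_deriv M l \<gamma> J) t
        + curvature M (\<gamma> t) (J t) (velocity M l \<gamma> t) (velocity M l \<gamma> t) = 0)"

text \<open>
  \<open>perp_part M l \<gamma> V t\<close> is the component of \<open>V t\<close> perpendicular to \<open>\<gamma>'(t)\<close>; it is applied both to
  a field \<open>V\<close> and to its covariant derivative.
\<close>

definition perp_part ::
  "('m, 'e::euclidean_space) riem \<Rightarrow> real \<Rightarrow> (real \<Rightarrow> 'm) \<Rightarrow> (real \<Rightarrow> ('m, 'e) tvec)
    \<Rightarrow> real \<Rightarrow> ('m, 'e) tvec" where
  "perp_part M l \<gamma> V t =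
     V t - rmetric M (\<gamma> t) (V t) (velocity M l \<gamma> t) *\<^sub>R velocity M l \<gamma> t"

definition initial_perp ::
  "('m, 'e::euclidean_space) riem \<Rightarrow> real \<Rightarrow> (real \<Rightarrow> 'm) \<Rightarrow> ('m, 'e) tvec set" where
  "initial_perp M l \<gamma> =
     {X \<in> tangent_space M (\<gamma> 0). rmetric M (\<gamma> 0) X (velocity M l \<gamma> 0) = 0}"

definition symmetric_transformation_on ::
  "'v::real_vector set \<Rightarrow> ('v \<Rightarrow> 'v \<Rightarrow> real) \<Rightarrow> ('v \<Rightarrow> 'v) \<Rightarrow> bool" where
  "symmetric_transformation_on S g B \<longleftrightarrow>
     (\<forall>X\<in>S. B X \<in> S) \<and>
     (\<forall>X\<in>S. \<forall>Y\<in>S. B (X + Y) = B X + B Y) \<and>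
     (\<forall>a. \<forall>X\<in>S. B (a *\<^sub>R X) = a *\<^sub>R B X) \<and>
     (\<forall>X\<in>S. \<forall>Y\<in>S. g (B X) Y = g X (B Y))"

text \<open>
  On a finite-dimensional space of positive dimension, the set of eigenvalues of a symmetric
  transformation is finite and non-empty, so that \<open>Min\<close> and \<open>Max\<close> of it are meaningful.
\<close>

definition eigenvalues_on :: "'v::real_vector set \<Rightarrow> ('v \<Rightarrow> 'v) \<Rightarrow> real set" where
  "eigenvalues_on S B = {a. \<exists>X\<in>S. X \<noteq> 0 \<and> B X = a *\<^sub>R X}"

definition focal_point_at ::
  "('m, 'e::euclidean_space) riem \<Rightarrow> real \<Rightarrow> (real \<Rightarrow> 'm) \<Rightarrow> (('m, 'e) tvec \<Rightarrow> ('m, 'e) tvec)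
    \<Rightarrow> real \<Rightarrow> bool" where
  "focal_point_at M l \<gamma> B t \<longleftrightarrow> t \<in> {0<..l} \<and>
     (\<exists>J. jacobi_field M t \<gamma> J \<and> J t = 0 \<and> J 0 \<noteq> 0 \<and> J 0 \<in> initial_perp M l \<gamma> \<and>
          cov_deriv M t \<gamma> J 0 = B (J 0))"

end

theory Submission
  imports Defs
begin

text \<open>
  In a parallel orthonormal frame the perpendicular parts of \<open>V\<close> and \<open>V\<^sub>0\<close> become solutions of
  \<open>w'' + R w = 0\<close> and \<open>u'' + R\<^sub>0 u = 0\<close>, and the tangential parts are the same affine function of \<open>t\<close>.
  Let \<open>A\<close> be the matrix solution of \<open>A'' + R\<^sub>0 A = 0\<close> with \<open>A(0) = 1\<close>, \<open>A'(0) = B\<^sub>0\<close>. It is invertible because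
  there is no focal point, \<open>u = A u(0)\<close>, and \<open>U = A' A\<^sup>-\<^sup>1\<close> is symmetric with \<open>U' + U\<^sup>2 + R\<^sub>0 = 0\<close>.
  For a constant unit vector \<open>c\<close> and \<open>q = U c \<bullet> c\<close>, the function \<open>w' \<bullet> w - q \<bar>w\<bar>\<^sup>2\<close> is nonnegative at \<open>0\<close> by
  the eigenvalue condition, and its derivative is
  \<open>((R\<^sub>0 c \<bullet> c) \<bar>w\<bar>\<^sup>2 - R w \<bullet> w) + \<bar>w' - q w\<bar>\<^sup>2 + \<bar>U c - q c\<bar>\<^sup>2 \<bar>w\<bar>\<^sup>2 \<ge> 0\<close>. Taking \<open>c = u(t)/\<bar>u(t)\<bar>\<close> at
  time \<open>t\<close> shows that \<open>\<bar>w\<bar>/\<bar>u\<bar>\<close> is nondecreasing; equality forces the three terms to vanish.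
  This comparison with a single parallel unit field is why the dimensions need not be related.
\<close>

section \<open>Functions of class $C^k$\<close>

text \<open>The obstacle is that the two Riccati operators cannot be compared with each other: they
  would act on unrelated spaces, and nothing is assumed about focal points in \<open>M\<close>,
  where a matrix solution may degenerate. So in \<open>M\<close> only the solution w is used, and U
  enters through the single number q. The curvature hypothesis admits every pair of directions,
  hence it may be applied to w(s) and the fixed c for all s in [0, t], although u(s) generally
  points elsewhere; only at s = t is q the logarithmic derivative of the norm of u. The term with U
  c - q c accounts for c not being an eigenvector of U. In the equality case the vector c changes
  with the time. The quantity formed with the c of time t vanishes on [0, t], and its derivative at
  the end t gives w' = q w and u' = q u with the same q. Dividing by the norm of w then leaves two
  constant vectors, that is, parallel fields. If w(0) = 0, the relation between w'(0) and w(0) makes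
  w vanish identically and there is nothing to compare.\<close>

definition derivative_set :: "'a::euclidean_space set \<Rightarrow> bool" where
  "derivative_set S \<longleftrightarrow>
     (\<forall>x\<in>S. \<forall>i\<in>Basis. \<forall>e>0. \<exists>d. 0 < \<bar>d\<bar> \<and> \<bar>d\<bar> < e \<and> x + d *\<^sub>R i \<in> S)"

text \<open>Points of the set along every coordinate axis at arbitrarily small distance are what
  uniqueness of the derivative within a set requires. Open sets, nondegenerate intervals and their
  relatively open subsets all have such points, so one calculus serves both charts and
  curves.\<close>

lemma derivative_setD:
  assumes "derivative_set S" "x \<in> S"
    and "(f has_derivative D) (at x within S)" "(f has_derivative D') (at x within S)"
  shows "D = D'"
  using frechet_derivative_unique_within[OF assms(3,4)] assms(1,2)
  unfolding derivative_set_def by blast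

lemma derivative_set_Int_open:
  assumes "derivative_set S" "open N" shows "derivative_set (S \<inter> N)"
  unfolding derivative_set_def
proof (intro ballI allI impI)
  fix x i and e :: real assume x: "x \<in> S \<inter> N" and i: "i \<in> (Basis :: 'a set)" and e: "e > 0"
  obtain r where r: "r > 0" "ball x r \<subseteq> N" using assms(2) x by (meson IntD2 openE)
  obtain d where d: "0 < \<bar>d\<bar>" "\<bar>d\<bar> < min e r" "x + d *\<^sub>R i \<in> S"
    using assms(1) x i e r unfolding derivative_set_def by (metis IntD1 min_less_iff_conj)
  have "x + d *\<^sub>R i \<in> ball x r" using d i by (simp add: dist_norm)
  then show "\<exists>d. 0 < \<bar>d\<bar> \<and> \<bar>d\<bar> < e \<and> x + d *\<^sub>R i \<in> S \<inter> N" using d r by auto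
qed

lemma derivative_set_UNIV: "derivative_set (UNIV :: 'a::euclidean_space set)"
  unfolding derivative_set_def
proof (intro ballI allI impI)
  fix x i :: 'a and e :: real assume "e > 0"
  then show "\<exists>d. 0 < \<bar>d\<bar> \<and> \<bar>d\<bar> < e \<and> x + d *\<^sub>R i \<in> UNIV" by (intro exI[of _ "e/2"]) auto
qed

lemma derivative_set_open: "open S \<Longrightarrow> derivative_set S"
  using derivative_set_Int_open[OF derivative_set_UNIV, of S] by simp

lemma derivative_set_interval:
  assumes "(a::real) < b" shows "derivative_set {a..b}"
  unfolding derivative_set_def
proof (intro ballI allI impI)
  fix x i e :: real assume x: "x \<in> {a..b}" and i: "i \<in> Basis" and e: "e > 0"
  show "\<exists>d. 0 < \<bar>d\<bar> \<and> \<bar>d\<bar> < e \<and> x + d *\<^sub>R i \<in> {a..b}"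
  proof (cases "x < b")
    case True
    then show ?thesis using x i e by (intro exI[of _ "min (e/2) (b - x)"]) auto
  next
    case False
    \<comment> \<open>At the right endpoint only negative increments stay inside, hence the absolute
      values in \<open>derivative_set\<close>.\<close>
    then show ?thesis using x i e assms by (intro exI[of _ "- min (e/2) (b - a)"]) auto
  qed
qed

lemma frechet_derivative_within_eq:
  assumes "derivative_set S" "x \<in> S" "(f has_derivative D) (at x within S)"
  shows "frechet_derivative f (at x within S) = D"
  by (meson assms derivative_setD differentiable_def frechet_derivative_works)

text \<open>\<open>frechet_derivative\<close> is a choice among the derivatives within the set. On a
  \<open>derivative_set\<close> there is at most one, so the values on the set determine all
  iterated derivatives.\<close>

lemma Ck_on_cong_imp:
  assumes S: "derivative_set S"
  shows "(\<And>x. x \<in> S \<Longrightarrow> f x = g x) \<Longrightarrow> Ck_on k f S \<Longrightarrow> Ck_on k g S"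
proof (induction k arbitrary: f g)
  case 0
  then show ?case using continuous_on_eq by fastforce
next
  case (Suc k)
  have f: "(f has_derivative frechet_derivative f (at x within S)) (at x within S)" if "x \<in> S" for x
    using Suc.prems(2) that by (auto simp: differentiable_on_def frechet_derivative_works)
  have g: "(g has_derivative frechet_derivative f (at x within S)) (at x within S)" if "x \<in> S" for x
    by (rule has_derivative_transform[OF that _ f[OF that]]) (use Suc.prems(1) in auto)
  have "frechet_derivative g (at x within S) = frechet_derivative f (at x within S)" if "x \<in> S" for x
    using frechet_derivative_within_eq[OF S that g[OF that]] .
  moreover have "g differentiable_on S"
    using g unfolding differentiable_on_def differentiable_def by blast
  ultimately show ?case using Suc.prems(2)
    by (auto intro: Suc.IH[rotated])
qed

lemma Ck_on_cong:
  assumes "derivative_set S" "\<And>x. x \<in> S \<Longrightarrow> f x = g x"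
  shows "Ck_on k f S \<longleftrightarrow> Ck_on k g S"
  using Ck_on_cong_imp[OF assms(1), of f g k] Ck_on_cong_imp[OF assms(1), of g f k] assms(2) by metis

text \<open>The working form of the recursion: any known derivative may replace the chosen one. The
  closure rules below then reduce to a differentiation rule followed by the induction
  hypothesis.\<close>

lemma Ck_on_Suc_iff:
  assumes "derivative_set S"
    and "\<And>x. x \<in> S \<Longrightarrow> (f has_derivative D x) (at x within S)"
  shows "Ck_on (Suc k) f S \<longleftrightarrow> (\<forall>v. Ck_on k (\<lambda>x. D x v) S)"
proof -
  have "frechet_derivative f (at x within S) = D x" if "x \<in> S" for x
    using frechet_derivative_within_eq[OF assms(1) that assms(2)[OF that]] .
  moreover have "f differentiable_on S"
    using assms(2) unfolding differentiable_on_def differentiable_def by blast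
  ultimately show ?thesis
    using Ck_on_cong[OF assms(1), of "\<lambda>x. D x v" "\<lambda>x. frechet_derivative f (at x within S) v" k for v]
    by auto
qed

lemma Ck_on_Suc_has_derivative:
  assumes "Ck_on (Suc k) f S" "x \<in> S"
  shows "(f has_derivative frechet_derivative f (at x within S)) (at x within S)"
  using assms by (auto simp: differentiable_on_def frechet_derivative_works)

lemma Ck_on_imp_continuous_on: "Ck_on k f S \<Longrightarrow> continuous_on S f"
  by (cases k) (auto intro: differentiable_imp_continuous_on)

lemma Ck_on_SucD: "Ck_on (Suc k) f S \<Longrightarrow> Ck_on k f S"
  by (induction k arbitrary: f) (auto intro: differentiable_imp_continuous_on)

lemma Ck_on_subset:
  assumes "derivative_set S" "derivative_set T" "T \<subseteq> S"
  shows "Ck_on k f S \<Longrightarrow> Ck_on k f T"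
proof (induction k arbitrary: f)
  case 0
  then show ?case using assms(3) continuous_on_subset by auto
next
  case (Suc k)
  have "(f has_derivative frechet_derivative f (at x within S)) (at x within T)" if "x \<in> T" for x
    using Ck_on_Suc_has_derivative[OF Suc.prems] that assms(3) has_derivative_subset by blast
  from Ck_on_Suc_iff[OF assms(2) this] show ?case
    using Suc.prems Suc.IH by auto
qed

text \<open>Along a curve, regularity is known only chart by chart, on relatively open sets of
  times; this passes to the whole interval. The derivative within \<open>S\<close> at x depends only
  on the part of \<open>S\<close> near x.\<close>

lemma Ck_on_local:
  assumes S: "derivative_set S"
  shows "(\<And>x. x \<in> S \<Longrightarrow> \<exists>N. open N \<and> x \<in> N \<and> Ck_on k f (S \<inter> N)) \<Longrightarrow> Ck_on k f S"
proof (induction k arbitrary: f)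
  case 0
  have "continuous (at x within S) f" if x: "x \<in> S" for x
  proof -
    obtain N where "open N" "x \<in> N" "continuous_on (S \<inter> N) f" using 0 x by auto
    moreover from this have "at x within (S \<inter> N) = at x within S" by (intro at_within_nhd[of x N]) auto
    ultimately show ?thesis using x by (metis IntI continuous_on_eq_continuous_within)
  qed
  then show ?case by (simp add: continuous_on_eq_continuous_within)
next
  case (Suc k)
  have w: "at x within (S \<inter> N) = at x within S" if "x \<in> N" "open N" for x N
    by (rule at_within_nhd[OF that(1,2)]) auto
  have d: "(f has_derivative frechet_derivative f (at x within S)) (at x within S)" if x: "x \<in> S" for x
  proof -
    obtain N where "open N" "x \<in> N" "Ck_on (Suc k) f (S \<inter> N)" using Suc.prems x by blast
    then show ?thesis using Ck_on_Suc_has_derivative[of k f "S \<inter> N" x] w x by auto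
  qed
  have "Ck_on k (\<lambda>x. frechet_derivative f (at x within S) v) S" for v
  proof (rule Suc.IH)
    fix x assume x: "x \<in> S"
    obtain N where N: "open N" "x \<in> N" "Ck_on (Suc k) f (S \<inter> N)" using Suc.prems x by blast
    have "Ck_on k (\<lambda>x. frechet_derivative f (at x within (S \<inter> N)) v) (S \<inter> N)" using N by simp
    then have "Ck_on k (\<lambda>x. frechet_derivative f (at x within S) v) (S \<inter> N)"
      by (rule Ck_on_cong_imp[OF derivative_set_Int_open[OF S N(1)], rotated]) (use N w in auto)
    then show "\<exists>N. open N \<and> x \<in> N \<and> Ck_on k (\<lambda>x. frechet_derivative f (at x within S) v) (S \<inter> N)"
      using N by blast
  qed
  then show ?case using Ck_on_Suc_iff[OF S d] by blast
qed

lemma Ck_on_const: "derivative_set S \<Longrightarrow> Ck_on k (\<lambda>x. c) S"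
proof (induction k arbitrary: c)
  case (Suc k)
  then show ?case
    using Ck_on_Suc_iff[OF Suc.prems, of "\<lambda>x. c" "\<lambda>x v. 0" k] by (auto intro: derivative_intros)
qed simp

lemma Ck_on_add:
  assumes "derivative_set S"
  shows "Ck_on k f S \<Longrightarrow> Ck_on k g S \<Longrightarrow> Ck_on k (\<lambda>x. f x + g x) S"
proof (induction k arbitrary: f g)
  case (Suc k)
  have "((\<lambda>x. f x + g x) has_derivative (\<lambda>v. frechet_derivative f (at x within S) v +
     frechet_derivative g (at x within S) v)) (at x within S)" if "x \<in> S" for x
    using Suc.prems that by (intro has_derivative_add Ck_on_Suc_has_derivative)
  from Ck_on_Suc_iff[OF assms this] show ?case using Suc by auto
qed (auto intro: continuous_intros)

lemma Ck_on_linear: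
  assumes "derivative_set S" "bounded_linear h"
  shows "Ck_on k f S \<Longrightarrow> Ck_on k (\<lambda>x. h (f x)) S"
proof (induction k arbitrary: f)
  case (Suc k)
  have "((\<lambda>x. h (f x)) has_derivative (\<lambda>v. h (frechet_derivative f (at x within S) v))) (at x within S)"
    if "x \<in> S" for x
    using Suc.prems that
    by (intro bounded_linear.has_derivative[OF assms(2)] Ck_on_Suc_has_derivative)
  from Ck_on_Suc_iff[OF assms(1) this] show ?case using Suc by auto
qed (use assms in \<open>auto intro: bounded_linear.continuous_on\<close>)

lemma Ck_on_bilinear:
  assumes "derivative_set S" "bounded_bilinear h"
  shows "Ck_on k f S \<Longrightarrow> Ck_on k g S \<Longrightarrow> Ck_on k (\<lambda>x. h (f x) (g x)) S"
proof (induction k arbitrary: f g)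
  case (Suc k)
  have "((\<lambda>x. h (f x) (g x)) has_derivative (\<lambda>v. h (f x) (frechet_derivative g (at x within S) v)
    + h (frechet_derivative f (at x within S) v) (g x))) (at x within S)" if "x \<in> S" for x
    using Suc.prems that
    by (intro bounded_bilinear.FDERIV[OF assms(2)] Ck_on_Suc_has_derivative)
  note iff = Ck_on_Suc_iff[OF assms(1) this]
  have "Ck_on k (\<lambda>x. h (f x) (frechet_derivative g (at x within S) v)
    + h (frechet_derivative f (at x within S) v) (g x)) S" for v
    using Suc.prems Ck_on_SucD[OF Suc.prems(1)] Ck_on_SucD[OF Suc.prems(2)]
    by (intro Ck_on_add[OF assms(1)] Suc.IH) auto
  then show ?case using iff by blast
qed (use assms in \<open>auto intro: bounded_bilinear.continuous_on\<close>)

lemmas Ck_on_scaleR = Ck_on_bilinear[OF _ bounded_bilinear_scaleR]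
lemmas Ck_on_inner = Ck_on_bilinear[OF _ bounded_bilinear_inner]

lemma Ck_on_minus: "derivative_set S \<Longrightarrow> Ck_on k f S \<Longrightarrow> Ck_on k (\<lambda>x. - f x) S"
  by (rule Ck_on_linear[OF _ bounded_linear_minus[OF bounded_linear_ident]])

lemma Ck_on_diff:
  "derivative_set S \<Longrightarrow> Ck_on k f S \<Longrightarrow> Ck_on k g S \<Longrightarrow> Ck_on k (\<lambda>x. f x - g x) S"
  using Ck_on_add[of S k f "\<lambda>x. - g x"] Ck_on_minus[of S k g] by simp

lemma Ck_on_sum:
  assumes "derivative_set S" "\<And>i. i \<in> I \<Longrightarrow> Ck_on k (f i) S"
  shows "Ck_on k (\<lambda>x. \<Sum>i\<in>I. f i x) S"
  using assms(2) by (induction I rule: infinite_finite_induct) (auto intro: Ck_on_add assms(1) Ck_on_const)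

lemma linear_Basis_expand:
  fixes F :: "'a::euclidean_space \<Rightarrow> 'b::real_vector"
  assumes "linear F" shows "F u = (\<Sum>b\<in>Basis. (u \<bullet> b) *\<^sub>R F b)"
proof -
  have "F u = F (\<Sum>b\<in>Basis. (u \<bullet> b) *\<^sub>R b)" by (simp add: euclidean_representation)
  also have "\<dots> = (\<Sum>b\<in>Basis. (u \<bullet> b) *\<^sub>R F b)"
    by (simp add: linear_sum[OF assms] linear_cmul[OF assms])
  finally show ?thesis .
qed

text \<open>Expanding \<open>u x\<close> in the standard basis leaves finitely many scalar multiples
  of \<open>F x b\<close>. Metric, Christoffel symbols and curvature are known to be smooth for
  constant arguments, and this is how they are evaluated on moving vectors.\<close>

lemma Ck_on_lin_apply:
  fixes F :: "'a::euclidean_space \<Rightarrow> 'b::euclidean_space \<Rightarrow> 'c::real_normed_vector"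
  assumes S: "derivative_set S"
    and lin: "\<And>x. x \<in> S \<Longrightarrow> linear (F x)"
    and F: "\<And>b. b \<in> Basis \<Longrightarrow> Ck_on k (\<lambda>x. F x b) S" and u: "Ck_on k u S"
  shows "Ck_on k (\<lambda>x. F x (u x)) S"
proof -
  have "Ck_on k (\<lambda>x. \<Sum>b\<in>Basis. (u x \<bullet> b) *\<^sub>R F x b) S"
    by (intro Ck_on_sum Ck_on_scaleR Ck_on_inner Ck_on_const S F u)
  then show ?thesis
    by (rule Ck_on_cong_imp[OF S, rotated]) (simp add: linear_Basis_expand[OF lin, symmetric])
qed

lemma has_derivative_lin_apply:
  fixes F :: "'a::real_normed_vector \<Rightarrow> 'b::euclidean_space \<Rightarrow> 'c::real_normed_vector"
  assumes lin: "\<And>y. y \<in> S \<Longrightarrow> linear (F y)" and x: "x \<in> S"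
    and F: "\<And>b. ((\<lambda>y. F y b) has_derivative D b) (at x within S)"
    and u: "(u has_derivative u') (at x within S)"
  shows "((\<lambda>y. F y (u y)) has_derivative (\<lambda>v. D (u x) v + F x (u' v))) (at x within S)"
proof -
  have 1: "((\<lambda>y. \<Sum>b\<in>Basis. (u y \<bullet> b) *\<^sub>R F y b) has_derivative
    (\<lambda>v. \<Sum>b\<in>Basis. (u x \<bullet> b) *\<^sub>R D b v + (u' v \<bullet> b) *\<^sub>R F x b)) (at x within S)"
    by (rule has_derivative_sum) (auto intro!: derivative_eq_intros F u)
  have 2: "((\<lambda>y. \<Sum>b\<in>Basis. (u x \<bullet> b) *\<^sub>R F y b) has_derivative
    (\<lambda>v. \<Sum>b\<in>Basis. (u x \<bullet> b) *\<^sub>R D b v)) (at x within S)"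
    by (rule has_derivative_sum) (auto intro!: derivative_eq_intros F u)
  have 4: "((\<lambda>y. F y (u y) - F y (u x)) has_derivative
      (\<lambda>v. \<Sum>b\<in>Basis. (u' v \<bullet> b) *\<^sub>R F x b)) (at x within S)"
    by (rule has_derivative_transform[OF x _ has_derivative_diff[OF 1 2, THEN has_derivative_eq_rhs]])
       (use linear_Basis_expand[OF lin] in \<open>auto simp: sum_subtractf[symmetric] sum.distrib\<close>)
  have "((\<lambda>y. (F y (u y) - F y (u x)) + F y (u x)) has_derivative
      (\<lambda>v. (\<Sum>b\<in>Basis. (u' v \<bullet> b) *\<^sub>R F x b) + D (u x) v)) (at x within S)"
    by (intro has_derivative_add 4 F)
  moreover have "(\<Sum>b\<in>Basis. (u' v \<bullet> b) *\<^sub>R F x b) = F x (u' v)" for v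
    using linear_Basis_expand[OF lin[OF x], of "u' v"] by simp
  ultimately show ?thesis by (simp add: add.commute)
qed

text \<open>By the chain rule the derivative is a varying linear map applied to a varying vector;
  the values of that map on basis vectors are compositions again, with \<open>?g'\<close> in place
  of g, which is why g is generalised in the induction.\<close>

lemma Ck_on_compose:
  fixes g :: "'b::euclidean_space \<Rightarrow> 'c::real_normed_vector" and f :: "'a::euclidean_space \<Rightarrow> 'b"
  assumes S: "derivative_set S" and T: "derivative_set T" and fT: "f ` S \<subseteq> T"
  shows "Ck_on k f S \<Longrightarrow> Ck_on k g T \<Longrightarrow> Ck_on k (\<lambda>x. g (f x)) S"
proof (induction k arbitrary: g)
  case 0
  then show ?case using continuous_on_compose2[OF _ _ fT, of g] by auto
next
  case (Suc k)
  let ?f' = "\<lambda>x. frechet_derivative f (at x within S)"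
  let ?g' = "\<lambda>x. frechet_derivative g (at x within T)"
  have d: "((\<lambda>x. g (f x)) has_derivative (\<lambda>v. ?g' (f x) (?f' x v))) (at x within S)" if x: "x \<in> S" for x
  proof -
    have "(g has_derivative ?g' (f x)) (at (f x) within f ` S)"
      using Ck_on_Suc_has_derivative[OF Suc.prems(2), of "f x"] fT x has_derivative_subset by blast
    from has_derivative_in_compose[OF Ck_on_Suc_has_derivative[OF Suc.prems(1) x] this]
    show ?thesis .
  qed
  have "Ck_on k (\<lambda>x. ?g' (f x) (?f' x v)) S" for v
  proof (rule Ck_on_lin_apply[OF S])
    show "linear (?g' (f x))" if "x \<in> S" for x
      using Ck_on_Suc_has_derivative[OF Suc.prems(2), of "f x"] fT that
        has_derivative_bounded_linear bounded_linear.linear by blast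
    show "Ck_on k (\<lambda>x. ?g' (f x) b) S" for b
      using Suc.IH[OF Ck_on_SucD[OF Suc.prems(1)], of "\<lambda>y. ?g' y b"] Suc.prems(2) by simp
    show "Ck_on k (\<lambda>x. ?f' x v) S" using Suc.prems(1) by simp
  qed
  with Ck_on_Suc_iff[OF S d] show ?case by blast
qed

section \<open>Solutions of linear equations depending on a parameter\<close>

lemma onorm_le_sum_Basis:
  fixes F :: "'a::euclidean_space \<Rightarrow> 'b::real_normed_vector"
  assumes "linear F" shows "norm (F u) \<le> (\<Sum>b\<in>Basis. norm (F b)) * norm u"
proof -
  have "norm (F u) \<le> (\<Sum>b\<in>Basis. norm ((u \<bullet> b) *\<^sub>R F b))"
    by (subst linear_Basis_expand[OF assms]) (rule norm_sum)
  also have "\<dots> \<le> (\<Sum>b\<in>Basis. norm (F b) * norm u)"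
    by (rule sum_mono) (auto simp: mult.commute[of "norm (F _)"] intro!: mult_right_mono Basis_le_norm)
  finally show ?thesis by (simp add: sum_distrib_right)
qed

text \<open>With \<open>L\<close> the inverse of \<open>F x\<close>, everything rests on
  \<open>z y - z x = L ((h y - h x) - (F y - F x) (z y))\<close>.\<close>

lemma linear_solution_identity:
  assumes "linear (F x)" "linear (F y)" "linear L" "L \<circ> F x = id" "F x (z x) = h x" "F y (z y) = h y"
  shows "z y - z x = L ((h y - h x) - (F y (z y) - F x (z y)))"
proof -
  have "(h y - h x) - (F y (z y) - F x (z y)) = F x (z y - z x)"
    using assms by (simp add: linear_diff)
  then show ?thesis using assms(4) by (metis comp_apply id_apply)
qed

lemma continuous_linear_solution:
  fixes F :: "'a::metric_space \<Rightarrow> 'b::euclidean_space \<Rightarrow> 'b"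
  assumes lin: "\<And>x. x \<in> S \<Longrightarrow> linear (F x)" and inj: "\<And>x. x \<in> S \<Longrightarrow> inj (F x)"
    and F: "\<And>b. continuous_on S (\<lambda>x. F x b)" and h: "continuous_on S h"
    and z: "\<And>x. x \<in> S \<Longrightarrow> F x (z x) = h x"
  shows "continuous_on S z"
  unfolding continuous_on_def
proof
  fix x assume x: "x \<in> S"
  obtain L where L: "linear L" "L \<circ> F x = id"
    using linear_injective_left_inverse[OF lin[OF x] inj[OF x]] by blast
  obtain K where K: "K > 0" "\<And>v. norm (L v) \<le> K * norm v"
    using linear_bounded_pos[OF L(1)] by blast
  \<comment> \<open>A bound for the operator norm of \<open>F y - F x\<close> by values on basis
    vectors only, so that continuity of each \<open>F x b\<close> makes it tend to 0.\<close>
  define e where "e y = (\<Sum>b\<in>Basis. norm (F y b - F x b))" for y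
  have e: "(e \<longlongrightarrow> 0) (at x within S)"
  proof -
    have "((\<lambda>y. \<Sum>b\<in>Basis. norm (F y b - F x b)) \<longlongrightarrow> (\<Sum>b\<in>Basis. norm (F x b - F x b))) (at x within S)"
      using F x by (intro tendsto_intros) (auto simp: continuous_on_def)
    then show ?thesis by (simp add: e_def[abs_def])
  qed
  have hx: "(h \<longlongrightarrow> h x) (at x within S)" using h x by (auto simp: continuous_on_def)
  have b1: "norm (z y - z x) \<le> K * (norm (h y - h x) + e y * norm (z y))" if y: "y \<in> S" for y
  proof -
    have "norm (F y (z y) - F x (z y)) \<le> e y * norm (z y)"
      unfolding e_def using onorm_le_sum_Basis[OF linear_compose_sub[OF lin[OF y] lin[OF x]], of "z y"] by simp
    then have "norm ((h y - h x) - (F y (z y) - F x (z y))) \<le> norm (h y - h x) + e y * norm (z y)"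
      using norm_triangle_ineq4[of "h y - h x" "F y (z y) - F x (z y)"] by linarith
    moreover have "norm (z y - z x) \<le> K * norm ((h y - h x) - (F y (z y) - F x (z y)))"
      using linear_solution_identity[OF lin[OF x] lin[OF y] L, of z h] z x y K(2) by metis
    ultimately show ?thesis using K(1) by (meson mult_left_mono order.trans less_imp_le)
  qed
  \<comment> \<open>The unknown \<open>z y\<close> also stands on the right of \<open>b1\<close>.
    Once \<open>e y\<close> is below 1/(2K), half of the left side absorbs it, which costs the
    factor 2.\<close>
  have ev: "\<forall>\<^sub>F y in at x within S. norm (z y - z x) \<le> 2 * K * (norm (h y - h x) + e y * norm (z x))"
  proof -
    have "\<forall>\<^sub>F y in at x within S. e y < 1 / (2 * K)"
      using order_tendstoD(2)[OF e, of "1 / (2 * K)"] K by simp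
    moreover have "\<forall>\<^sub>F y in at x within S. y \<in> S" by (simp add: eventually_at_filter)
    ultimately show ?thesis
    proof eventually_elim
      case (elim y)
      have e0: "e y \<ge> 0" unfolding e_def by (simp add: sum_nonneg)
      have "norm (z y) \<le> norm (z x) + norm (z y - z x)"
        using norm_triangle_sub by blast
      then have "K * (e y * norm (z y)) \<le> K * (e y * norm (z x)) + (K * e y) * norm (z y - z x)"
        using mult_left_mono[of "norm (z y)" "norm (z x) + norm (z y - z x)" "K * e y"] e0 K(1)
        by (simp add: distrib_left mult.assoc)
      moreover have "(K * e y) * norm (z y - z x) \<le> (1/2) * norm (z y - z x)"
        using elim(1) K by (intro mult_right_mono) (auto simp: field_simps)
      ultimately show ?case using b1[OF elim(2)] by (simp add: algebra_simps)
    qed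
  qed
  have "((\<lambda>y. 2 * K * (norm (h y - h x) + e y * norm (z x))) \<longlongrightarrow> 2 * K * (norm (h x - h x) + 0 * norm (z x))) (at x within S)"
    by (intro tendsto_intros hx e)
  then have "((\<lambda>y. 2 * K * (norm (h y - h x) + e y * norm (z x))) \<longlongrightarrow> 0) (at x within S)" by simp
  from Lim_null_comparison[OF ev this]
  show "(z \<longlongrightarrow> z x) (at x within S)" by (rule LIM_zero_cancel)
qed

text \<open>f is of the order of the increment and s tends to 0, so the product is of smaller order;
  s need not be differentiable. This serves the product of the increments of F and z while z is only
  known to be continuous.\<close>

lemma has_derivative_zero_times_vanishing:
  fixes s :: "'a::real_normed_vector \<Rightarrow> real" and f :: "'a \<Rightarrow> 'b::real_normed_vector"
  assumes f: "(f has_derivative D) (at x within S)" and "f x = 0"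
    and s: "(s \<longlongrightarrow> 0) (at x within S)"
  shows "((\<lambda>y. s y *\<^sub>R f y) has_derivative (\<lambda>v. 0)) (at x within S)"
proof -
  obtain K where K: "\<And>v. norm (D v) \<le> norm v * K"
    using bounded_linear.bounded[OF has_derivative_bounded_linear[OF f]] by blast
  have 1: "((\<lambda>y. norm (f y - D (y - x)) / norm (y - x)) \<longlongrightarrow> 0) (at x within S)"
    using f assms(2) unfolding has_derivative_iff_norm by simp
  have 2: "((\<lambda>y. \<bar>s y\<bar> * (norm (f y - D (y - x)) / norm (y - x) + K)) \<longlongrightarrow> \<bar>0\<bar> * (0 + K)) (at x within S)"
    by (intro tendsto_intros s 1)
  have 3: "norm (norm (s y *\<^sub>R f y) / norm (y - x)) \<le>
      \<bar>s y\<bar> * (norm (f y - D (y - x)) / norm (y - x) + K)" if "y \<noteq> x" for y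
  proof -
    have "norm (f y) \<le> norm (f y - D (y - x)) + norm (y - x) * K"
      using norm_triangle_sub[of "f y" "D (y - x)"] K[of "y - x"] by linarith
    then have "norm (f y) / norm (y - x) \<le> norm (f y - D (y - x)) / norm (y - x) + K"
      using that by (simp add: field_simps)
    from mult_left_mono[OF this, of "\<bar>s y\<bar>"] show ?thesis by simp
  qed
  have "((\<lambda>y. norm (s y *\<^sub>R f y) / norm (y - x)) \<longlongrightarrow> 0) (at x within S)"
    by (rule Lim_null_comparison[OF _ 2[simplified]])
       (use 3 in \<open>auto simp: eventually_at_filter\<close>)
  then show ?thesis by (simp add: has_derivative_iff_norm assms(2))
qed

text \<open>The product rule would presuppose differentiability of z. Instead the increment of F at
  \<open>z y\<close> is split into the one at the fixed vector \<open>z x\<close>, differentiable by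
  assumption, and the remainder \<open>?r\<close>, a sum of products of vanishing increments with
  derivative 0.\<close>

lemma has_derivative_linear_solution:
  fixes F :: "'a::euclidean_space \<Rightarrow> 'b::euclidean_space \<Rightarrow> 'b"
  assumes lin: "\<And>x. x \<in> S \<Longrightarrow> linear (F x)" and inj: "\<And>x. x \<in> S \<Longrightarrow> inj (F x)"
    and F: "\<And>b x. x \<in> S \<Longrightarrow> ((\<lambda>x. F x b) has_derivative D x b) (at x within S)"
    and h: "\<And>x. x \<in> S \<Longrightarrow> (h has_derivative h' x) (at x within S)"
    and z: "\<And>x. x \<in> S \<Longrightarrow> F x (z x) = h x" and x: "x \<in> S"
  shows "\<exists>z'. (z has_derivative z') (at x within S) \<and> (\<forall>v. F x (z' v) = h' x v - D x (z x) v)"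
proof -
  obtain L where L: "linear L" "F x \<circ> L = id" "L \<circ> F x = id"
    using linear_injective_isomorphism[OF lin[OF x] inj[OF x]] by (auto simp: o_def id_def)
  have zc: "continuous_on S z"
  proof (rule continuous_linear_solution[OF lin inj _ _ z])
    show "continuous_on S (\<lambda>x. F x b)" for b
      by (rule has_derivative_continuous_on, rule F)
    show "continuous_on S h" by (rule has_derivative_continuous_on, rule h)
  qed
  let ?r = "\<lambda>y. \<Sum>b\<in>Basis. ((z y - z x) \<bullet> b) *\<^sub>R (F y b - F x b)"
  have r: "(?r has_derivative (\<lambda>v. \<Sum>b\<in>(Basis::'b set). 0)) (at x within S)"
  proof (rule has_derivative_sum, rule has_derivative_zero_times_vanishing)
    fix b :: 'b
    show "((\<lambda>y. F y b - F x b) has_derivative (\<lambda>v. D x b v - 0)) (at x within S)"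
      by (intro has_derivative_diff F x) simp
    have "((\<lambda>y. (z y - z x) \<bullet> b) \<longlongrightarrow> (z x - z x) \<bullet> b) (at x within S)"
      using zc x by (intro tendsto_intros) (auto simp: continuous_on_def)
    then show "((\<lambda>y. (z y - z x) \<bullet> b) \<longlongrightarrow> 0) (at x within S)" by simp
  qed simp
  have r_eq: "?r y = (F y (z y) - F x (z y)) - (F y (z x) - F x (z x))" if "y \<in> S" for y
  proof -
    have "?r y = F y (z y - z x) - F x (z y - z x)"
      using linear_Basis_expand[OF linear_compose_sub[OF lin[OF that] lin[OF x]], of "z y - z x"]
      by simp
    then show ?thesis using lin[OF that] lin[OF x] by (simp add: linear_diff)
  qed
  have d: "((\<lambda>y. h y - h x - (F y (z x) - F x (z x)) - ?r y) has_derivative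
      (\<lambda>v. h' x v - 0 - (D x (z x) v - 0) - (\<Sum>b\<in>(Basis::'b set). 0))) (at x within S)"
    by (intro has_derivative_diff h F x r) auto
  have "((\<lambda>y. L (h y - h x - (F y (z x) - F x (z x)) - ?r y) + z x) has_derivative
      (\<lambda>v. L (h' x v - 0 - (D x (z x) v - 0) - (\<Sum>b\<in>(Basis::'b set). 0)) + 0)) (at x within S)"
    using d L(1) by (intro has_derivative_add bounded_linear.has_derivative[of L])
      (auto simp: linear_conv_bounded_linear)
  moreover have "z y = L (h y - h x - (F y (z x) - F x (z x)) - ?r y) + z x" if "y \<in> S" for y
  proof -
    have "h y - h x - (F y (z x) - F x (z x)) - ?r y = h y - h x - (F y (z y) - F x (z y))"
      unfolding r_eq[OF that] by simp
    then show ?thesis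
      using linear_solution_identity[where F=F and h=h, OF lin[OF x] lin[OF that] L(1) L(3) z[OF x] z[OF that]]
      by (metis diff_add_cancel)
  qed
  ultimately have "(z has_derivative (\<lambda>v. L (h' x v - 0 - (D x (z x) v - 0) - (\<Sum>b\<in>(Basis::'b set). 0)) + 0))
      (at x within S)"
    by (rule has_derivative_transform[OF x, rotated])
  then have "(z has_derivative (\<lambda>v. L (h' x v - D x (z x) v))) (at x within S)" by simp
  moreover have "F x (L v) = v" for v using L(2) by (metis comp_apply id_apply)
  ultimately show ?thesis by blast
qed

text \<open>The derivative of the solution solves an equation with the same F, whose right-hand side
  involves only the derivatives of h and F and z itself, so the induction hypothesis applies to it.
  Smoothness of the Christoffel symbols follows this way, with no inverse matrix written
  down.\<close>

lemma Ck_on_linear_solution: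
  fixes F :: "'a::euclidean_space \<Rightarrow> 'b::euclidean_space \<Rightarrow> 'b"
  assumes S: "derivative_set S"
    and lin: "\<And>x. x \<in> S \<Longrightarrow> linear (F x)" and inj: "\<And>x. x \<in> S \<Longrightarrow> inj (F x)"
  shows "(\<And>b. Ck_on k (\<lambda>x. F x b) S) \<Longrightarrow> Ck_on k h S \<Longrightarrow> (\<And>x. x \<in> S \<Longrightarrow> F x (z x) = h x) \<Longrightarrow> Ck_on k z S"
proof (induction k arbitrary: h z)
  case 0
  show ?case
    using continuous_linear_solution[of S F h z, OF lin inj] 0 by simp
next
  case (Suc k)
  let ?D = "\<lambda>x b. frechet_derivative (\<lambda>x. F x b) (at x within S)"
  let ?h' = "\<lambda>x. frechet_derivative h (at x within S)"
  have F: "((\<lambda>x. F x b) has_derivative ?D x b) (at x within S)" if "x \<in> S" for x b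
    using Ck_on_Suc_has_derivative[OF Suc.prems(1) that] .
  have h: "(h has_derivative ?h' x) (at x within S)" if "x \<in> S" for x
    using Ck_on_Suc_has_derivative[OF Suc.prems(2) that] .
  obtain z' where z': "\<And>x. x \<in> S \<Longrightarrow> (z has_derivative z' x) (at x within S)"
      "\<And>x v. x \<in> S \<Longrightarrow> F x (z' x v) = ?h' x v - ?D x (z x) v"
    using has_derivative_linear_solution[where F=F and z=z, OF lin inj F h Suc.prems(3)] by metis
  have zk: "Ck_on k z S" using Suc by (meson Ck_on_SucD)
  have Dlin: "linear (\<lambda>b. ?D x b v)" if x: "x \<in> S" for x v
  proof (rule linearI)
    fix a b and r :: real
    have "((\<lambda>x. F x (a + b)) has_derivative (\<lambda>v. ?D x a v + ?D x b v)) (at x within S)"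
      by (rule has_derivative_transform[OF x _ has_derivative_add[OF F[OF x] F[OF x]]])
         (simp add: linear_add[OF lin])
    from frechet_derivative_within_eq[OF S x this]
    show "?D x (a + b) v = ?D x a v + ?D x b v" by simp
    have "((\<lambda>x. F x (r *\<^sub>R b)) has_derivative (\<lambda>v. r *\<^sub>R ?D x b v)) (at x within S)"
      by (rule has_derivative_transform[OF x _ has_derivative_scaleR_right[OF F[OF x]]])
         (simp add: linear_cmul[OF lin])
    from frechet_derivative_within_eq[OF S x this]
    show "?D x (r *\<^sub>R b) v = r *\<^sub>R ?D x b v" by simp
  qed
  have "Ck_on k (\<lambda>x. z' x v) S" for v
  proof (rule Suc.IH[OF _ _ z'(2)])
    show "Ck_on k (\<lambda>x. F x b) S" for b using Ck_on_SucD Suc.prems(1) by blast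
    show "Ck_on k (\<lambda>x. ?h' x v - ?D x (z x) v) S"
      using Suc.prems(1,2)
      by (intro Ck_on_diff[OF S] Ck_on_lin_apply[OF S Dlin _ zk]) auto
  qed
  with Ck_on_Suc_iff[OF S z'(1)] show ?case by blast
qed

section \<open>Symmetry of second derivatives\<close>

lemma has_derivative_along_line:
  fixes f :: "'a::real_normed_vector \<Rightarrow> real"
  assumes "(f has_derivative D) (at (x + s *\<^sub>R u))"
  shows "((\<lambda>s. f (x + s *\<^sub>R u)) has_real_derivative D u) (at s)"
proof -
  have "((\<lambda>s. x + s *\<^sub>R u) has_derivative (\<lambda>r. r *\<^sub>R u)) (at s)"
    by (auto intro!: derivative_eq_intros)
  from has_derivative_compose[OF this assms]
  have "((\<lambda>s. f (x + s *\<^sub>R u)) has_derivative (\<lambda>r. D (r *\<^sub>R u))) (at s)" .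
  moreover have "D (r *\<^sub>R u) = r * D u" for r
    using has_derivative_bounded_linear[OF assms] by (simp add: bounded_linear.linear linear_cmul)
  ultimately show ?thesis unfolding has_field_derivative_def by (simp add: mult.commute[of _ "D u"] fun_eq_iff)
qed

text \<open>The mean value theorem is applied in direction u to the difference of f along two
  parallel segments, then in direction v. The second difference is symmetric in u and v, while the
  mixed derivative found is not visibly so.\<close>

lemma second_difference_mvt:
  fixes f :: "'a::real_normed_vector \<Rightarrow> real"
  assumes h: "h > 0"
    and inS: "\<And>s t. 0 \<le> s \<Longrightarrow> s \<le> h \<Longrightarrow> 0 \<le> t \<Longrightarrow> t \<le> h \<Longrightarrow> x + s *\<^sub>R u + t *\<^sub>R v \<in> S"
    and f: "\<And>y. y \<in> S \<Longrightarrow> (f has_derivative f' y) (at y)"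
    and f'': "\<And>y. y \<in> S \<Longrightarrow> ((\<lambda>y. f' y u) has_derivative f'' y) (at y)"
  shows "\<exists>s t. 0 \<le> s \<and> s \<le> h \<and> 0 \<le> t \<and> t \<le> h \<and>
    f (x + h *\<^sub>R u + h *\<^sub>R v) - f (x + h *\<^sub>R u) - f (x + h *\<^sub>R v) + f x
      = h * h * f'' (x + s *\<^sub>R u + t *\<^sub>R v) v"
proof -
  let ?g = "\<lambda>s. f (x + h *\<^sub>R v + s *\<^sub>R u) - f (x + s *\<^sub>R u)"
  have g: "(?g has_real_derivative f' (x + h *\<^sub>R v + s *\<^sub>R u) u - f' (x + s *\<^sub>R u) u) (at s)"
    if "0 \<le> s" "s \<le> h" for s
    using inS[of s h] inS[of s 0] that h
    by (intro DERIV_diff has_derivative_along_line f) (auto simp: algebra_simps)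
  obtain s where s: "0 < s" "s < h"
    "?g h - ?g 0 = (h - 0) * (f' (x + h *\<^sub>R v + s *\<^sub>R u) u - f' (x + s *\<^sub>R u) u)"
    using MVT2[OF h g] by blast
  let ?k = "\<lambda>t. f' (x + s *\<^sub>R u + t *\<^sub>R v) u"
  have k: "(?k has_real_derivative f'' (x + s *\<^sub>R u + t *\<^sub>R v) v) (at t)" if "0 \<le> t" "t \<le> h" for t
    using inS[of s t] that s by (intro has_derivative_along_line f'') auto
  obtain t where t: "0 < t" "t < h" "?k h - ?k 0 = (h - 0) * f'' (x + s *\<^sub>R u + t *\<^sub>R v) v"
    using MVT2[OF h k] by blast
  have "?g h - ?g 0 = h * (?k h - ?k 0)" using s(3) by (simp add: algebra_simps)
  also have "\<dots> = h * h * f'' (x + s *\<^sub>R u + t *\<^sub>R v) v" using t(3) by simp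
  finally show ?thesis using s t
    by (intro exI[of _ s] exI[of _ t]) (simp add: algebra_simps)
qed

text \<open>Both mixed derivatives, taken at suitable points near x, equal the same second
  difference divided by \<open>h * h\<close>; continuity at x carries the equality over to
  x.\<close>

lemma second_derivative_symmetric_real:
  fixes f :: "'a::real_normed_vector \<Rightarrow> real"
  assumes S: "open S" "x \<in> S"
    and f: "\<And>y. y \<in> S \<Longrightarrow> (f has_derivative f' y) (at y)"
    and fu: "\<And>y. y \<in> S \<Longrightarrow> ((\<lambda>y. f' y u) has_derivative fu y) (at y)"
    and fv: "\<And>y. y \<in> S \<Longrightarrow> ((\<lambda>y. f' y v) has_derivative fv y) (at y)"
    and cu: "continuous_on S (\<lambda>y. fu y v)" and cv: "continuous_on S (\<lambda>y. fv y u)"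
  shows "fu x v = fv x u"
proof (rule ccontr)
  assume ne: "fu x v \<noteq> fv x u"
  define e where "e = \<bar>fu x v - fv x u\<bar> / 2"
  have e: "e > 0" using ne by (simp add: e_def)
  have "isCont (\<lambda>y. fu y v) x" "isCont (\<lambda>y. fv y u) x"
    using cu cv S continuous_on_eq_continuous_at by blast+
  then have "\<forall>\<^sub>F y in at x. dist (fu y v) (fu x v) < e" "\<forall>\<^sub>F y in at x. dist (fv y u) (fv x u) < e"
    using e by (auto simp: isCont_def tendsto_iff)
  moreover have "\<forall>\<^sub>F y in at x. y \<in> S" using S by (simp add: eventually_at_topological) blast
  ultimately have "\<forall>\<^sub>F y in at x. dist (fu y v) (fu x v) < e \<and> dist (fv y u) (fv x u) < e \<and> y \<in> S"
    by eventually_elim auto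
  then obtain d where d: "d > 0"
    "\<And>y. y \<noteq> x \<Longrightarrow> dist y x < d \<Longrightarrow> dist (fu y v) (fu x v) < e \<and> dist (fv y u) (fv x u) < e \<and> y \<in> S"
    unfolding eventually_at by auto
  have d': "dist (fu y v) (fu x v) < e \<and> dist (fv y u) (fv x u) < e \<and> y \<in> S" if "dist y x < d" for y
    using d(2)[of y] that e S by (cases "y = x") auto
  \<comment> \<open>Keeps the parallelogram with sides \<open>h *\<^sub>R u\<close> and
    \<open>h *\<^sub>R v\<close> within distance d of x; the summand 1 keeps the denominator
    positive for u = v = 0.\<close>
  define h where "h = d / (2 * (norm u + norm v + 1))"
  have pos: "0 < norm u + norm v + 1" by (simp add: add_nonneg_pos)
  have h: "h > 0" unfolding h_def using d pos by simp
  have hd: "h * norm u + h * norm v < d"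
  proof -
    have "h * norm u + h * norm v \<le> h * (norm u + norm v + 1)" using h by (simp add: algebra_simps)
    also have "\<dots> = d / 2" unfolding h_def using pos by (simp add: field_simps)
    finally show ?thesis using d by simp
  qed
  have near: "dist (x + s *\<^sub>R u + t *\<^sub>R v) x < d" if "0 \<le> s" "s \<le> h" "0 \<le> t" "t \<le> h" for s t
  proof -
    have "norm (s *\<^sub>R u + t *\<^sub>R v) \<le> s * norm u + t * norm v"
      using norm_triangle_ineq[of "s *\<^sub>R u" "t *\<^sub>R v"] that by simp
    also have "\<dots> \<le> h * norm u + h * norm v" using that by (intro add_mono mult_right_mono) auto
    finally show ?thesis using hd by (simp add: dist_norm add.assoc)
  qed
  have near': "dist (x + s *\<^sub>R v + t *\<^sub>R u) x < d" if "0 \<le> s" "s \<le> h" "0 \<le> t" "t \<le> h" for s t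
    using near[of t s] that by (simp add: algebra_simps)
  obtain s t where st: "0 \<le> s" "s \<le> h" "0 \<le> t" "t \<le> h"
    "f (x + h *\<^sub>R u + h *\<^sub>R v) - f (x + h *\<^sub>R u) - f (x + h *\<^sub>R v) + f x
      = h * h * fu (x + s *\<^sub>R u + t *\<^sub>R v) v"
    using second_difference_mvt[OF h, of x u v S f f' fu] d' near f fu by blast
  obtain s' t' where st': "0 \<le> s'" "s' \<le> h" "0 \<le> t'" "t' \<le> h"
    "f (x + h *\<^sub>R v + h *\<^sub>R u) - f (x + h *\<^sub>R v) - f (x + h *\<^sub>R u) + f x
      = h * h * fv (x + s' *\<^sub>R v + t' *\<^sub>R u) u"
    using second_difference_mvt[OF h, of x v u S f f' fv] d' near' f fv by blast
  have "h * h * fu (x + s *\<^sub>R u + t *\<^sub>R v) v = h * h * fv (x + s' *\<^sub>R v + t' *\<^sub>R u) u"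
    unfolding st(5)[symmetric] st'(5)[symmetric] by (simp add: algebra_simps)
  then have "fu (x + s *\<^sub>R u + t *\<^sub>R v) v = fv (x + s' *\<^sub>R v + t' *\<^sub>R u) u" using h by simp
  moreover have "dist (fu (x + s *\<^sub>R u + t *\<^sub>R v) v) (fu x v) < e"
    "dist (fv (x + s' *\<^sub>R v + t' *\<^sub>R u) u) (fv x u) < e"
    using d' near near' st st' by blast+
  ultimately have "\<bar>fu x v - fv x u\<bar> < 2 * e" by (simp add: dist_real_def)
  then show False by (simp add: e_def)
qed

lemma Ck_on_open_has_derivative:
  assumes "Ck_on (Suc k) f S" "open S" "x \<in> S"
  shows "(f has_derivative frechet_derivative f (at x)) (at x)"
  using Ck_on_Suc_has_derivative[OF assms(1,3)] unfolding at_within_open[OF assms(3,2)] .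

lemma Ck_on_open_derivative:
  fixes S :: "'a::euclidean_space set"
  assumes "Ck_on (Suc k) f S" "open S"
  shows "Ck_on k (\<lambda>x. frechet_derivative f (at x) v) S"
proof -
  have "Ck_on k (\<lambda>x. frechet_derivative f (at x within S) v) S" using assms(1) by simp
  then show ?thesis
    by (rule Ck_on_cong_imp[OF derivative_set_open[OF assms(2)], rotated])
       (use at_within_open[OF _ assms(2)] in simp)
qed

lemma second_derivative_symmetric:
  fixes f :: "'a::euclidean_space \<Rightarrow> 'b::euclidean_space"
  assumes f: "Ck_on (Suc (Suc 0)) f S" and S: "open S" "x \<in> S"
  shows "frechet_derivative (\<lambda>y. frechet_derivative f (at y) u) (at x) v
    = frechet_derivative (\<lambda>y. frechet_derivative f (at y) v) (at x) u"
proof (rule euclidean_eqI)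
  fix b :: 'b assume "b \<in> Basis"
  let ?D = "\<lambda>w y. frechet_derivative (\<lambda>y. frechet_derivative f (at y) w) (at y)"
  have 1: "(f has_derivative frechet_derivative f (at y)) (at y)" if "y \<in> S" for y
    using Ck_on_open_has_derivative[OF f S(1) that] .
  have c1: "Ck_on (Suc 0) (\<lambda>y. frechet_derivative f (at y) w) S" for w
    using Ck_on_open_derivative[OF f S(1)] .
  have 2: "((\<lambda>y. frechet_derivative f (at y) w) has_derivative ?D w y) (at y)" if "y \<in> S" for y w
    using Ck_on_open_has_derivative[OF c1 S(1) that] .
  have 3: "continuous_on S (\<lambda>y. ?D w y w')" for w w'
    using Ck_on_open_derivative[OF c1 S(1)] by simp
  show "?D u x v \<bullet> b = ?D v x u \<bullet> b"
    by (rule second_derivative_symmetric_real[where f="\<lambda>y. f y \<bullet> b" and fu="\<lambda>y h. ?D u y h \<bullet> b"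
          and fv="\<lambda>y h. ?D v y h \<bullet> b" and f'="\<lambda>y h. frechet_derivative f (at y) h \<bullet> b" and S=S])
      (auto intro!: S has_derivative_inner_left 1 2 3 continuous_on_inner continuous_on_const)
qed

section \<open>Linear ordinary differential equations\<close>

text \<open>On an interval this short the Picard integral operator is a contraction with factor 1/2,
  and its fixed point satisfies the integral form of the equation.\<close>

lemma linear_ode_step:
  fixes A :: "real \<Rightarrow> 'a::euclidean_space \<Rightarrow> 'a"
  assumes ab: "a \<le> b" and lin: "\<And>t. t \<in> {a..b} \<Longrightarrow> linear (A t)"
    and cont: "\<And>i. i \<in> Basis \<Longrightarrow> continuous_on {a..b} (\<lambda>t. A t i)"
    and K: "\<And>t v. t \<in> {a..b} \<Longrightarrow> norm (A t v) \<le> K * norm v" and small: "(b - a) * K \<le> 1/2" and K0: "K \<ge> 0"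
  shows "\<exists>y. y a = y0 \<and> (\<forall>t\<in>{a..b}. (y has_vector_derivative A t (y t)) (at t within {a..b}))"
proof -
  \<comment> \<open>Clamping the time to the interval makes the Picard operator act on bounded
    continuous functions on the whole line, a complete space with the supremum distance.\<close>
  define c where "c t = max a (min t b)" for t
  have c: "c t \<in> {a..b}" "t \<in> {a..b} \<Longrightarrow> c t = t" for t using ab by (auto simp: c_def)
  have contc: "continuous_on UNIV c" unfolding c_def by (intro continuous_intros)
  have contA: "continuous_on {a..b} (\<lambda>t. A t (f t))" if "continuous_on {a..b} f" for f
  proof -
    have "continuous_on {a..b} (\<lambda>t. \<Sum>i\<in>Basis. (f t \<bullet> i) *\<^sub>R A t i)"
      by (intro continuous_intros that cont)
    then show ?thesis by (rule continuous_on_eq) (simp add: linear_Basis_expand[OF lin, symmetric])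
  qed
  define T0 where "T0 f t = y0 + integral {a..c t} (\<lambda>s. A s (f s))" for f :: "real \<Rightarrow> 'a" and t
  have T0cont: "continuous_on {a..b} (\<lambda>u. y0 + integral {a..u} (\<lambda>s. A s (f s)))"
    if "continuous_on {a..b} f" for f
    by (intro continuous_intros indefinite_integral_continuous_1 integrable_continuous_real contA that)
  have T0: "T0 (apply_bcontfun f) \<in> bcontfun" for f
  proof -
    have fc: "continuous_on {a..b} (apply_bcontfun f)" by simp
    have eq: "T0 (apply_bcontfun f) = (\<lambda>u. y0 + integral {a..u} (\<lambda>s. A s (f s))) \<circ> c"
      by (simp add: T0_def fun_eq_iff)
    have "continuous_on UNIV (T0 (apply_bcontfun f))" unfolding eq
      by (rule continuous_on_compose[OF contc continuous_on_subset[OF T0cont[OF fc]]]) (use c in auto)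
    moreover have "bounded (range (T0 (apply_bcontfun f)))"
    proof (rule bounded_subset[OF compact_imp_bounded[OF compact_continuous_image[OF T0cont[OF fc]]]])
      show "range (T0 (apply_bcontfun f)) \<subseteq> (\<lambda>u. y0 + integral {a..u} (\<lambda>s. A s (f s))) ` {a..b}"
        unfolding eq using c by auto
    qed simp
    ultimately show ?thesis by (simp add: bcontfun_def)
  qed
  define T where "T f = Bcontfun (T0 (apply_bcontfun f))" for f
  have T: "apply_bcontfun (T f) = T0 (apply_bcontfun f)" for f
    unfolding T_def using T0 by (simp add: Bcontfun_inverse)
  have "dist (T f) (T g) \<le> (1/2) * dist f g" for f g
  proof (rule dist_bound)
    fix t
    have int: "(\<lambda>s. A s (apply_bcontfun f s)) integrable_on {a..c t}" for f :: "real \<Rightarrow>\<^sub>C 'a"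
      using c(1)[of t] by (intro integrable_continuous_real continuous_on_subset[OF contA]) auto
    have "norm (integral {a..c t} (\<lambda>s. A s (f s) - A s (g s))) \<le> (K * dist f g) * (c t - a)"
    proof (rule integral_bound)
      show "a \<le> c t" using c(1)[of t] by simp
      show "continuous_on {a..c t} (\<lambda>s. A s (f s) - A s (g s))"
        using c(1)[of t] by (intro continuous_on_diff continuous_on_subset[OF contA]) auto
      fix s assume "s \<in> {a..c t}"
      then have s: "s \<in> {a..b}" using c(1)[of t] by auto
      have "norm (A s (f s) - A s (g s)) = norm (A s (f s - g s))"
        using lin[OF s] by (simp add: linear_diff)
      also have "\<dots> \<le> K * norm (f s - g s)" using K[OF s] .
      also have "\<dots> \<le> K * dist f g" using dist_bounded[of f s g] K0
        by (intro mult_left_mono) (auto simp: dist_norm)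
      finally show "norm (A s (f s) - A s (g s)) \<le> K * dist f g" .
    qed
    also have "\<dots> \<le> (K * dist f g) * (b - a)" using c(1)[of t] K0 by (intro mult_left_mono) auto
    also have "\<dots> \<le> (1/2) * dist f g"
      using mult_right_mono[OF small, of "dist f g"] by (simp add: mult_ac)
    finally show "dist (T f t) (T g t) \<le> (1/2) * dist f g"
      unfolding T T0_def using int by (simp add: dist_norm integral_diff)
  qed
  then have "\<exists>!f. T f = f" by (intro banach_fix_type[of "1/2"]) auto
  then obtain f where f: "T f = f" by blast
  have fe: "f t = y0 + integral {a..t} (\<lambda>s. A s (f s))" if "t \<in> {a..b}" for t
    using c(2)[OF that] T[of f] unfolding f T0_def by metis
  have "(f has_vector_derivative A t (f t)) (at t within {a..b})" if t: "t \<in> {a..b}" for t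
  proof (rule has_vector_derivative_transform[OF t])
    show "((\<lambda>t. y0 + integral {a..t} (\<lambda>s. A s (f s))) has_vector_derivative A t (f t)) (at t within {a..b})"
      using has_vector_derivative_add[OF has_vector_derivative_const
          integral_has_vector_derivative[OF contA t]] by fastforce
  qed (use fe in simp)
  moreover have "f a = y0" using fe[of a] ab by simp
  ultimately show ?thesis by blast
qed

lemma has_vector_derivative_within_Un:
  "(f has_vector_derivative D) (at x within S) \<Longrightarrow> (f has_vector_derivative D) (at x within T)
    \<Longrightarrow> (f has_vector_derivative D) (at x within (S \<union> T))"
  unfolding has_vector_derivative_def has_derivative_iff_norm
  by (auto simp: at_within_union intro: filterlim_sup)

text \<open>Two solutions of the same first-order equation that agree at b also have the same
  derivative there, so a single \<open>D\<close> is enough for both one-sided derivatives.\<close>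

lemma has_vector_derivative_glue:
  fixes f g :: "real \<Rightarrow> 'a::real_normed_vector"
  assumes ab: "a \<le> b" "b \<le> c" and fg: "f b = g b"
    and f: "t \<le> b \<Longrightarrow> (f has_vector_derivative D) (at t within {a..b})"
    and g: "b \<le> t \<Longrightarrow> (g has_vector_derivative D) (at t within {b..c})"
    and t: "t \<in> {a..c}"
  shows "((\<lambda>t. if t \<le> b then f t else g t) has_vector_derivative D) (at t within {a..c})"
proof -
  let ?h = "\<lambda>t. if t \<le> b then f t else g t"
  have near: "(?h has_vector_derivative D) (at t within {a..b})" if "t \<le> b"
    by (rule has_vector_derivative_transform[OF _ _ f[OF that]]) (use that t in auto)
  have near': "(?h has_vector_derivative D) (at t within {b..c})" if "b \<le> t"
    by (rule has_vector_derivative_transform[OF _ _ g[OF that]]) (use that t fg in auto)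
  consider "t < b" | "t = b" | "t > b" by linarith
  then show ?thesis
  proof cases
    case 1
    have "at t within {a..c} = at t within {a..b}"
      by (rule at_within_nhd[of _ "{..<b}"]) (use 1 ab in auto)
    then show ?thesis using near 1 by simp
  next
    case 2
    have "{a..c} = {a..b} \<union> {b..c}" using ab by auto
    then show ?thesis using has_vector_derivative_within_Un near near' 2 by fastforce
  next
    case 3
    have "at t within {a..c} = at t within {b..c}"
      by (rule at_within_nhd[of _ "{b<..}"]) (use 3 ab in auto)
    then show ?thesis using near' 3 by simp
  qed
qed

lemma linear_family_bounded:
  fixes A :: "real \<Rightarrow> 'a::euclidean_space \<Rightarrow> 'b::real_normed_vector"
  assumes lin: "\<And>t. t \<in> {a..b} \<Longrightarrow> linear (A t)"
    and cont: "\<And>i. i \<in> Basis \<Longrightarrow> continuous_on {a..b} (\<lambda>t. A t i)"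
  obtains K where "K > 0" "\<And>t v. t \<in> {a..b} \<Longrightarrow> norm (A t v) \<le> K * norm v"
proof -
  have "continuous_on {a..b} (\<lambda>t. \<Sum>i\<in>Basis. norm (A t i))" by (intro continuous_intros cont)
  then have "bounded ((\<lambda>t. \<Sum>i\<in>Basis. norm (A t i)) ` {a..b})"
    by (intro compact_imp_bounded compact_continuous_image) auto
  then obtain K where K: "K > 0" "\<And>t. t \<in> {a..b} \<Longrightarrow> \<bar>\<Sum>i\<in>Basis. norm (A t i)\<bar> \<le> K"
    unfolding bounded_pos by auto
  have "norm (A t v) \<le> K * norm v" if t: "t \<in> {a..b}" for t v
  proof -
    have "(\<Sum>i\<in>Basis. norm (A t i)) \<le> K" using K(2)[OF t] by simp
    from mult_right_mono[OF this norm_ge_zero, of v] onorm_le_sum_Basis[OF lin[OF t], of v]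
    show ?thesis by linarith
  qed
  then show thesis using that K by blast
qed

text \<open>The coefficients are bounded by one K on the compact interval, so the short-time result
  applies to every subinterval of length below 1/(2K), and bisection covers the whole
  interval.\<close>

lemma linear_ode_solution:
  fixes A :: "real \<Rightarrow> 'a::euclidean_space \<Rightarrow> 'a"
  assumes ab: "a \<le> b" and lin: "\<And>t. t \<in> {a..b} \<Longrightarrow> linear (A t)"
    and cont: "\<And>i. i \<in> Basis \<Longrightarrow> continuous_on {a..b} (\<lambda>t. A t i)"
  shows "\<exists>y. y a = y0 \<and> (\<forall>t\<in>{a..b}. (y has_vector_derivative A t (y t)) (at t within {a..b}))"
proof -
  obtain K where K: "K > 0" "\<And>t v. t \<in> {a..b} \<Longrightarrow> norm (A t v) \<le> K * norm v"
    using linear_family_bounded[OF lin cont] by blast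
  \<comment> \<open>The initial value is quantified inside \<open>P\<close>: the second of two
    adjacent pieces starts from whatever value the first one reaches.\<close>
  define P where "P c d \<longleftrightarrow> (a \<le> c \<longrightarrow> c \<le> d \<longrightarrow> d \<le> b \<longrightarrow> (\<forall>y0. \<exists>y. y c = y0 \<and>
    (\<forall>t\<in>{c..d}. (y has_vector_derivative A t (y t)) (at t within {c..d}))))" for c d
  have "P a b" using ab
  proof (induction rule: Bolzano)
    case (trans c d e)
    show ?case unfolding P_def
    proof (intro impI allI)
      fix y0 assume ce: "a \<le> c" "c \<le> e" "e \<le> b"
      obtain y where y: "y c = y0" "\<And>t. t \<in> {c..d} \<Longrightarrow> (y has_vector_derivative A t (y t)) (at t within {c..d})"
        using trans ce unfolding P_def by (metis order.trans)
      obtain z where z: "z d = y d" "\<And>t. t \<in> {d..e} \<Longrightarrow> (z has_vector_derivative A t (z t)) (at t within {d..e})"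
        using trans ce unfolding P_def by (metis order.trans)
      let ?w = "\<lambda>t. if t \<le> d then y t else z t"
      have "(?w has_vector_derivative A t (?w t)) (at t within {c..e})" if t: "t \<in> {c..e}" for t
        by (rule has_vector_derivative_glue) (use trans t z(1) y(2)[of t] z(2)[of t] in \<open>auto split: if_splits\<close>)
      then show "\<exists>y. y c = y0 \<and> (\<forall>t\<in>{c..e}. (y has_vector_derivative A t (y t)) (at t within {c..e}))"
        using y(1) trans by (intro exI[of _ ?w]) auto
    qed
  next
    case (local x)
    have "P c d" if "c \<le> x" "x \<le> d" "d - c < 1 / (2 * K)" for c d
      unfolding P_def
    proof (intro impI allI)
      fix y0 assume cd: "a \<le> c" "c \<le> d" "d \<le> b"
      show "\<exists>y. y c = y0 \<and> (\<forall>t\<in>{c..d}. (y has_vector_derivative A t (y t)) (at t within {c..d}))"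
      proof (rule linear_ode_step)
        show "(d - c) * K \<le> 1/2" using that(3) K(1) by (simp add: field_simps)
        show "continuous_on {c..d} (\<lambda>t. A t i)" if "i \<in> Basis" for i
          using cont[OF that] by (rule continuous_on_subset) (use cd in auto)
      qed (use cd lin K in auto)
    qed
    then show ?case using K(1) by (intro exI[of _ "1 / (2 * K)"]) auto
  qed
  then show ?thesis using ab unfolding P_def by blast
qed

lemma nondecreasing_within:
  fixes f :: "real \<Rightarrow> real"
  assumes f: "\<And>t. t \<in> {a..b} \<Longrightarrow> (f has_real_derivative f' t) (at t within {a..b})"
    and f': "\<And>t. t \<in> {a..b} \<Longrightarrow> f' t \<ge> 0" and st: "a \<le> s" "s \<le> t" "t \<le> b"
  shows "f s \<le> f t"
proof (rule DERIV_nonneg_imp_increasing_open[of s t f, OF st(2)])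
  show "\<exists>y. (f has_real_derivative y) (at x) \<and> 0 \<le> y" if x: "s < x" "x < t" for x
  proof -
    have "at x within {a..b} = at x"
      using x st by (intro at_within_interior) (simp add: interior_atLeastAtMost_real)
    then show ?thesis using f[of x] f'[of x] x st by auto
  qed
  show "continuous_on {s..t} f"
    using st by (intro continuous_on_subset[OF DERIV_continuous_on[OF f]]) auto
qed

lemma constant_on_interval:
  fixes f :: "real \<Rightarrow> 'a::real_normed_vector"
  assumes f: "\<And>t. t \<in> {a..b} \<Longrightarrow> (f has_vector_derivative 0) (at t within {a..b})"
    and st: "s \<in> {a..b}" "t \<in> {a..b}"
  shows "f s = f t"
proof -
  have "\<exists>c. \<forall>x\<in>{a..b}. f x = c"
    by (rule has_derivative_zero_constant) (use f in \<open>simp_all add: has_vector_derivative_def\<close>)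
  then show ?thesis using st by force
qed

text \<open>Gronwall's argument: the derivative of \<open>y s \<bullet> y s\<close> is at most 2K
  times the function, so multiplied by \<open>exp (- 2 * K * s)\<close> it cannot increase from its
  initial value 0. The sign in \<open>g\<close> adapts this to a lemma on nondecreasing
  functions.\<close>

lemma linear_ode_zero:
  fixes A :: "real \<Rightarrow> 'a::euclidean_space \<Rightarrow> 'a"
  assumes lin: "\<And>t. t \<in> {a..b} \<Longrightarrow> linear (A t)"
    and cont: "\<And>i. i \<in> Basis \<Longrightarrow> continuous_on {a..b} (\<lambda>t. A t i)"
    and y: "\<And>t. t \<in> {a..b} \<Longrightarrow> (y has_vector_derivative A t (y t)) (at t within {a..b})"
    and ya: "y a = 0" and t: "t \<in> {a..b}"
  shows "y t = 0"
proof -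
  obtain K where K: "K > 0" "\<And>t v. t \<in> {a..b} \<Longrightarrow> norm (A t v) \<le> K * norm v"
    using linear_family_bounded[OF lin cont] by blast
  define g where "g s = - (exp (- 2 * K * s) * (y s \<bullet> y s))" for s
  define g' where "g' s = - (exp (- 2 * K * s) * (2 * (A s (y s) \<bullet> y s)) - 2 * K * exp (- 2 * K * s) * (y s \<bullet> y s))" for s
  have yd: "(y has_derivative (\<lambda>x. x *\<^sub>R A s (y s))) (at s within {a..b})" if "s \<in> {a..b}" for s
    using y[OF that] by (simp add: has_vector_derivative_def)
  have g: "(g has_real_derivative g' s) (at s within {a..b})" if "s \<in> {a..b}" for s
    unfolding has_field_derivative_def g_def g'_def
    by (auto intro!: derivative_eq_intros yd[OF that] simp: fun_eq_iff inner_commute algebra_simps)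
  have g': "g' s \<ge> 0" if "s \<in> {a..b}" for s
  proof -
    have "A s (y s) \<bullet> y s \<le> norm (A s (y s)) * norm (y s)" by (rule norm_cauchy_schwarz)
    also have "\<dots> \<le> K * norm (y s) * norm (y s)" by (intro mult_right_mono K that) simp
    finally have "A s (y s) \<bullet> y s \<le> K * (y s \<bullet> y s)" by (simp add: dot_square_norm power2_eq_square mult.assoc)
    then have "exp (- 2 * K * s) * (2 * (A s (y s) \<bullet> y s)) \<le> exp (- 2 * K * s) * (2 * (K * (y s \<bullet> y s)))"
      by (intro mult_left_mono) auto
    then show ?thesis by (simp add: g'_def algebra_simps)
  qed
  have "g a \<le> g t"
    by (rule nondecreasing_within[where f=g, OF g g']) (use t in auto)
  then have "y t \<bullet> y t \<le> 0" using ya by (simp add: g_def mult_le_0_iff)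
  then show ?thesis by (metis inner_eq_zero_iff inner_ge_zero order_antisym)
qed

text \<open>Bootstrapping: if y is of class k, then so is the right-hand side, which is the
  derivative of y.\<close>

lemma linear_ode_Ck:
  fixes A :: "real \<Rightarrow> 'a::euclidean_space \<Rightarrow> 'a"
  assumes S: "derivative_set S" and lin: "\<And>t. t \<in> S \<Longrightarrow> linear (A t)"
    and A: "\<And>k i. i \<in> Basis \<Longrightarrow> Ck_on k (\<lambda>t. A t i) S"
    and y: "\<And>t. t \<in> S \<Longrightarrow> (y has_vector_derivative A t (y t)) (at t within S)"
  shows "Ck_on k y S"
proof (induction k)
  case 0
  have "continuous_on S y"
    by (rule has_derivative_continuous_on, rule y[unfolded has_vector_derivative_def])
  then show ?case by simp
next
  case (Suc k)
  have "Ck_on k (\<lambda>t. v *\<^sub>R A t (y t)) S" for v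
    by (rule Ck_on_scaleR[OF S Ck_on_const[OF S] Ck_on_lin_apply[OF S lin A Suc]])
  then show ?case using Ck_on_Suc_iff[OF S y[unfolded has_vector_derivative_def]] by blast
qed

section \<open>Derivatives in the interior of a domain\<close>

abbreviation dd :: "('a::real_normed_vector \<Rightarrow> 'b::real_normed_vector) \<Rightarrow> 'a \<Rightarrow> 'a \<Rightarrow> 'b" where
  "dd f x v \<equiv> frechet_derivative f (at x) v"

lemma smooth_onD: "smooth_on f S \<Longrightarrow> Ck_on k f S"
  by (simp add: smooth_on_def)

lemma smooth_on_has_derivative:
  assumes "smooth_on f S" "open S" "x \<in> S" shows "(f has_derivative dd f x) (at x)"
  using Ck_on_open_has_derivative[OF smooth_onD[OF assms(1)] assms(2,3)] .

lemma smooth_on_dd: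
  fixes S :: "'a::euclidean_space set"
  assumes "smooth_on f S" "open S" shows "smooth_on (\<lambda>x. dd f x v) S"
  unfolding smooth_on_def using Ck_on_open_derivative[OF smooth_onD[OF assms(1)] assms(2)] by blast

lemma dd_eq: "(f has_derivative D) (at x) \<Longrightarrow> dd f x v = D v"
  using frechet_derivative_at by metis

lemma linear_dd:
  assumes "smooth_on f S" "open S" "x \<in> S" shows "linear (dd f x)"
  using smooth_on_has_derivative[OF assms] has_derivative_bounded_linear bounded_linear.linear by blast

lemma linear_dd_param:
  fixes F :: "'a::real_normed_vector \<Rightarrow> 'b::euclidean_space \<Rightarrow> 'c::real_normed_vector"
  assumes lin: "\<And>y. y \<in> S \<Longrightarrow> linear (F y)" and S: "open S" "x \<in> S"
    and F: "\<And>b. ((\<lambda>y. F y b) has_derivative D b) (at x)"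
  shows "linear (\<lambda>b. D b v)"
proof (rule linearI)
  fix a b and r :: real
  have "((\<lambda>x. F x (a + b)) has_derivative (\<lambda>v. D a v + D b v)) (at x)"
    by (rule has_derivative_transform_within_open[OF has_derivative_add[OF F F] S])
       (simp add: linear_add[OF lin])
  from has_derivative_unique[OF F this] show "D (a + b) v = D a v + D b v" by metis
  have "((\<lambda>x. F x (r *\<^sub>R b)) has_derivative (\<lambda>v. r *\<^sub>R D b v)) (at x)"
    by (rule has_derivative_transform_within_open[OF has_derivative_scaleR_right[OF F] S])
       (simp add: linear_cmul[OF lin])
  from has_derivative_unique[OF F this] show "D (r *\<^sub>R b) v = r *\<^sub>R D b v" by metis
qed

section \<open>Riemannian metrics on open subsets of a Euclidean space\<close>

text \<open>The formulas of \<open>christoffel\<close> and \<open>curvature_coeff\<close> with the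
  metric coefficients of a chart replaced by an arbitrary family g, so that the local theory can be
  developed on open sets of a Euclidean space without mentioning manifolds.\<close>

definition koszul :: "('e::euclidean_space \<Rightarrow> 'e \<Rightarrow> 'e \<Rightarrow> real) \<Rightarrow> 'e \<Rightarrow> 'e \<Rightarrow> 'e \<Rightarrow> 'e \<Rightarrow> real" where
  "koszul g x u v w = (dd (\<lambda>y. g y v w) x u + dd (\<lambda>y. g y u w) x v - dd (\<lambda>y. g y u v) x w) / 2"

definition levi_civita :: "('e::euclidean_space \<Rightarrow> 'e \<Rightarrow> 'e \<Rightarrow> real) \<Rightarrow> 'e \<Rightarrow> 'e \<Rightarrow> 'e \<Rightarrow> 'e" where
  "levi_civita g x u v = (THE z. \<forall>w. g x z w = koszul g x u v w)"

definition riemann :: "('e::euclidean_space \<Rightarrow> 'e \<Rightarrow> 'e \<Rightarrow> real) \<Rightarrow> 'e \<Rightarrow> 'e \<Rightarrow> 'e \<Rightarrow> 'e \<Rightarrow> 'e" where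
  "riemann g x u v w = dd (\<lambda>y. levi_civita g y v w) x u - dd (\<lambda>y. levi_civita g y u w) x v
     + levi_civita g x u (levi_civita g x v w) - levi_civita g x v (levi_civita g x u w)"

lemma christoffel_eq: "christoffel M c = levi_civita (metric_coeff M c)"
  by (simp add: fun_eq_iff christoffel_def levi_civita_def koszul_def)

lemma curvature_coeff_eq: "curvature_coeff M c = riemann (metric_coeff M c)"
  by (simp add: fun_eq_iff curvature_coeff_def riemann_def christoffel_eq)

locale local_metric =
  fixes U :: "'e::euclidean_space set" and g :: "'e \<Rightarrow> 'e \<Rightarrow> 'e \<Rightarrow> real"
  assumes open_U: "open U"
    and smooth_g: "smooth_on (\<lambda>x. g x v w) U"
    and g_add: "x \<in> U \<Longrightarrow> g x (u + v) w = g x u w + g x v w"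
    and g_scale: "x \<in> U \<Longrightarrow> g x (r *\<^sub>R u) w = r * g x u w"
    and g_sym: "x \<in> U \<Longrightarrow> g x u w = g x w u"
    and g_pos: "x \<in> U \<Longrightarrow> u \<noteq> 0 \<Longrightarrow> g x u u > 0"
begin

lemma derivative_set_U: "derivative_set U"
  by (rule derivative_set_open[OF open_U])

lemma g_linear: "x \<in> U \<Longrightarrow> linear (\<lambda>u. g x u w)"
  by (rule linearI) (simp_all add: g_add g_scale)

lemma g_linear': "x \<in> U \<Longrightarrow> linear (g x w)"
  using g_linear[of x w] g_sym[of x _ w] by simp

lemmas g_simps = linear_add[OF g_linear] linear_add[OF g_linear'] linear_diff[OF g_linear]
  linear_diff[OF g_linear'] linear_cmul[OF g_linear] linear_cmul[OF g_linear'] linear_neg[OF g_linear]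
  linear_neg[OF g_linear'] linear_0[OF g_linear] linear_0[OF g_linear']

lemma g_eqI: "x \<in> U \<Longrightarrow> (\<And>w. g x z w = g x z' w) \<Longrightarrow> z = z'"
  using g_pos[of x "z - z'"] by (force simp: g_simps)

lemma g_has_derivative: "x \<in> U \<Longrightarrow> ((\<lambda>y. g y v w) has_derivative dd (\<lambda>y. g y v w) x) (at x)"
  using smooth_on_has_derivative[OF smooth_g open_U] .

lemma dd_g_linear: "x \<in> U \<Longrightarrow> linear (\<lambda>v. dd (\<lambda>y. g y v w) x u)"
  by (rule linear_dd_param[where S=U, OF g_linear open_U _ g_has_derivative])

lemma dd_g_sym: "x \<in> U \<Longrightarrow> dd (\<lambda>y. g y v w) x u = dd (\<lambda>y. g y w v) x u"
  by (rule dd_eq, rule has_derivative_transform_within_open[OF g_has_derivative open_U])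
     (auto intro: g_sym)

lemma dd_g_linear': "x \<in> U \<Longrightarrow> linear (\<lambda>w. dd (\<lambda>y. g y v w) x u)"
  using dd_g_linear[of x v u] dd_g_sym[of x _ v u] by simp

lemma dd_g_linear'': "x \<in> U \<Longrightarrow> linear (\<lambda>u. dd (\<lambda>y. g y v w) x u)"
  by (rule linear_dd[OF smooth_g open_U])

lemma koszul_linear: "x \<in> U \<Longrightarrow> linear (koszul g x u v)"
  unfolding koszul_def
  by (rule linearI)
     (simp_all add: linear_add[OF dd_g_linear'] linear_add[OF dd_g_linear'']
       linear_cmul[OF dd_g_linear'] linear_cmul[OF dd_g_linear''] field_simps)

lemma koszul_linear2: "x \<in> U \<Longrightarrow> linear (\<lambda>v. koszul g x u v w)"
  unfolding koszul_def
  by (rule linearI)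
     (simp_all add: linear_add[OF dd_g_linear'] linear_add[OF dd_g_linear''] linear_add[OF dd_g_linear]
       linear_cmul[OF dd_g_linear'] linear_cmul[OF dd_g_linear''] linear_cmul[OF dd_g_linear] field_simps)

lemma koszul_sym: "x \<in> U \<Longrightarrow> koszul g x u v w = koszul g x v u w"
  unfolding koszul_def using dd_g_sym[of x u v w] by simp

text \<open>The lowering of an index: the covector \<open>g x z\<close> is identified with a vector
  through the standard basis. The defining equation of the Christoffel symbols thereby becomes a
  linear equation within one Euclidean space.\<close>

definition flat :: "'e \<Rightarrow> 'e \<Rightarrow> 'e" where
  "flat x z = (\<Sum>b\<in>Basis. g x z b *\<^sub>R b)"

lemma flat_linear: "x \<in> U \<Longrightarrow> linear (flat x)"
  unfolding flat_def
  by (rule linearI) (simp_all add: g_simps scaleR_add_left sum.distrib scaleR_sum_right)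

lemma flat_inj: assumes x: "x \<in> U" shows "inj (flat x)"
proof -
  have "z = 0" if "flat x z = 0" for z
  proof (rule g_eqI[OF x])
    fix w
    have 0: "g x z b = 0" if "b \<in> Basis" for b
    proof -
      have "g x z b = flat x z \<bullet> b" using that by (simp add: flat_def)
      then show ?thesis using \<open>flat x z = 0\<close> by simp
    qed
    show "g x z w = g x 0 w"
      by (subst linear_Basis_expand[OF g_linear'[OF x]]) (simp add: 0 g_simps x)
  qed
  then show ?thesis using linear_injective_0[OF flat_linear[OF x]] by blast
qed

lemma flat_eq_iff:
  assumes x: "x \<in> U" and h: "linear h"
  shows "flat x z = (\<Sum>b\<in>Basis. h b *\<^sub>R b) \<longleftrightarrow> (\<forall>w. g x z w = h w)"
proof
  assume *: "flat x z = (\<Sum>b\<in>Basis. h b *\<^sub>R b)"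
  have b: "g x z b = h b" if "b \<in> Basis" for b
    using arg_cong[OF *, of "\<lambda>y. y \<bullet> b"] that by (simp add: flat_def)
  show "\<forall>w. g x z w = h w"
  proof
    fix w
    have "g x z w = (\<Sum>b\<in>Basis. (w \<bullet> b) *\<^sub>R g x z b)" by (rule linear_Basis_expand[OF g_linear'[OF x]])
    also have "\<dots> = (\<Sum>b\<in>Basis. (w \<bullet> b) *\<^sub>R h b)" by (intro sum.cong refl) (simp only: b)
    also have "\<dots> = h w" by (rule linear_Basis_expand[OF h, symmetric])
    finally show "g x z w = h w" .
  qed
qed (simp add: flat_def)

text \<open>Makes the definite description in \<open>levi_civita\<close> meaningful.
  \<open>flat x\<close> is injective by positivity of g, hence onto by equality of
  dimensions.\<close>

lemma riesz:
  assumes x: "x \<in> U" and h: "linear h" shows "\<exists>!z. \<forall>w. g x z w = h w"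
proof -
  have "surj (flat x)" by (rule linear_inj_imp_surj[OF flat_linear[OF x] flat_inj[OF x]])
  then obtain z where "flat x z = (\<Sum>b\<in>Basis. h b *\<^sub>R b)" by (metis surjD)
  then have "\<forall>w. g x z w = h w" using flat_eq_iff[OF x h] by blast
  then show ?thesis using g_eqI[OF x] by (intro ex1I[of _ z]) auto
qed

abbreviation "\<Gamma> \<equiv> levi_civita g"

lemma levi_civita: "x \<in> U \<Longrightarrow> g x (\<Gamma> x u v) w = koszul g x u v w"
  unfolding levi_civita_def using theI'[OF riesz[OF _ koszul_linear]] by blast

lemma levi_civita_sym: "x \<in> U \<Longrightarrow> \<Gamma> x u v = \<Gamma> x v u"
  by (rule g_eqI) (auto simp: levi_civita koszul_sym)

lemma levi_civita_linear: assumes x: "x \<in> U" shows "linear (\<Gamma> x u)"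
  by (rule linearI; rule g_eqI[OF x])
     (simp_all add: x g_simps levi_civita linear_add[OF koszul_linear2] linear_cmul[OF koszul_linear2])

lemma levi_civita_linear': "x \<in> U \<Longrightarrow> linear (\<lambda>u. \<Gamma> x u v)"
  using levi_civita_linear[of x v] levi_civita_sym[of x _ v] by simp

lemmas \<Gamma>_simps = linear_add[OF levi_civita_linear] linear_add[OF levi_civita_linear']
  linear_diff[OF levi_civita_linear] linear_diff[OF levi_civita_linear']
  linear_cmul[OF levi_civita_linear] linear_cmul[OF levi_civita_linear']
  linear_neg[OF levi_civita_linear] linear_neg[OF levi_civita_linear']
  linear_0[OF levi_civita_linear] linear_0[OF levi_civita_linear']

text \<open>In the sum of the Koszul expressions for (u, v, w) and (u, w, v) the derivatives in the
  directions v and w cancel, and the derivative in the direction u remains.\<close>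

lemma metric_compatible:
  "x \<in> U \<Longrightarrow> dd (\<lambda>y. g y v w) x u = g x (\<Gamma> x u v) w + g x v (\<Gamma> x u w)"
  using g_sym[of x v "\<Gamma> x u w"] dd_g_sym[of x v w u] dd_g_sym[of x u v w] dd_g_sym[of x u w v]
  by (simp add: levi_civita koszul_def field_simps)

lemma smooth_levi_civita: "smooth_on (\<lambda>x. \<Gamma> x u v) U"
  unfolding smooth_on_def
proof
  fix k
  have c1: "Ck_on k (\<lambda>x. g x v w) U" for v w using smooth_g smooth_onD by blast
  have c2: "Ck_on k (\<lambda>x. dd (\<lambda>y. g y v w) x u) U" for u v w
    using smooth_on_dd[OF smooth_g open_U] smooth_onD by blast
  show "Ck_on k (\<lambda>x. \<Gamma> x u v) U"
  proof (rule Ck_on_linear_solution[where F=flat and h="\<lambda>x. \<Sum>b\<in>Basis. koszul g x u v b *\<^sub>R b"])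
    show "Ck_on k (\<lambda>x. flat x b) U" for b
      unfolding flat_def
      by (intro Ck_on_sum Ck_on_scaleR Ck_on_const derivative_set_U c1)
    have "Ck_on k (\<lambda>x. (1/2) *\<^sub>R koszul' x) U" if "Ck_on k koszul' U" for koszul' :: "'e \<Rightarrow> real"
      by (intro Ck_on_scaleR Ck_on_const derivative_set_U that)
    from this[OF Ck_on_diff[OF derivative_set_U Ck_on_add[OF derivative_set_U c2 c2] c2]]
    have "Ck_on k (\<lambda>x. koszul g x u v b) U" for b
      unfolding koszul_def by simp
    then show "Ck_on k (\<lambda>x. \<Sum>b\<in>Basis. koszul g x u v b *\<^sub>R b) U"
      by (intro Ck_on_sum Ck_on_scaleR Ck_on_const derivative_set_U)
    show "flat x (\<Gamma> x u v) = (\<Sum>b\<in>Basis. koszul g x u v b *\<^sub>R b)" if "x \<in> U" for x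
      using flat_eq_iff[OF that koszul_linear[OF that]] levi_civita[OF that] by blast
  qed (auto intro: derivative_set_U flat_linear flat_inj)
qed

lemma levi_civita_has_derivative:
  "x \<in> U \<Longrightarrow> ((\<lambda>y. \<Gamma> y u v) has_derivative dd (\<lambda>y. \<Gamma> y u v) x) (at x)"
  using smooth_on_has_derivative[OF smooth_levi_civita open_U] .

text \<open>Metric compatibility absorbs the derivative of g in the base point into Christoffel
  corrections of the two slots. The base map \<phi> is arbitrary, since the rule is applied to the
  identity, to coordinate changes and to curves.\<close>

lemma g_product_rule:
  fixes \<phi> a b :: "'a::real_normed_vector \<Rightarrow> 'e"
  assumes \<phi>: "(\<phi> has_derivative \<phi>') (at x within S)" "x \<in> S" "\<And>y. y \<in> S \<Longrightarrow> \<phi> y \<in> U"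
    and a: "(a has_derivative a') (at x within S)" and b: "(b has_derivative b') (at x within S)"
  shows "((\<lambda>y. g (\<phi> y) (a y) (b y)) has_derivative
    (\<lambda>h. g (\<phi> x) (a' h + \<Gamma> (\<phi> x) (\<phi>' h) (a x)) (b x)
       + g (\<phi> x) (a x) (b' h + \<Gamma> (\<phi> x) (\<phi>' h) (b x)))) (at x within S)"
proof -
  have U: "\<phi> x \<in> U" using \<phi> by blast
  have 0: "((\<lambda>y. g (\<phi> y) u w) has_derivative
      (\<lambda>h. g (\<phi> x) (\<Gamma> (\<phi> x) (\<phi>' h) u) w + g (\<phi> x) u (\<Gamma> (\<phi> x) (\<phi>' h) w))) (at x within S)" for u w
    using has_derivative_compose[OF \<phi>(1) g_has_derivative[OF U, of u w]] metric_compatible[OF U]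
    by simp
  have 1: "((\<lambda>y. g (\<phi> y) (a y) w) has_derivative
      (\<lambda>h. (g (\<phi> x) (\<Gamma> (\<phi> x) (\<phi>' h) (a x)) w + g (\<phi> x) (a x) (\<Gamma> (\<phi> x) (\<phi>' h) w))
         + g (\<phi> x) (a' h) w)) (at x within S)" for w
    by (rule has_derivative_lin_apply[where F="\<lambda>y u. g (\<phi> y) u w", OF _ \<phi>(2) 0 a])
       (auto intro: g_linear \<phi>)
  have "((\<lambda>y. g (\<phi> y) (a y) (b y)) has_derivative
      (\<lambda>h. ((g (\<phi> x) (\<Gamma> (\<phi> x) (\<phi>' h) (a x)) (b x) + g (\<phi> x) (a x) (\<Gamma> (\<phi> x) (\<phi>' h) (b x)))
         + g (\<phi> x) (a' h) (b x)) + g (\<phi> x) (a x) (b' h))) (at x within S)"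
    by (rule has_derivative_lin_apply[OF _ \<phi>(2) 1 b]) (auto intro: g_linear' \<phi>)
  then show ?thesis by (simp add: g_simps U algebra_simps)
qed

lemma levi_civita_product_rule:
  fixes \<phi> a b :: "'a::real_normed_vector \<Rightarrow> 'e"
  assumes \<phi>: "(\<phi> has_derivative \<phi>') (at x within S)" "x \<in> S" "\<And>y. y \<in> S \<Longrightarrow> \<phi> y \<in> U"
    and a: "(a has_derivative a') (at x within S)" and b: "(b has_derivative b') (at x within S)"
  shows "((\<lambda>y. \<Gamma> (\<phi> y) (a y) (b y)) has_derivative
    (\<lambda>h. dd (\<lambda>y. \<Gamma> y (a x) (b x)) (\<phi> x) (\<phi>' h) + \<Gamma> (\<phi> x) (a' h) (b x)
       + \<Gamma> (\<phi> x) (a x) (b' h))) (at x within S)"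
proof -
  have U: "\<phi> x \<in> U" using \<phi> by blast
  have 0: "((\<lambda>y. \<Gamma> (\<phi> y) u w) has_derivative (\<lambda>h. dd (\<lambda>y. \<Gamma> y u w) (\<phi> x) (\<phi>' h))) (at x within S)" for u w
    using has_derivative_compose[OF \<phi>(1) levi_civita_has_derivative[OF U, of u w]] .
  have 1: "((\<lambda>y. \<Gamma> (\<phi> y) (a y) w) has_derivative
      (\<lambda>h. dd (\<lambda>y. \<Gamma> y (a x) w) (\<phi> x) (\<phi>' h) + \<Gamma> (\<phi> x) (a' h) w)) (at x within S)" for w
    by (rule has_derivative_lin_apply[where F="\<lambda>y u. \<Gamma> (\<phi> y) u w", OF _ \<phi>(2) 0 a])
       (auto intro: levi_civita_linear' \<phi>)
  show ?thesis
    by (rule has_derivative_lin_apply[OF _ \<phi>(2) 1 b]) (auto intro: levi_civita_linear \<phi>)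
qed

abbreviation "R \<equiv> riemann g"

lemma dd_levi_civita_linear: "x \<in> U \<Longrightarrow> linear (\<lambda>v. dd (\<lambda>y. \<Gamma> y v w) x u)"
  by (rule linear_dd_param[where S=U, OF levi_civita_linear' open_U _ levi_civita_has_derivative])

lemma dd_levi_civita_linear': "x \<in> U \<Longrightarrow> linear (\<lambda>w. dd (\<lambda>y. \<Gamma> y v w) x u)"
  by (rule linear_dd_param[where S=U, OF levi_civita_linear open_U _ levi_civita_has_derivative])

lemma dd_levi_civita_linear'': "x \<in> U \<Longrightarrow> linear (\<lambda>u. dd (\<lambda>y. \<Gamma> y v w) x u)"
  by (rule linear_dd[OF smooth_levi_civita open_U])

lemma dd_levi_civita_sym: "x \<in> U \<Longrightarrow> dd (\<lambda>y. \<Gamma> y v w) x u = dd (\<lambda>y. \<Gamma> y w v) x u"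
  by (rule dd_eq, rule has_derivative_transform_within_open[OF levi_civita_has_derivative open_U])
     (auto intro: levi_civita_sym)

lemma riemann_linear: "x \<in> U \<Longrightarrow> linear (\<lambda>u. R x u v w)"
  unfolding riemann_def
  by (rule linearI) (simp_all add: \<Gamma>_simps linear_add[OF dd_levi_civita_linear]
    linear_add[OF dd_levi_civita_linear''] linear_cmul[OF dd_levi_civita_linear]
    linear_cmul[OF dd_levi_civita_linear''] algebra_simps)

lemma riemann_linear': "x \<in> U \<Longrightarrow> linear (\<lambda>w. R x u v w)"
  unfolding riemann_def
  by (rule linearI) (simp_all add: \<Gamma>_simps linear_add[OF dd_levi_civita_linear']
    linear_cmul[OF dd_levi_civita_linear'] algebra_simps)

lemma riemann_antisym: "R x u v w = - R x v u w"
  by (simp add: riemann_def)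

lemma riemann_linear2: "x \<in> U \<Longrightarrow> linear (\<lambda>v. R x u v w)"
  using linear_compose_neg[OF riemann_linear[of x u w]] riemann_antisym[of x u _ w] by simp

lemma riemann_bianchi: "x \<in> U \<Longrightarrow> R x u v w + R x v w u + R x w u v = 0"
  unfolding riemann_def
  using dd_levi_civita_sym[of x v w u] dd_levi_civita_sym[of x w u v] dd_levi_civita_sym[of x u v w]
    levi_civita_sym[of x v w] levi_civita_sym[of x w u] levi_civita_sym[of x u v]
  by simp

text \<open>Two applications of metric compatibility express the second derivative of
  \<open>g y w z\<close> through the connection. Antisymmetrising in u and v, the mixed products
  cancel and symmetry of second derivatives leaves the claim.\<close>

lemma riemann_skew:
  assumes x: "x \<in> U" shows "g x (R x u v w) z = - g x w (R x u v z)"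
proof -
  have 1: "dd (\<lambda>y. dd (\<lambda>y. g y w z) y a) x b =
      (g x (dd (\<lambda>y. \<Gamma> y a w) x b + \<Gamma> x b (\<Gamma> x a w)) z + g x (\<Gamma> x a w) (\<Gamma> x b z))
    + (g x (\<Gamma> x b w) (\<Gamma> x a z) + g x w (dd (\<lambda>y. \<Gamma> y a z) x b + \<Gamma> x b (\<Gamma> x a z)))" for a b
  proof (rule dd_eq)
    have ev: "((\<lambda>y. \<Gamma> y a w) has_derivative dd (\<lambda>y. \<Gamma> y a w) x) (at x within U)" for w
      by (rule has_derivative_at_withinI[OF levi_civita_has_derivative[OF x]])
    have "((\<lambda>y. g y (\<Gamma> y a w) z) has_derivative
       (\<lambda>b. g x (dd (\<lambda>y. \<Gamma> y a w) x b + \<Gamma> x b (\<Gamma> x a w)) z + g x (\<Gamma> x a w) (0 + \<Gamma> x b z))) (at x within U)"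
      "((\<lambda>y. g y w (\<Gamma> y a z)) has_derivative
       (\<lambda>b. g x (0 + \<Gamma> x b w) (\<Gamma> x a z) + g x w (dd (\<lambda>y. \<Gamma> y a z) x b + \<Gamma> x b (\<Gamma> x a z)))) (at x within U)"
      by (rule g_product_rule[OF has_derivative_ident x _ ev has_derivative_const]
               g_product_rule[OF has_derivative_ident x _ has_derivative_const ev]; simp)+
    note * = has_derivative_add[OF this, unfolded at_within_open[OF x open_U]]
    show "((\<lambda>y. dd (\<lambda>y. g y w z) y a) has_derivative (\<lambda>b. 
      (g x (dd (\<lambda>y. \<Gamma> y a w) x b + \<Gamma> x b (\<Gamma> x a w)) z + g x (\<Gamma> x a w) (\<Gamma> x b z))
    + (g x (\<Gamma> x b w) (\<Gamma> x a z) + g x w (dd (\<lambda>y. \<Gamma> y a z) x b + \<Gamma> x b (\<Gamma> x a z))))) (at x)"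
      by (rule has_derivative_transform_within_open[OF _ open_U x])
         (use * metric_compatible in simp_all)
  qed
  have "dd (\<lambda>y. dd (\<lambda>y. g y w z) y v) x u = dd (\<lambda>y. dd (\<lambda>y. g y w z) y u) x v"
    by (rule second_derivative_symmetric[OF smooth_onD[OF smooth_g] open_U x])
  then show ?thesis unfolding 1 by (simp add: riemann_def g_simps x algebra_simps)
qed

text \<open>Self-adjointness of the Jacobi operator. The Bianchi identity for u, t, z is paired with
  t: the term with R(z, u)t drops out by skewness, and skewness and antisymmetry turn the other two
  into the two sides of the claim.\<close>

lemma jacobi_operator_sym:
  assumes x: "x \<in> U" shows "g x (R x u t t) z = g x (R x z t t) u"
proof -
  have "g x (R x u t z) t + g x (R x t z u) t + g x (R x z u t) t = 0"
    using arg_cong[OF riemann_bianchi[OF x, of u t z], of "\<lambda>r. g x r t"] by (simp add: g_simps x)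
  moreover have "g x (R x z u t) t = 0"
    using riemann_skew[OF x, of z u t t] g_sym[OF x, of t] by simp
  moreover have "g x (R x t z u) t = - g x (R x z t u) t"
    by (subst riemann_antisym) (simp add: g_simps x)
  ultimately show ?thesis
    using riemann_skew[OF x, of u t t z] riemann_skew[OF x, of z t t u]
      g_sym[OF x, of t "R x u t z"] g_sym[OF x, of t "R x z t u"] by simp
qed

lemma smooth_riemann: "smooth_on (\<lambda>x. R x u v w) U"
  unfolding smooth_on_def
proof
  fix k
  have 1: "Ck_on k (\<lambda>x. dd (\<lambda>y. \<Gamma> y v w) x u) U" for u v w
    using smooth_on_dd[OF smooth_levi_civita open_U] smooth_onD by blast
  have 2: "Ck_on k (\<lambda>x. \<Gamma> x u (\<Gamma> x v w)) U" for u v w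
    by (rule Ck_on_lin_apply[OF derivative_set_U levi_civita_linear])
       (auto intro: smooth_onD[OF smooth_levi_civita])
  show "Ck_on k (\<lambda>x. R x u v w) U"
    unfolding riemann_def by (intro Ck_on_diff Ck_on_add derivative_set_U 1 2)
qed

end

section \<open>Christoffel symbols and curvature under a change of coordinates\<close>

locale local_isometry = L: local_metric U g + L': local_metric U' g'
  for U :: "'e::euclidean_space set" and g and U' :: "'e set" and g' +
  fixes O' :: "'e set" and \<phi> :: "'e \<Rightarrow> 'e"
  assumes O: "open O'" "O' \<subseteq> U" "\<phi> ` O' \<subseteq> U'" and smooth_\<phi>: "smooth_on \<phi> O'"
    and isom: "x \<in> O' \<Longrightarrow> g x u v = g' (\<phi> x) (dd \<phi> x u) (dd \<phi> x v)"
    and surj_\<phi>: "x \<in> O' \<Longrightarrow> surj (dd \<phi> x)"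
begin

abbreviation D2 where "D2 x u v \<equiv> dd (\<lambda>y. dd \<phi> y v) x u"

lemma \<phi>_der: "x \<in> O' \<Longrightarrow> (\<phi> has_derivative dd \<phi> x) (at x within O')"
  using smooth_on_has_derivative[OF smooth_\<phi> O(1)] has_derivative_at_withinI by blast

lemma \<phi>_der2: "x \<in> O' \<Longrightarrow> ((\<lambda>y. dd \<phi> y v) has_derivative (\<lambda>u. D2 x u v)) (at x within O')"
  using smooth_on_has_derivative[OF smooth_on_dd[OF smooth_\<phi> O(1)] O(1)] has_derivative_at_withinI by blast

lemma D2_sym: "x \<in> O' \<Longrightarrow> D2 x u v = D2 x v u"
  by (rule second_derivative_symmetric[OF smooth_onD[OF smooth_\<phi>] O(1)])

lemma linear_\<phi>': "x \<in> O' \<Longrightarrow> linear (dd \<phi> x)"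
  by (rule linear_dd[OF smooth_\<phi> O(1)])

lemma in_U: "x \<in> O' \<Longrightarrow> x \<in> U" "x \<in> O' \<Longrightarrow> \<phi> x \<in> U'"
  using O by auto

text \<open>Differentiating the isometry relation gives the derivatives of g in terms of
  \<open>T\<close>, the Christoffel symbol of the target plus the second derivative of \<phi>.
  \<open>T\<close> is symmetric, so the Koszul combination collapses to \<open>T u v\<close>.
  Surjectivity of the derivative of \<phi> provides enough test vectors to conclude.\<close>

lemma levi_civita_transform:
  assumes x: "x \<in> O'"
  shows "dd \<phi> x (L.\<Gamma> x u v) = L'.\<Gamma> (\<phi> x) (dd \<phi> x u) (dd \<phi> x v) + D2 x u v"
proof -
  define T where "T u v = D2 x u v + L'.\<Gamma> (\<phi> x) (dd \<phi> x u) (dd \<phi> x v)" for u v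
  have T_sym: "T u v = T v u" for u v
    unfolding T_def using D2_sym[OF x] L'.levi_civita_sym[OF in_U(2)[OF x]] by simp
  have *: "dd (\<lambda>y. g y v w) x u = g' (\<phi> x) (T u v) (dd \<phi> x w) + g' (\<phi> x) (dd \<phi> x v) (T u w)" for u v w
  proof (rule dd_eq)
    have "((\<lambda>y. g' (\<phi> y) (dd \<phi> y v) (dd \<phi> y w)) has_derivative
      (\<lambda>u. g' (\<phi> x) (T u v) (dd \<phi> x w) + g' (\<phi> x) (dd \<phi> x v) (T u w))) (at x within O')"
      unfolding T_def
      by (rule L'.g_product_rule[OF \<phi>_der[OF x] x in_U(2) \<phi>_der2[OF x] \<phi>_der2[OF x]])
    then have "((\<lambda>y. g' (\<phi> y) (dd \<phi> y v) (dd \<phi> y w)) has_derivative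
      (\<lambda>u. g' (\<phi> x) (T u v) (dd \<phi> x w) + g' (\<phi> x) (dd \<phi> x v) (T u w))) (at x)"
      using at_within_open[OF x O(1)] by simp
    then show "((\<lambda>y. g y v w) has_derivative
      (\<lambda>u. g' (\<phi> x) (T u v) (dd \<phi> x w) + g' (\<phi> x) (dd \<phi> x v) (T u w))) (at x)"
      by (rule has_derivative_transform_within_open[OF _ O(1) x]) (simp add: isom)
  qed
  have "g' (\<phi> x) (dd \<phi> x (L.\<Gamma> x u v)) (dd \<phi> x w) = g' (\<phi> x) (T u v) (dd \<phi> x w)" for w
  proof -
    have "g' (\<phi> x) (dd \<phi> x (L.\<Gamma> x u v)) (dd \<phi> x w) = koszul g x u v w"
      using isom[OF x, symmetric] L.levi_civita[OF in_U(1)[OF x]] by simp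
    also have "\<dots> = g' (\<phi> x) (T u v) (dd \<phi> x w)"
      unfolding koszul_def * using T_sym[of u v] T_sym[of u w] T_sym[of v w]
        L'.g_sym[OF in_U(2)[OF x], of "dd \<phi> x v"] L'.g_sym[OF in_U(2)[OF x], of "dd \<phi> x u"] by simp
    finally show ?thesis .
  qed
  then have "dd \<phi> x (L.\<Gamma> x u v) = T u v"
    using surj_\<phi>[OF x] by (intro L'.g_eqI[OF in_U(2)[OF x]]) (metis surjD)
  then show ?thesis by (simp add: T_def add.commute)
qed

text \<open>The transformation law of the Christoffel symbols is differentiated once more. Third
  derivatives of \<phi> are symmetric in u and v and disappear; the terms with second derivatives
  either do the same or cancel against those in \<open>FG\<close>.\<close>

lemma riemann_transform:
  assumes x: "x \<in> O'"
  shows "dd \<phi> x (L.R x u v w) = L'.R (\<phi> x) (dd \<phi> x u) (dd \<phi> x v) (dd \<phi> x w)"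
proof -
  let ?F = "dd \<phi> x"
  have D2_smooth: "smooth_on (\<lambda>y. D2 y v w) O'" for v w
    using smooth_on_dd[OF smooth_on_dd[OF smooth_\<phi> O(1)] O(1)] .
  have *: "D2 x u (L.\<Gamma> x v w) + ?F (dd (\<lambda>y. L.\<Gamma> y v w) x u) =
     dd (\<lambda>y. L'.\<Gamma> y (?F v) (?F w)) (\<phi> x) (?F u) + L'.\<Gamma> (\<phi> x) (D2 x u v) (?F w)
       + L'.\<Gamma> (\<phi> x) (?F v) (D2 x u w) + dd (\<lambda>y. D2 y v w) x u" for u v
  proof -
    have 1: "((\<lambda>y. dd \<phi> y (L.\<Gamma> y v w)) has_derivative
        (\<lambda>u. D2 x u (L.\<Gamma> x v w) + ?F (dd (\<lambda>y. L.\<Gamma> y v w) x u))) (at x within O')"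
      by (rule has_derivative_lin_apply[OF linear_\<phi>' x \<phi>_der2[OF x]
            has_derivative_at_withinI[OF L.levi_civita_has_derivative[OF in_U(1)[OF x]]]])
    have "((\<lambda>y. L'.\<Gamma> (\<phi> y) (dd \<phi> y v) (dd \<phi> y w) + D2 y v w) has_derivative
       (\<lambda>u. (dd (\<lambda>y. L'.\<Gamma> y (?F v) (?F w)) (\<phi> x) (?F u) + L'.\<Gamma> (\<phi> x) (D2 x u v) (?F w)
       + L'.\<Gamma> (\<phi> x) (?F v) (D2 x u w)) + dd (\<lambda>y. D2 y v w) x u)) (at x within O')"
      by (intro has_derivative_add L'.levi_civita_product_rule[OF \<phi>_der[OF x] x in_U(2) \<phi>_der2[OF x] \<phi>_der2[OF x]]
          has_derivative_at_withinI[OF smooth_on_has_derivative[OF D2_smooth O(1) x]])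
    then have 2: "((\<lambda>y. dd \<phi> y (L.\<Gamma> y v w)) has_derivative
       (\<lambda>u. (dd (\<lambda>y. L'.\<Gamma> y (?F v) (?F w)) (\<phi> x) (?F u) + L'.\<Gamma> (\<phi> x) (D2 x u v) (?F w)
       + L'.\<Gamma> (\<phi> x) (?F v) (D2 x u w)) + dd (\<lambda>y. D2 y v w) x u)) (at x within O')"
      by (rule has_derivative_transform[OF x, rotated]) (rule levi_civita_transform)
    show ?thesis using fun_cong[OF derivative_setD[OF derivative_set_open[OF O(1)] x 1 2], of u] by simp
  qed
  have sym3: "dd (\<lambda>y. D2 y v w) x u = dd (\<lambda>y. D2 y u w) x v"
    by (rule second_derivative_symmetric[OF smooth_onD[OF smooth_on_dd[OF smooth_\<phi> O(1)]] O(1) x])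
  have FG: "?F (L.\<Gamma> x u (L.\<Gamma> x v w)) = L'.\<Gamma> (\<phi> x) (?F u) (L'.\<Gamma> (\<phi> x) (?F v) (?F w))
      + L'.\<Gamma> (\<phi> x) (?F u) (D2 x v w) + D2 x u (L.\<Gamma> x v w)" for u v
    by (simp add: levi_civita_transform[OF x] L'.\<Gamma>_simps[OF in_U(2)[OF x]])
  have dF: "?F (dd (\<lambda>y. L.\<Gamma> y v w) x u) =
     dd (\<lambda>y. L'.\<Gamma> y (?F v) (?F w)) (\<phi> x) (?F u) + L'.\<Gamma> (\<phi> x) (D2 x u v) (?F w)
       + L'.\<Gamma> (\<phi> x) (?F v) (D2 x u w) + dd (\<lambda>y. D2 y v w) x u - D2 x u (L.\<Gamma> x v w)" for u v
    by (rule add_implies_diff, rule trans[OF add.commute *])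
  have "?F (L.R x u v w) = ?F (dd (\<lambda>y. L.\<Gamma> y v w) x u) - ?F (dd (\<lambda>y. L.\<Gamma> y u w) x v)
     + ?F (L.\<Gamma> x u (L.\<Gamma> x v w)) - ?F (L.\<Gamma> x v (L.\<Gamma> x u w))"
    unfolding riemann_def using linear_\<phi>'[OF x] by (simp add: linear_add linear_diff)
  then show ?thesis
    unfolding dF FG riemann_def[of g'] by (simp add: sym3 D2_sym[OF x, of u v])
qed

end

section \<open>Metric quantities along maps, and orthonormal bases\<close>

context local_metric
begin

lemma Ck_on_g:
  assumes S: "derivative_set S" and x: "Ck_on k x S" "x ` S \<subseteq> U" and a: "Ck_on k a S" and b: "Ck_on k b S"
  shows "Ck_on k (\<lambda>t. g (x t) (a t) (b t)) S"
proof (rule Ck_on_lin_apply[OF S _ _ b])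
  show "linear (g (x t) (a t))" if "t \<in> S" for t using x that g_linear' by blast
  show "Ck_on k (\<lambda>t. g (x t) (a t) w) S" for w
  proof (rule Ck_on_lin_apply[OF S _ _ a])
    show "linear (\<lambda>u. g (x t) u w)" if "t \<in> S" for t using x that g_linear by blast
    show "Ck_on k (\<lambda>t. g (x t) v w) S" for v
      by (rule Ck_on_compose[OF S derivative_set_U x(2,1) smooth_onD[OF smooth_g]])
  qed
qed

lemma Ck_on_levi_civita:
  assumes S: "derivative_set S" and x: "Ck_on k x S" "x ` S \<subseteq> U" and a: "Ck_on k a S" and b: "Ck_on k b S"
  shows "Ck_on k (\<lambda>t. \<Gamma> (x t) (a t) (b t)) S"
proof (rule Ck_on_lin_apply[OF S _ _ b])
  show "linear (\<Gamma> (x t) (a t))" if "t \<in> S" for t using x that levi_civita_linear by blast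
  show "Ck_on k (\<lambda>t. \<Gamma> (x t) (a t) w) S" for w
  proof (rule Ck_on_lin_apply[OF S _ _ a])
    show "linear (\<lambda>u. \<Gamma> (x t) u w)" if "t \<in> S" for t using x that levi_civita_linear' by blast
    show "Ck_on k (\<lambda>t. \<Gamma> (x t) v w) S" for v
      by (rule Ck_on_compose[OF S derivative_set_U x(2,1) smooth_onD[OF smooth_levi_civita]])
  qed
qed

lemma Ck_on_riemann:
  assumes S: "derivative_set S" and x: "Ck_on k x S" "x ` S \<subseteq> U" and a: "Ck_on k a S" and b: "Ck_on k b S"
    and c: "Ck_on k c S"
  shows "Ck_on k (\<lambda>t. R (x t) (a t) (b t) (c t)) S"
proof (rule Ck_on_lin_apply[OF S _ _ c])
  show "linear (R (x t) (a t) (b t))" if "t \<in> S" for t using x that riemann_linear' by blast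
  show "Ck_on k (\<lambda>t. R (x t) (a t) (b t) w) S" for w
  proof (rule Ck_on_lin_apply[OF S _ _ b])
    show "linear (\<lambda>v. R (x t) (a t) v w)" if "t \<in> S" for t using x that riemann_linear2 by blast
    show "Ck_on k (\<lambda>t. R (x t) (a t) v w) S" for v
    proof (rule Ck_on_lin_apply[OF S _ _ a])
      show "linear (\<lambda>u. R (x t) u v w)" if "t \<in> S" for t using x that riemann_linear by blast
      show "Ck_on k (\<lambda>t. R (x t) u v w) S" for u
        by (rule Ck_on_compose[OF S derivative_set_U x(2,1) smooth_onD[OF smooth_riemann]])
    qed
  qed
qed

text \<open>Orthonormal sets are independent, so one of maximal cardinality exists. It spans, for
  otherwise the normalised residual of a vector outside its span would enlarge it. Matching it with
  \<open>Basis\<close> gives an isometry from the standard inner product.\<close>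

lemma orthonormal_frame:
  assumes x: "x \<in> U"
  shows "\<exists>f :: 'e \<Rightarrow> 'e. linear f \<and> (\<forall>a b. g x (f a) (f b) = a \<bullet> b)"
proof -
  define P where "P B \<longleftrightarrow> finite B \<and> (\<forall>a\<in>B. \<forall>b\<in>B. g x a b = (if a = b then 1 else 0))" for B
  have ind: "independent B" if "P B" for B
  proof (rule independent_if_scalars_zero)
    show "finite B" using that by (simp add: P_def)
    fix h b assume h: "(\<Sum>a\<in>B. h a *\<^sub>R a) = 0" and b: "b \<in> B"
    have "0 = g x (\<Sum>a\<in>B. h a *\<^sub>R a) b" unfolding h by (simp add: g_simps x)
    also have "\<dots> = (\<Sum>a\<in>B. h a * g x a b)"
      by (simp add: linear_sum[OF g_linear[OF x]] g_simps x)
    also have "\<dots> = (\<Sum>a\<in>B. if a = b then h a else 0)"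
      using that b by (intro sum.cong) (auto simp: P_def)
    also have "\<dots> = h b" using that b by (simp add: P_def)
    finally show "h b = 0" by simp
  qed
  have "\<forall>B. P B \<longrightarrow> card B < Suc DIM('e)"
    using independent_bound[OF ind] by (simp add: less_Suc_eq_le)
  moreover have "P {}" by (simp add: P_def)
  ultimately have "\<exists>B. P B \<and> (\<forall>C. P C \<longrightarrow> card C \<le> card B)" by (rule ex_has_greatest_nat[rotated])
  then obtain B where B: "P B" and max: "\<And>C. P C \<Longrightarrow> card C \<le> card B" by blast
  have finB: "finite B" using B by (simp add: P_def)
  have "span B = UNIV"
  proof (rule ccontr)
    assume "span B \<noteq> UNIV"
    then obtain v where v: "v \<notin> span B" by blast
    define w where "w = v - (\<Sum>a\<in>B. g x v a *\<^sub>R a)"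
    have w0: "w \<noteq> 0"
    proof
      assume "w = 0"
      moreover have "v - w \<in> span B"
        by (simp add: w_def) (intro span_sum span_scale span_base)
      ultimately show False using v by simp
    qed
    have wb: "g x w b = 0" if b: "b \<in> B" for b
    proof -
      have "g x (\<Sum>a\<in>B. g x v a *\<^sub>R a) b = (\<Sum>a\<in>B. g x v a * g x a b)"
        by (simp add: linear_sum[OF g_linear[OF x]] g_simps x)
      also have "\<dots> = (\<Sum>a\<in>B. if a = b then g x v a else 0)"
        using B b by (intro sum.cong) (auto simp: P_def)
      also have "\<dots> = g x v b" using finB b by simp
      finally show ?thesis by (simp add: w_def g_simps x)
    qed
    define u where "u = (1 / sqrt (g x w w)) *\<^sub>R w"
    have pos: "g x w w > 0" by (rule g_pos[OF x w0])
    have uu: "g x u u = 1" using pos by (simp add: u_def g_simps x)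
    have ub: "g x u b = 0" "g x b u = 0" if "b \<in> B" for b
      using wb[OF that] g_sym[OF x, of b] by (simp_all add: u_def g_simps x)
    have "u \<notin> B" using ub uu by fastforce
    moreover have "P (insert u B)" using B ub uu \<open>u \<notin> B\<close> by (auto simp: P_def)
    ultimately show False using max[of "insert u B"] finB by simp
  qed
  then have "card B = DIM('e)"
    using dim_eq_card_independent[OF ind[OF B]] by (metis dim_UNIV dim_span)
  then obtain h where h: "bij_betw h (Basis :: 'e set) B"
    using finB finite_same_card_bij[of "Basis :: 'e set" B] by auto
  define f where "f a = (\<Sum>i\<in>Basis. (a \<bullet> i) *\<^sub>R h i)" for a
  have f: "linear f"
    unfolding f_def by (rule linearI) (simp_all add: inner_left_distrib scaleR_add_left sum.distrib scaleR_sum_right)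
  have gh: "g x (h i) (h j) = (if i = j then 1 else 0)" if "i \<in> Basis" "j \<in> Basis" for i j
    using h B that unfolding P_def bij_betw_def inj_on_def by (metis imageI)
  have "g x (f a) (f b) = a \<bullet> b" for a b
  proof -
    have 1: "g x (f a) w = (\<Sum>i\<in>Basis. (a \<bullet> i) * g x (h i) w)" for w
      by (simp add: f_def linear_sum[OF g_linear[OF x]] g_simps x)
    have 2: "g x w (f b) = (\<Sum>j\<in>Basis. (b \<bullet> j) * g x w (h j))" for w
      by (simp add: f_def linear_sum[OF g_linear'[OF x]] g_simps x)
    have "g x (f a) (f b) = (\<Sum>i\<in>Basis. \<Sum>j\<in>Basis. (a \<bullet> i) * ((b \<bullet> j) * g x (h i) (h j)))"
      unfolding 1[of "f b"] unfolding 2 sum_distrib_left ..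
    also have "\<dots> = (\<Sum>i\<in>Basis. \<Sum>j\<in>Basis. if i = j then (a \<bullet> i) * (b \<bullet> j) else 0)"
      by (intro sum.cong refl) (simp add: gh)
    also have "\<dots> = a \<bullet> b" by (simp add: euclidean_inner[of a b])
    finally show ?thesis .
  qed
  then show ?thesis using f by (intro exI[of _ f]) simp
qed

end

section \<open>Tangent vectors in coordinates\<close>

lemma coords_simps [simp]:
  "coords 0 c = 0" "coords (X + Y) c = coords X c + coords Y c" "coords (X - Y) c = coords X c - coords Y c"
  "coords (- X) c = - coords X c" "coords (a *\<^sub>R X) c = a *\<^sub>R coords X c"
  by (simp_all add: zero_tvec_def plus_tvec_def minus_tvec_def uminus_tvec_def scaleR_tvec_def)

lemma coords_sum [simp]: "coords (\<Sum>i\<in>I. X i) c = (\<Sum>i\<in>I. coords (X i) c)"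
  by (induction I rule: infinite_finite_induct) auto

lemma tvec_eqI: "(\<And>c. coords X c = coords Y c) \<Longrightarrow> X = Y"
  by (cases X; cases Y) auto

locale riemannian =
  fixes M :: "('m, 'e::euclidean_space) riem"
  assumes riemannian_manifold: "riemannian_manifold M"
begin

lemma atlas_props:
  assumes "c \<in> atlas M"
  shows "openin (mtop M) (chart_dom c)" "open (chart_img c)"
    "homeomorphic_map (subtopology (mtop M) (chart_dom c)) (top_of_set (chart_img c)) (chart_map c)"
  using riemannian_manifold assms unfolding riemannian_manifold_def smooth_manifold_def by auto

lemma charts_atD: "c \<in> charts_at M p \<Longrightarrow> c \<in> atlas M" "c \<in> charts_at M p \<Longrightarrow> p \<in> chart_dom c"
  by (auto simp: charts_at_def)

lemma chart_inj: assumes "c \<in> atlas M" shows "inj_on (chart_map c) (chart_dom c)"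
proof -
  have "chart_dom c \<subseteq> topspace (mtop M)" using atlas_props(1)[OF assms] openin_subset by blast
  then show ?thesis using atlas_props(3)[OF assms]
    by (auto simp: homeomorphic_eq_everything_map topspace_subtopology Int_absorb1)
qed

lemma chart_inv_map [simp]: "c \<in> atlas M \<Longrightarrow> p \<in> chart_dom c \<Longrightarrow> chart_inv c (chart_map c p) = p"
  unfolding chart_inv_def by (rule inv_into_f_f[OF chart_inj])

lemma chart_map_inv: "x \<in> chart_img c \<Longrightarrow> chart_map c (chart_inv c x) = x"
  unfolding chart_inv_def chart_img_def by (rule f_inv_into_f)

lemma chart_inv_dom: "x \<in> chart_img c \<Longrightarrow> chart_inv c x \<in> chart_dom c"
  unfolding chart_inv_def chart_img_def by (rule inv_into_into)

lemma chart_map_img: "p \<in> chart_dom c \<Longrightarrow> chart_map c p \<in> chart_img c"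
  by (simp add: chart_img_def)

lemma open_chart_image:
  assumes c: "c \<in> atlas M" and W: "openin (mtop M) W" "W \<subseteq> chart_dom c"
  shows "open (chart_map c ` W)"
proof -
  have "openin (subtopology (mtop M) (chart_dom c)) W"
    using W by (metis inf.absorb1 openin_subtopology)
  then have "openin (top_of_set (chart_img c)) (chart_map c ` W)"
    using homeomorphic_imp_open_map[OF atlas_props(3)[OF c]] by (auto simp: open_map_def)
  then show ?thesis using atlas_props(2)[OF c] openin_open_trans by blast
qed

abbreviation transition :: "('m, 'e) chart \<Rightarrow> ('m, 'e) chart \<Rightarrow> 'e \<Rightarrow> 'e" where
  "transition c d \<equiv> chart_map d \<circ> chart_inv c"

abbreviation ovl :: "('m, 'e) chart \<Rightarrow> ('m, 'e) chart \<Rightarrow> 'e set" where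
  "ovl c d \<equiv> chart_map c ` (chart_dom c \<inter> chart_dom d)"

lemma open_ovl: "c \<in> atlas M \<Longrightarrow> d \<in> atlas M \<Longrightarrow> open (ovl c d)"
  by (rule open_chart_image) (auto intro: atlas_props openin_Int)

lemma smooth_trans: "c \<in> atlas M \<Longrightarrow> d \<in> atlas M \<Longrightarrow> smooth_on (transition c d) (ovl c d)"
  using riemannian_manifold unfolding riemannian_manifold_def smooth_manifold_def by blast

lemma dd_trans_self:
  assumes "c \<in> charts_at M p" shows "dd (transition c c) (chart_map c p) v = v"
proof (rule dd_eq)
  have "((\<lambda>v. v) has_derivative (\<lambda>v. v)) (at (chart_map c p))" by (rule has_derivative_ident)
  then show "(transition c c has_derivative (\<lambda>v. v)) (at (chart_map c p))"
    by (rule has_derivative_transform_within_open[OF _ atlas_props(2)[OF charts_atD(1)[OF assms]]])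
       (use assms in \<open>auto simp: chart_map_inv charts_at_def chart_map_img\<close>)
qed

lemma trans_has_derivative:
  assumes "c \<in> charts_at M p" "d \<in> charts_at M p"
  shows "(transition c d has_derivative dd (transition c d) (chart_map c p)) (at (chart_map c p))"
  using assms
  by (intro smooth_on_has_derivative[OF smooth_trans open_ovl]) (auto simp: charts_at_def)

lemma linear_dd_trans:
  assumes "c \<in> charts_at M p" "d \<in> charts_at M p"
  shows "linear (dd (transition c d) (chart_map c p))"
  using has_derivative_bounded_linear[OF trans_has_derivative[OF assms]] by (rule bounded_linear.linear)

text \<open>The chain rule, as the composed transitions agree with the direct one near the point.
  This compatibility is what makes \<open>tangent_of_coords\<close> an element of
  \<open>tangent_space\<close>.\<close>

lemma dd_trans_cocycle:
  assumes c: "c \<in> charts_at M p" and d: "d \<in> charts_at M p" and e: "e \<in> charts_at M p"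
  shows "dd (transition d e) (chart_map d p) (dd (transition c d) (chart_map c p) v) = dd (transition c e) (chart_map c p) v"
proof (rule dd_eq[symmetric])
  have p: "transition c d (chart_map c p) = chart_map d p" using c by (simp add: charts_at_def)
  have "((\<lambda>x. transition d e (transition c d x)) has_derivative
      (\<lambda>v. dd (transition d e) (chart_map d p) (dd (transition c d) (chart_map c p) v))) (at (chart_map c p))"
    by (rule has_derivative_compose[OF trans_has_derivative[OF c d]])
       (unfold p, rule trans_has_derivative[OF d e])
  then show "(transition c e has_derivative
      (\<lambda>v. dd (transition d e) (chart_map d p) (dd (transition c d) (chart_map c p) v))) (at (chart_map c p))"
  proof (rule has_derivative_transform_within_open)
    show "open (ovl c d)" "chart_map c p \<in> ovl c d" using c d by (auto intro!: open_ovl simp: charts_at_def)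
  qed (use c d in \<open>auto simp: charts_at_def\<close>)
qed

lemma tangent_spaceD:
  assumes "X \<in> tangent_space M p" "c \<in> charts_at M p" "d \<in> charts_at M p"
  shows "coords X d = dd (transition c d) (chart_map c p) (coords X c)"
  using assms unfolding tangent_space_def by blast

lemma tangent_spaceI:
  assumes "\<And>c d. c \<in> charts_at M p \<Longrightarrow> d \<in> charts_at M p \<Longrightarrow>
      coords X d = dd (transition c d) (chart_map c p) (coords X c)"
    and "\<And>c. c \<notin> charts_at M p \<Longrightarrow> coords X c = 0"
  shows "X \<in> tangent_space M p"
  using assms unfolding tangent_space_def by blast

lemma tangent_space_coords_0: "X \<in> tangent_space M p \<Longrightarrow> c \<notin> charts_at M p \<Longrightarrow> coords X c = 0"
  unfolding tangent_space_def by blast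

lemma tangent_space_eqI:
  assumes X: "X \<in> tangent_space M p" and Y: "Y \<in> tangent_space M p" and c: "c \<in> charts_at M p"
    and eq: "coords X c = coords Y c"
  shows "X = Y"
proof (rule tvec_eqI)
  fix d show "coords X d = coords Y d"
  proof (cases "d \<in> charts_at M p")
    case True
    then show ?thesis using tangent_spaceD[OF X c True] tangent_spaceD[OF Y c True] eq by simp
  next
    case False
    then show ?thesis by (simp add: tangent_space_coords_0[OF X] tangent_space_coords_0[OF Y])
  qed
qed

lemma coords_tangent_of_coords:
  "d \<in> charts_at M p \<Longrightarrow> coords (tangent_of_coords M c p v) d = dd (transition c d) (chart_map c p) v"
  by (simp add: tangent_of_coords_def)

lemma coords_tangent_of_coords_self:
  "c \<in> charts_at M p \<Longrightarrow> coords (tangent_of_coords M c p v) c = v"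
  using coords_tangent_of_coords dd_trans_self by metis

lemma tangent_of_coords_in:
  assumes c: "c \<in> charts_at M p" shows "tangent_of_coords M c p v \<in> tangent_space M p"
  unfolding tangent_space_def
proof (intro CollectI conjI ballI allI impI)
  fix d e assume "d \<in> charts_at M p" "e \<in> charts_at M p"
  then show "coords (tangent_of_coords M c p v) e
      = dd (transition d e) (chart_map d p) (coords (tangent_of_coords M c p v) d)"
    using dd_trans_cocycle[OF c] by (simp add: coords_tangent_of_coords)
qed (simp add: tangent_of_coords_def)

lemma tangent_of_coords_coords:
  assumes "X \<in> tangent_space M p" "c \<in> charts_at M p"
  shows "tangent_of_coords M c p (coords X c) = X"
  by (rule tangent_space_eqI[OF tangent_of_coords_in assms(1) assms(2)])
     (use assms coords_tangent_of_coords_self in auto)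

lemma subspace_tangent_space: "subspace (tangent_space M p)"
proof (rule subspaceI)
  have lin: "linear (dd (transition c d) (chart_map c p))" if "c \<in> charts_at M p" "d \<in> charts_at M p" for c d
    by (rule linear_dd_trans[OF that])
  show "0 \<in> tangent_space M p"
    by (rule tangent_spaceI) (simp_all add: linear_0[OF lin])
  show "X + Y \<in> tangent_space M p" if X: "X \<in> tangent_space M p" and Y: "Y \<in> tangent_space M p" for X Y
  proof (rule tangent_spaceI)
    fix c d assume cd: "c \<in> charts_at M p" "d \<in> charts_at M p"
    show "coords (X + Y) d = dd (transition c d) (chart_map c p) (coords (X + Y) c)"
      unfolding coords_simps linear_add[OF lin[OF cd]]
      by (intro arg_cong2[where f="(+)"] tangent_spaceD cd X Y)
  qed (simp add: tangent_space_coords_0[OF X] tangent_space_coords_0[OF Y])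
  show "r *\<^sub>R X \<in> tangent_space M p" if X: "X \<in> tangent_space M p" for X r
  proof (rule tangent_spaceI)
    fix c d assume cd: "c \<in> charts_at M p" "d \<in> charts_at M p"
    show "coords (r *\<^sub>R X) d = dd (transition c d) (chart_map c p) (coords (r *\<^sub>R X) c)"
      unfolding coords_simps linear_cmul[OF lin[OF cd]]
      by (intro arg_cong2[where f="(*\<^sub>R)"] tangent_spaceD cd X refl)
  qed (simp add: tangent_space_coords_0[OF X])
qed

lemma in_topspace: "c \<in> charts_at M p \<Longrightarrow> p \<in> topspace (mtop M)"
  using subsetD[OF openin_subset[OF atlas_props(1)[OF charts_atD(1)]] charts_atD(2)] by blast

lemma inner_product: "c \<in> charts_at M p \<Longrightarrow> inner_product_on (tangent_space M p) (rmetric M p)"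
  using riemannian_manifold in_topspace unfolding riemannian_manifold_def by blast

lemma rmetric_coords:
  assumes "c \<in> charts_at M p" "X \<in> tangent_space M p" "Y \<in> tangent_space M p"
  shows "rmetric M p X Y = metric_coeff M c (chart_map c p) (coords X c) (coords Y c)"
  using assms unfolding metric_coeff_def
  by (simp add: charts_atD tangent_of_coords_coords)

lemma tangent_of_coords_linear:
  assumes c: "c \<in> charts_at M p" shows "linear (tangent_of_coords M c p)"
proof (rule linearI)
  note sub = subspace_tangent_space[of p]
  show "tangent_of_coords M c p (u + v) = tangent_of_coords M c p u + tangent_of_coords M c p v" for u v
    by (rule tangent_space_eqI[OF _ _ c])
       (auto intro: tangent_of_coords_in[OF c] subspace_add[OF sub] simp: coords_tangent_of_coords_self[OF c])
  show "tangent_of_coords M c p (r *\<^sub>R v) = r *\<^sub>R tangent_of_coords M c p v" for r v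
    by (rule tangent_space_eqI[OF _ _ c])
       (auto intro: tangent_of_coords_in[OF c] subspace_scale[OF sub] simp: coords_tangent_of_coords_self[OF c])
qed

lemma chart_inv_charts_at: "c \<in> atlas M \<Longrightarrow> x \<in> chart_img c \<Longrightarrow> c \<in> charts_at M (chart_inv c x)"
  by (simp add: charts_at_def chart_inv_dom)

lemma local_metric_chart:
  assumes c: "c \<in> atlas M" shows "local_metric (chart_img c) (metric_coeff M c)"
proof
  show "open (chart_img c)" using atlas_props[OF c] by blast
  show "smooth_on (\<lambda>x. metric_coeff M c x v w) (chart_img c)" for v w
    using riemannian_manifold c unfolding riemannian_manifold_def by blast
  fix x u v w and r :: real assume x: "x \<in> chart_img c"
  note cp = chart_inv_charts_at[OF c x]
  note ip = inner_product[OF cp, unfolded inner_product_on_def]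
  note tin = tangent_of_coords_in[OF cp]
  note lin = tangent_of_coords_linear[OF cp]
  show "metric_coeff M c x (u + v) w = metric_coeff M c x u w + metric_coeff M c x v w"
    using ip tin by (simp add: metric_coeff_def linear_add[OF lin])
  show "metric_coeff M c x (r *\<^sub>R u) w = r * metric_coeff M c x u w"
    using ip tin by (simp add: metric_coeff_def linear_cmul[OF lin])
  show "metric_coeff M c x u w = metric_coeff M c x w u"
    using ip tin by (simp add: metric_coeff_def)
  assume "u \<noteq> 0"
  then have "tangent_of_coords M c (chart_inv c x) u \<noteq> 0"
    using coords_tangent_of_coords_self[OF cp, of u] by auto
  then show "metric_coeff M c x u u > 0" using ip tin by (simp add: metric_coeff_def)
qed

text \<open>Both coefficient functions evaluate the same metric on the same tangent vectors, so the
  transition map is isometric. The reverse transition inverts its derivative, which is therefore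
  onto.\<close>

lemma local_isometry_trans:
  assumes c: "c \<in> atlas M" and d: "d \<in> atlas M"
  shows "local_isometry (chart_img c) (metric_coeff M c) (chart_img d) (metric_coeff M d) (ovl c d) (transition c d)"
proof (intro local_isometry.intro local_isometry_axioms.intro local_metric_chart c d)
  show "open (ovl c d)" "smooth_on (transition c d) (ovl c d)" using open_ovl smooth_trans c d by auto
  show "ovl c d \<subseteq> chart_img c" by (auto simp: chart_img_def)
  show "transition c d ` ovl c d \<subseteq> chart_img d" using c by (auto simp: chart_img_def)
  fix x u v assume "x \<in> ovl c d"
  then obtain p where p: "p \<in> chart_dom c" "p \<in> chart_dom d" "x = chart_map c p" by auto
  have cp: "c \<in> charts_at M p" "d \<in> charts_at M p" using c d p by (auto simp: charts_at_def)
  have *: "tangent_of_coords M d p (dd (transition c d) x u) = tangent_of_coords M c p u" for u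
    using tangent_of_coords_coords[OF tangent_of_coords_in[OF cp(1), of u] cp(2)]
    by (simp add: coords_tangent_of_coords cp p(3))
  show "metric_coeff M c x u v = metric_coeff M d (transition c d x) (dd (transition c d) x u) (dd (transition c d) x v)"
    unfolding metric_coeff_def using c d p * by simp
  show "surj (dd (transition c d) x)"
    using dd_trans_cocycle[OF cp(2,1,2)] dd_trans_self[OF cp(2)] p(3) by (metis surjI)
qed

text \<open>\<open>curvature\<close> is given by a separate formula in each chart; the
  transformation law of the curvature says that these values fit together.\<close>

lemma curvature_in_tangent_space:
  assumes "X \<in> tangent_space M p" "Y \<in> tangent_space M p" "Z \<in> tangent_space M p"
  shows "curvature M p X Y Z \<in> tangent_space M p"
proof (rule tangent_spaceI)
  fix c d assume cd: "c \<in> charts_at M p" "d \<in> charts_at M p"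
  interpret local_isometry "chart_img c" "metric_coeff M c" "chart_img d" "metric_coeff M d" "ovl c d" "transition c d"
    using local_isometry_trans cd by (simp add: charts_at_def)
  have "chart_map c p \<in> ovl c d" using cd by (auto simp: charts_at_def)
  note * = riemann_transform[OF this]
  show "coords (curvature M p X Y Z) d =
      dd (transition c d) (chart_map c p) (coords (curvature M p X Y Z) c)"
    using cd *[of "coords X c" "coords Y c" "coords Z c"]
    unfolding assms[THEN tangent_spaceD, OF cd, symmetric]
    by (simp add: curvature_def curvature_coeff_eq charts_at_def)
qed (simp add: curvature_def)

end

section \<open>Parallel frames along geodesics\<close>

locale geodesic = riemannian M for M :: "('m, 'e::euclidean_space) riem" +
  fixes l :: real and \<gamma> :: "real \<Rightarrow> 'm"
  assumes normal_geodesic: "normal_geodesic M l \<gamma>"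
begin

abbreviation vel :: "real \<Rightarrow> ('m, 'e) tvec" where "vel \<equiv> velocity M l \<gamma>"
abbreviation I where "I \<equiv> {0..l}"
text \<open>A relatively open set of times but in general not an interval, which is why smoothness
  is handled on arbitrary sets with unique derivatives.\<close>

definition S :: "('m, 'e) chart \<Rightarrow> real set" where "S c = {t \<in> I. \<gamma> t \<in> chart_dom c}"
abbreviation pt :: "('m, 'e) chart \<Rightarrow> real \<Rightarrow> 'e" where "pt c t \<equiv> chart_map c (\<gamma> t)"
abbreviation chr where "chr c \<equiv> levi_civita (metric_coeff M c)"

lemma l_pos: "0 < l" and smooth_curve: "smooth_curve M l \<gamma>"
  using normal_geodesic by (simp_all add: normal_geodesic_def)

lemma derivative_set_I: "derivative_set I"
  by (rule derivative_set_interval[OF l_pos])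

lemma not_bot: "t \<in> I \<Longrightarrow> at t within I \<noteq> bot"
  using l_pos by (simp add: trivial_limit_within islimpt_Icc)

lemma S_I: "t \<in> S c \<Longrightarrow> t \<in> I"
  by (simp add: S_def)

lemma in_S: "t \<in> I \<Longrightarrow> c \<in> charts_at M (\<gamma> t) \<Longrightarrow> t \<in> S c"
  by (simp add: S_def charts_at_def)

lemma in_charts_at: "c \<in> atlas M \<Longrightarrow> t \<in> S c \<Longrightarrow> c \<in> charts_at M (\<gamma> t)"
  by (simp add: S_def charts_at_def)

lemma S_open:
  assumes "c \<in> atlas M" shows "\<exists>N. open N \<and> S c = I \<inter> N"
proof -
  have "openin (top_of_set I) {t \<in> topspace (top_of_set I). \<gamma> t \<in> chart_dom c}"
    using smooth_curve atlas_props(1)[OF assms] openin_continuous_map_preimage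
    unfolding smooth_curve_def by blast
  then show ?thesis by (auto simp: S_def openin_open)
qed

lemma derivative_set_S: assumes "c \<in> atlas M" shows "derivative_set (S c)"
proof -
  obtain N where "open N" "S c = I \<inter> N" using S_open[OF assms] by blast
  then show ?thesis using derivative_set_Int_open[OF derivative_set_I] by simp
qed

lemma at_within_S:
  assumes c: "c \<in> atlas M" and t: "t \<in> S c" shows "at t within S c = at t within I"
proof -
  obtain N where N: "open N" "S c = I \<inter> N" using S_open[OF c] by blast
  show ?thesis by (rule at_within_nhd[of t N]) (use N t in auto)
qed

lemma charts_at_exists:
  assumes t: "t \<in> I" shows "\<exists>c. c \<in> charts_at M (\<gamma> t)"
proof -
  have "\<gamma> t \<in> topspace (mtop M)"
    using smooth_curve t by (auto simp: smooth_curve_def continuous_map_def)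
  also have "\<dots> = (\<Union>c\<in>atlas M. chart_dom c)"
    using riemannian_manifold by (simp add: riemannian_manifold_def smooth_manifold_def)
  finally show ?thesis by (auto simp: charts_at_def)
qed

lemma pt_img: "t \<in> S c \<Longrightarrow> pt c t \<in> chart_img c"
  by (simp add: S_def chart_map_img)

lemma pt_image: "pt c ` S c \<subseteq> chart_img c"
  by (rule image_subsetI) (rule pt_img)

lemma Ck_on_pt: "c \<in> atlas M \<Longrightarrow> Ck_on k (pt c) (S c)"
  using smooth_curve unfolding smooth_curve_def S_def smooth_on_def comp_def by blast

lemma pt_has_vector_derivative:
  assumes "c \<in> atlas M" "t \<in> S c"
  shows "(pt c has_vector_derivative coords (vel t) c) (at t within I)"
proof -
  have "pt c differentiable (at t within I)"
    using Ck_on_Suc_has_derivative[OF Ck_on_pt[OF assms(1)] assms(2)] at_within_S[OF assms]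
    by (auto simp: differentiable_def)
  then show ?thesis
    using in_charts_at[OF assms] by (simp add: velocity_def vector_derivative_works comp_def)
qed

lemma Ck_on_vel:
  assumes c: "c \<in> atlas M" shows "Ck_on k (\<lambda>t. coords (vel t) c) (S c)"
proof -
  have "(pt c has_derivative (\<lambda>h. h *\<^sub>R coords (vel t) c)) (at t within S c)" if "t \<in> S c" for t
    using pt_has_vector_derivative[OF c that] at_within_S[OF c that] by (simp add: has_vector_derivative_def)
  from Ck_on_Suc_iff[OF derivative_set_S[OF c] this, of k]
  have "\<forall>v. Ck_on k (\<lambda>t. v *\<^sub>R coords (vel t) c) (S c)" using Ck_on_pt[OF c] by blast
  from spec[OF this, of 1] show ?thesis by simp
qed

lemma trans_pt: "t \<in> S c \<Longrightarrow> c \<in> atlas M \<Longrightarrow> transition c d (pt c t) = pt d t"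
  by (simp add: S_def)

lemma vel_tangent: assumes t: "t \<in> I" shows "vel t \<in> tangent_space M (\<gamma> t)"
proof (rule tangent_spaceI)
  fix c d assume cd: "c \<in> charts_at M (\<gamma> t)" "d \<in> charts_at M (\<gamma> t)"
  note c = charts_atD(1)[OF cd(1)] and d = charts_atD(1)[OF cd(2)]
  note tc = in_S[OF t cd(1)] and td = in_S[OF t cd(2)]
  have "((\<lambda>t. transition c d (pt c t)) has_derivative
     (\<lambda>h. dd (transition c d) (pt c t) (h *\<^sub>R coords (vel t) c))) (at t within S c)"
    using pt_has_vector_derivative[OF c tc]
    unfolding at_within_S[OF c tc] has_vector_derivative_def
    by (rule has_derivative_compose[where f="pt c" and g="transition c d", OF _ trans_has_derivative[OF cd]])
  then have "(pt d has_derivative (\<lambda>h. dd (transition c d) (pt c t) (h *\<^sub>R coords (vel t) c))) (at t within S c)"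
    by (rule has_derivative_transform[OF tc, rotated]) (simp add: trans_pt c del: o_apply)
  then have "(pt d has_vector_derivative dd (transition c d) (pt c t) (coords (vel t) c)) (at t within I)"
    using at_within_S[OF c tc] linear_cmul[OF linear_dd_trans[OF cd]] by (simp add: has_vector_derivative_def)
  from vector_derivative_unique_within[OF not_bot[OF t] pt_has_vector_derivative[OF d td] this]
  show "coords (vel t) d = dd (transition c d) (pt c t) (coords (vel t) c)" .
qed (simp add: velocity_def)

section \<open>Covariant derivatives in charts and parallel transport\<close>

lemma local_metric': "c \<in> charts_at M (\<gamma> t) \<Longrightarrow> local_metric (chart_img c) (metric_coeff M c)"
  by (rule local_metric_chart) (simp add: charts_at_def)

text \<open>The covariant derivative does not depend on the chart: differentiating the transition
  along the curve produces a second derivative, which is exactly the inhomogeneous term in the law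
  for the Christoffel symbols. \<open>J\<close> may be a subinterval because transport is built
  piecewise.\<close>

lemma covariant_transform:
  assumes cd: "c \<in> charts_at M (\<gamma> t)" "d \<in> charts_at M (\<gamma> t)" and J: "t \<in> J" "J \<subseteq> I"
    and X: "(X has_vector_derivative X') (at t within J)"
  shows "((\<lambda>s. dd (transition c d) (pt c s) (X s)) has_vector_derivative
      dd (transition c d) (pt c t) (X' + chr c (pt c t) (coords (vel t) c) (X t))
      - chr d (pt d t) (coords (vel t) d) (dd (transition c d) (pt c t) (X t))) (at t within J)"
proof -
  note c = charts_atD(1)[OF cd(1)] and d = charts_atD(1)[OF cd(2)]
  have t: "t \<in> I" using J by blast
  note tc = in_S[OF t cd(1)] and td = in_S[OF t cd(2)]
  interpret local_isometry "chart_img c" "metric_coeff M c" "chart_img d" "metric_coeff M d" "ovl c d" "transition c d"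
    using local_isometry_trans[OF c d] .
  obtain N where N: "open N" "S c = I \<inter> N" using S_open[OF c] by blast
  obtain N' where N': "open N'" "S d = I \<inter> N'" using S_open[OF d] by blast
  \<comment> \<open>Near t the curve lies in both chart domains, and restricting to such times
    leaves the filter at t unchanged.\<close>
  let ?J = "J \<inter> (N \<inter> N')"
  have at: "at t within ?J = at t within J"
    by (rule at_within_nhd[of t "N \<inter> N'"]) (use N N' tc td in auto)
  have tJ: "t \<in> ?J" using J tc td N N' by auto
  have JS: "s \<in> S c" "s \<in> S d" if "s \<in> ?J" for s using that J N N' by auto
  have ovl: "pt c s \<in> ovl c d" if "s \<in> ?J" for s using JS[OF that] by (auto simp: S_def)
  have pt: "(pt c has_derivative (\<lambda>h. h *\<^sub>R coords (vel t) c)) (at t within ?J)"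
    using has_derivative_subset[OF pt_has_vector_derivative[OF c tc, unfolded has_vector_derivative_def]] J by blast
  have "((\<lambda>s. dd (transition c d) (pt c s) (X s)) has_derivative
      (\<lambda>h. D2 (pt c t) (h *\<^sub>R coords (vel t) c) (X t) + dd (transition c d) (pt c t) (h *\<^sub>R X'))) (at t within ?J)"
  proof (rule has_derivative_lin_apply[where D="\<lambda>b h. D2 (pt c t) (h *\<^sub>R coords (vel t) c) b", OF _ tJ])
    show "linear (dd (transition c d) (pt c s))" if "s \<in> ?J" for s by (rule linear_\<phi>'[OF ovl[OF that]])
    show "((\<lambda>s. dd (transition c d) (pt c s) b) has_derivative (\<lambda>h. D2 (pt c t) (h *\<^sub>R coords (vel t) c) b)) (at t within ?J)" for b
      using \<phi>_der2[OF ovl[OF tJ]] unfolding at_within_open[OF ovl[OF tJ] O(1)]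
      by (rule has_derivative_compose[OF pt])
    show "(X has_derivative (\<lambda>h. h *\<^sub>R X')) (at t within ?J)"
      using X at by (simp add: has_vector_derivative_def)
  qed
  moreover have "D2 (pt c t) (h *\<^sub>R coords (vel t) c) (X t) + dd (transition c d) (pt c t) (h *\<^sub>R X')
    = h *\<^sub>R (D2 (pt c t) (coords (vel t) c) (X t) + dd (transition c d) (pt c t) X')" for h
    using linear_cmul[OF has_derivative_bounded_linear[OF \<phi>_der2[OF ovl[OF tJ], of "X t"], THEN bounded_linear.linear]]
      linear_cmul[OF linear_\<phi>'[OF ovl[OF tJ]]]
    by (simp add: scaleR_add_right)
  ultimately have "((\<lambda>s. dd (transition c d) (pt c s) (X s)) has_vector_derivative
      (D2 (pt c t) (coords (vel t) c) (X t) + dd (transition c d) (pt c t) X')) (at t within J)"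
    using at by (simp add: has_vector_derivative_def del: o_apply)
  moreover have "dd (transition c d) (pt c t) (chr c (pt c t) (coords (vel t) c) (X t)) =
      chr d (pt d t) (coords (vel t) d) (dd (transition c d) (pt c t) (X t)) + D2 (pt c t) (coords (vel t) c) (X t)"
    using levi_civita_transform[OF ovl[OF tJ], of "coords (vel t) c" "X t"]
    unfolding trans_pt[OF tc c] tangent_spaceD[OF vel_tangent[OF t] cd, symmetric] .
  ultimately show ?thesis
    unfolding linear_add[OF linear_\<phi>'[OF ovl[OF tJ]]] by (simp add: add.commute del: o_apply)
qed

text \<open>A version of \<open>parallel_along\<close> for any set of times that asks only for
  derivatives, so that pieces can be glued. Smoothness is recovered afterwards by
  \<open>Ck_on_parallel\<close>.\<close>

definition parallel_on :: "real set \<Rightarrow> (real \<Rightarrow> ('m, 'e) tvec) \<Rightarrow> bool" where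
  "parallel_on J F \<longleftrightarrow> (\<forall>t\<in>J. F t \<in> tangent_space M (\<gamma> t) \<and> (\<forall>c\<in>charts_at M (\<gamma> t).
     ((\<lambda>s. coords (F s) c) has_vector_derivative - chr c (pt c t) (coords (vel t) c) (coords (F t) c)) (at t within J)))"

text \<open>Within one chart parallelism is a linear differential equation for the coordinate
  vector. That the solution is parallel in every other chart is the chart independence of the
  covariant derivative.\<close>

lemma parallel_on_local:
  assumes c: "c \<in> atlas M" and ab: "a \<le> b" "{a..b} \<subseteq> S c" and X: "X \<in> tangent_space M (\<gamma> a)"
  shows "\<exists>F. F a = X \<and> parallel_on {a..b} F"
proof -
  interpret local_metric "chart_img c" "metric_coeff M c" by (rule local_metric_chart[OF c])
  define A where "A t v = - \<Gamma> (pt c t) (coords (vel t) c) v" for t v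
  have "\<exists>y. y a = coords X c \<and> (\<forall>t\<in>{a..b}. (y has_vector_derivative A t (y t)) (at t within {a..b}))"
  proof (rule linear_ode_solution[OF ab(1)])
    show "linear (A t)" if "t \<in> {a..b}" for t
      unfolding A_def using linear_compose_neg[OF levi_civita_linear[OF pt_img]] that ab(2) by blast
    have "continuous_on (S c) (\<lambda>t. A t i)" for i
      unfolding A_def
      by (rule Ck_on_imp_continuous_on[of 0], intro Ck_on_minus derivative_set_S c Ck_on_levi_civita
            Ck_on_pt Ck_on_vel Ck_on_const pt_image)
    then show "continuous_on {a..b} (\<lambda>t. A t i)" for i
      using ab(2) continuous_on_subset by blast
  qed
  then obtain y where y: "y a = coords X c"
    "\<And>t. t \<in> {a..b} \<Longrightarrow> (y has_vector_derivative A t (y t)) (at t within {a..b})" by blast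
  define F where "F t = tangent_of_coords M c (\<gamma> t) (y t)" for t
  have cc: "c \<in> charts_at M (\<gamma> t)" if "t \<in> {a..b}" for t using in_charts_at[OF c] that ab(2) by blast
  have "F a = X" unfolding F_def y using tangent_of_coords_coords[OF X cc] ab(1) by simp
  moreover have "parallel_on {a..b} F"
    unfolding parallel_on_def
  proof (intro ballI conjI)
    fix t assume t: "t \<in> {a..b}"
    show "F t \<in> tangent_space M (\<gamma> t)" unfolding F_def by (rule tangent_of_coords_in[OF cc[OF t]])
    fix d assume d: "d \<in> charts_at M (\<gamma> t)"
    have tI: "t \<in> I" using t ab(2) S_I by blast
    have J: "{a..b} \<subseteq> I" using ab(2) S_I by blast
    have Ft: "coords (F s) d = dd (transition c d) (pt c s) (y s)" if "s \<in> {a..b}" "s \<in> S d" for s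
      unfolding F_def using in_charts_at[OF charts_atD(1)[OF d] that(2)] by (rule coords_tangent_of_coords)
    have 0: "A t (y t) + \<Gamma> (pt c t) (coords (vel t) c) (y t) = 0" by (simp add: A_def)
    have "((\<lambda>s. dd (transition c d) (pt c s) (y s)) has_vector_derivative
      - chr d (pt d t) (coords (vel t) d) (dd (transition c d) (pt c t) (y t))) (at t within {a..b})"
      using covariant_transform[OF cc[OF t] d t J y(2)[OF t]]
      unfolding 0 linear_0[OF linear_dd_trans[OF cc[OF t] d]] by (simp del: o_apply)
    then have *: "((\<lambda>s. dd (transition c d) (pt c s) (y s)) has_vector_derivative
      - chr d (pt d t) (coords (vel t) d) (coords (F t) d)) (at t within {a..b})"
      using Ft[OF t in_S[OF tI d]] by (simp del: o_apply)
    obtain N where N: "open N" "S d = I \<inter> N" using S_open[OF charts_atD(1)[OF d]] by blast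
    have tN: "t \<in> N" using in_S[OF tI d] N by blast
    have at: "at t within ({a..b} \<inter> N) = at t within {a..b}"
      by (rule at_within_nhd[OF tN N(1)]) auto
    have "((\<lambda>s. coords (F s) d) has_vector_derivative
      - chr d (pt d t) (coords (vel t) d) (coords (F t) d)) (at t within ({a..b} \<inter> N))"
      by (rule has_vector_derivative_transform[OF _ _ *[folded at]])
         (use t tN N J Ft in \<open>auto simp del: o_apply\<close>)
    then show "((\<lambda>s. coords (F s) d) has_vector_derivative
      - chr d (pt d t) (coords (vel t) d) (coords (F t) d)) (at t within {a..b})"
      unfolding at .
  qed
  ultimately show ?thesis by blast
qed

lemma parallel_on_glue:
  assumes ab: "a \<le> b" "b \<le> c" and F: "parallel_on {a..b} F" and G: "parallel_on {b..c} G" and FG: "F b = G b"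
  shows "parallel_on {a..c} (\<lambda>t. if t \<le> b then F t else G t)"
  unfolding parallel_on_def
proof (intro ballI conjI)
  let ?H = "\<lambda>t. if t \<le> b then F t else G t"
  fix t assume t: "t \<in> {a..c}"
  show "?H t \<in> tangent_space M (\<gamma> t)" using F G t by (auto simp: parallel_on_def)
  fix d assume d: "d \<in> charts_at M (\<gamma> t)"
  have "((\<lambda>s. if s \<le> b then coords (F s) d else coords (G s) d) has_vector_derivative
      - chr d (pt d t) (coords (vel t) d) (coords (?H t) d)) (at t within {a..c})"
  proof (rule has_vector_derivative_glue[OF ab _ _ _ t])
    show "((\<lambda>s. coords (F s) d) has_vector_derivative
      - chr d (pt d t) (coords (vel t) d) (coords (?H t) d)) (at t within {a..b})" if "t \<le> b"
      using F d t that by (simp add: parallel_on_def)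
    show "((\<lambda>s. coords (G s) d) has_vector_derivative
      - chr d (pt d t) (coords (vel t) d) (coords (?H t) d)) (at t within {b..c})" if "b \<le> t"
    proof -
      have "?H t = G t" using that FG by (cases "t = b") auto
      then show ?thesis using G d t that by (simp add: parallel_on_def)
    qed
  qed (simp add: FG)
  moreover have "(\<lambda>s. if s \<le> b then coords (F s) d else coords (G s) d) = (\<lambda>s. coords (?H s) d)" by auto
  ultimately show "((\<lambda>s. coords (?H s) d) has_vector_derivative
      - chr d (pt d t) (coords (vel t) d) (coords (?H t) d)) (at t within {a..c})" by simp
qed

text \<open>The curve may leave every single chart domain, so the local fields are joined by
  bisection: a short enough interval around any time lies in \<open>S c\<close> for one chart
  c.\<close>

lemma parallel_transport:
  assumes "X \<in> tangent_space M (\<gamma> 0)"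
  shows "\<exists>F. F 0 = X \<and> parallel_on I F"
proof -
  define P where "P a b \<longleftrightarrow> (0 \<le> a \<longrightarrow> a \<le> b \<longrightarrow> b \<le> l \<longrightarrow>
    (\<forall>X\<in>tangent_space M (\<gamma> a). \<exists>F. F a = X \<and> parallel_on {a..b} F))" for a b
  have "0 \<le> l" using l_pos by simp
  then have "P 0 l"
  proof (induction rule: Bolzano)
    case (trans a b c)
    show ?case unfolding P_def
    proof (intro impI ballI)
      fix X assume h: "0 \<le> a" "a \<le> c" "c \<le> l" "X \<in> tangent_space M (\<gamma> a)"
      have "\<exists>F. F a = X \<and> parallel_on {a..b} F" using trans h unfolding P_def by simp
      then obtain F where F: "F a = X" "parallel_on {a..b} F" by blast
      then have "F b \<in> tangent_space M (\<gamma> b)" using trans(3) by (simp add: parallel_on_def)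
      then have "\<exists>G. G b = F b \<and> parallel_on {b..c} G" using trans h unfolding P_def by simp
      then obtain G where G: "G b = F b" "parallel_on {b..c} G" by blast
      show "\<exists>F. F a = X \<and> parallel_on {a..c} F"
        using parallel_on_glue[OF trans(3,4) F(2) G(2) G(1)[symmetric]] F(1) trans(3)
        by (intro exI[of _ "\<lambda>t. if t \<le> b then F t else G t"]) simp
    qed
  next
    case (local x)
    then have "x \<in> I" by simp
    then obtain c where c: "c \<in> charts_at M (\<gamma> x)" using charts_at_exists by blast
    obtain N where N: "open N" "S c = I \<inter> N" using S_open[OF charts_atD(1)[OF c]] by blast
    have "x \<in> N" using in_S[OF \<open>x \<in> I\<close> c] N by blast
    then obtain e where e: "e > 0" "ball x e \<subseteq> N" using N(1) openE by blast
    have "P a b" if ab: "a \<le> x" "x \<le> b" "b - a < e" for a b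
      unfolding P_def
    proof (intro impI ballI)
      fix X assume h: "0 \<le> a" "a \<le> b" "b \<le> l" and X: "X \<in> tangent_space M (\<gamma> a)"
      have "{a..b} \<subseteq> ball x e" using ab by (auto simp: dist_real_def)
      then have "{a..b} \<subseteq> S c" using e h N by auto
      then show "\<exists>F. F a = X \<and> parallel_on {a..b} F"
        by (rule parallel_on_local[OF charts_atD(1)[OF c] h(2) _ X])
    qed
    then show ?case using e(1) by blast
  qed
  then show ?thesis using assms l_pos by (simp add: P_def)
qed

lemma parallel_onD:
  assumes "parallel_on I F" "t \<in> I" "c \<in> charts_at M (\<gamma> t)"
  shows "((\<lambda>s. coords (F s) c) has_vector_derivative - chr c (pt c t) (coords (vel t) c) (coords (F t) c)) (at t within I)"
  using assms unfolding parallel_on_def by blast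

lemma parallel_on_tangent: "parallel_on I F \<Longrightarrow> t \<in> I \<Longrightarrow> F t \<in> tangent_space M (\<gamma> t)"
  unfolding parallel_on_def by blast

lemma Ck_on_parallel:
  assumes F: "parallel_on I F" and c: "c \<in> atlas M"
  shows "Ck_on k (\<lambda>t. coords (F t) c) (S c)"
proof (rule linear_ode_Ck[OF derivative_set_S[OF c]])
  interpret local_metric "chart_img c" "metric_coeff M c" by (rule local_metric_chart[OF c])
  show "linear (\<lambda>v. - \<Gamma> (pt c t) (coords (vel t) c) v)" if "t \<in> S c" for t
    using linear_compose_neg[OF levi_civita_linear[OF pt_img[OF that]]] .
  show "Ck_on k (\<lambda>t. - \<Gamma> (pt c t) (coords (vel t) c) i) (S c)" for k i
    by (intro Ck_on_minus derivative_set_S c Ck_on_levi_civita Ck_on_pt Ck_on_vel Ck_on_const pt_image)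
  show "((\<lambda>t. coords (F t) c) has_vector_derivative - \<Gamma> (pt c t) (coords (vel t) c) (coords (F t) c)) (at t within S c)"
    if "t \<in> S c" for t
    using parallel_onD[OF F S_I[OF that] in_charts_at[OF c that]] at_within_S[OF c that] by simp
qed

lemma rmetric_has_derivative:
  assumes t: "t \<in> I" and c: "c \<in> charts_at M (\<gamma> t)"
    and XY: "\<And>s. s \<in> I \<Longrightarrow> X s \<in> tangent_space M (\<gamma> s)" "\<And>s. s \<in> I \<Longrightarrow> Y s \<in> tangent_space M (\<gamma> s)"
    and X: "((\<lambda>s. coords (X s) c) has_vector_derivative X') (at t within I)"
    and Y: "((\<lambda>s. coords (Y s) c) has_vector_derivative Y') (at t within I)"
  shows "((\<lambda>s. rmetric M (\<gamma> s) (X s) (Y s)) has_vector_derivative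
     metric_coeff M c (pt c t) (X' + chr c (pt c t) (coords (vel t) c) (coords (X t) c)) (coords (Y t) c)
   + metric_coeff M c (pt c t) (coords (X t) c) (Y' + chr c (pt c t) (coords (vel t) c) (coords (Y t) c)))
     (at t within I)"
proof -
  note ca = charts_atD(1)[OF c]
  interpret local_metric "chart_img c" "metric_coeff M c" by (rule local_metric_chart[OF ca])
  note tS = in_S[OF t c] and at = at_within_S[OF ca in_S[OF t c]]
  note img = pt_img[OF tS]
  have "((\<lambda>s. metric_coeff M c (pt c s) (coords (X s) c) (coords (Y s) c)) has_derivative
    (\<lambda>h. metric_coeff M c (pt c t) (h *\<^sub>R X' + \<Gamma> (pt c t) (h *\<^sub>R coords (vel t) c) (coords (X t) c)) (coords (Y t) c)
       + metric_coeff M c (pt c t) (coords (X t) c) (h *\<^sub>R Y' + \<Gamma> (pt c t) (h *\<^sub>R coords (vel t) c) (coords (Y t) c))))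
    (at t within S c)"
    using X Y pt_has_vector_derivative[OF ca tS] unfolding has_vector_derivative_def at[symmetric]
    by (intro g_product_rule tS pt_img) auto
  then have "((\<lambda>s. rmetric M (\<gamma> s) (X s) (Y s)) has_derivative
    (\<lambda>h. metric_coeff M c (pt c t) (h *\<^sub>R X' + \<Gamma> (pt c t) (h *\<^sub>R coords (vel t) c) (coords (X t) c)) (coords (Y t) c)
       + metric_coeff M c (pt c t) (coords (X t) c) (h *\<^sub>R Y' + \<Gamma> (pt c t) (h *\<^sub>R coords (vel t) c) (coords (Y t) c))))
    (at t within S c)"
    by (rule has_derivative_transform[OF tS, rotated])
       (rule rmetric_coords, auto intro: in_charts_at ca XY S_I)
  then show ?thesis
    unfolding has_vector_derivative_def at
    by (simp add: g_simps[OF img] \<Gamma>_simps[OF img] algebra_simps)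
qed

lemma parallel_inner_const:
  assumes F: "parallel_on I F" and G: "parallel_on I G" and t: "t \<in> I"
  shows "rmetric M (\<gamma> t) (F t) (G t) = rmetric M (\<gamma> 0) (F 0) (G 0)"
proof -
  have "((\<lambda>s. rmetric M (\<gamma> s) (F s) (G s)) has_vector_derivative 0) (at t within I)" if t: "t \<in> I" for t
  proof -
    obtain c where c: "c \<in> charts_at M (\<gamma> t)" using charts_at_exists[OF t] by blast
    interpret local_metric "chart_img c" "metric_coeff M c" by (rule local_metric'[OF c])
    show ?thesis
      using rmetric_has_derivative[OF t c parallel_on_tangent[OF F] parallel_on_tangent[OF G]
        parallel_onD[OF F t c] parallel_onD[OF G t c]]
      by (simp add: g_simps[OF pt_img[OF in_S[OF t c]]])
  qed
  then show ?thesis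
    by (rule constant_on_interval[where f="\<lambda>s. rmetric M (\<gamma> s) (F s) (G s)", OF _ t]) (use l_pos in simp_all)
qed

text \<open>\<open>vector_derivative\<close> has a value even where no derivative exists. From left
  to right differentiability is therefore taken from smoothness of the field; from right to left
  smoothness comes from the differential equation.\<close>

lemma parallel_on_iff: "parallel_along M l \<gamma> F \<longleftrightarrow> parallel_on I F"
proof
  assume F: "parallel_along M l \<gamma> F"
  show "parallel_on I F"
    unfolding parallel_on_def
  proof (intro ballI conjI)
    fix t assume t: "t \<in> I"
    show "F t \<in> tangent_space M (\<gamma> t)"
      using F t by (simp add: parallel_along_def vector_field_along_def)
    fix c assume c: "c \<in> charts_at M (\<gamma> t)"
    note ca = charts_atD(1)[OF c]
    have "Ck_on (Suc 0) (\<lambda>t. coords (F t) c) (S c)"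
      using F ca unfolding parallel_along_def vector_field_along_def smooth_on_def S_def by blast
    from Ck_on_Suc_has_derivative[OF this in_S[OF t c]]
    have "(\<lambda>t. coords (F t) c) differentiable at t within I"
      using at_within_S[OF ca in_S[OF t c]] by (auto simp: differentiable_def)
    moreover have "coords (cov_deriv M l \<gamma> F t) c = 0" using F t by (simp add: parallel_along_def)
    then have "vector_derivative (\<lambda>t. coords (F t) c) (at t within I) =
        - chr c (pt c t) (coords (vel t) c) (coords (F t) c)"
      using c by (simp add: cov_deriv_def christoffel_eq eq_neg_iff_add_eq_0)
    ultimately show "((\<lambda>s. coords (F s) c) has_vector_derivative
        - chr c (pt c t) (coords (vel t) c) (coords (F t) c)) (at t within I)"
      by (simp add: vector_derivative_works)
  qed
next
  assume F: "parallel_on I F"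
  have "cov_deriv M l \<gamma> F t = 0" if t: "t \<in> I" for t
  proof (rule tvec_eqI)
    fix c
    show "coords (cov_deriv M l \<gamma> F t) c = coords 0 c"
    proof (cases "c \<in> charts_at M (\<gamma> t)")
      case True
      from vector_derivative_within[OF not_bot[OF t] parallel_onD[OF F t True]] True show ?thesis
        by (simp add: cov_deriv_def christoffel_eq)
    qed (simp add: cov_deriv_def)
  qed
  then show "parallel_along M l \<gamma> F"
    using parallel_on_tangent[OF F] Ck_on_parallel[OF F]
    by (simp add: parallel_along_def vector_field_along_def smooth_on_def S_def)
qed

lemma vel_parallel: "parallel_on I vel"
proof -
  have "vector_field_along M l \<gamma> vel"
    using vel_tangent Ck_on_vel by (simp add: vector_field_along_def smooth_on_def S_def)
  then show ?thesis
    using normal_geodesic by (simp add: parallel_on_iff[symmetric] parallel_along_def normal_geodesic_def)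
qed

end

text \<open>A frame is encoded as linear isometries from \<open>'e\<close> with its standard inner
  product onto the tangent spaces. Fields along the curve become curves in \<open>'e\<close>, and
  norms and inner products there have their usual meaning.\<close>

definition parallel_frame ::
  "('m, 'e::euclidean_space) riem \<Rightarrow> real \<Rightarrow> (real \<Rightarrow> 'm) \<Rightarrow> (real \<Rightarrow> 'e \<Rightarrow> ('m, 'e) tvec) \<Rightarrow> bool" where
  "parallel_frame M l \<gamma> \<Phi> \<longleftrightarrow> (\<forall>t\<in>{0..l}. linear (\<Phi> t) \<and> range (\<Phi> t) = tangent_space M (\<gamma> t) \<and>
     (\<forall>x y. rmetric M (\<gamma> t) (\<Phi> t x) (\<Phi> t y) = x \<bullet> y)) \<and> (\<forall>x. parallel_along M l \<gamma> (\<lambda>t. \<Phi> t x))"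

lemma (in geodesic) parallel_on_combination:
  assumes "\<And>i. i \<in> K \<Longrightarrow> parallel_on I (F i)"
  shows "parallel_on I (\<lambda>t. \<Sum>i\<in>K. a i *\<^sub>R F i t)"
  unfolding parallel_on_def
proof (intro ballI conjI)
  fix t assume t: "t \<in> I"
  show "(\<Sum>i\<in>K. a i *\<^sub>R F i t) \<in> tangent_space M (\<gamma> t)"
    by (intro subspace_sum subspace_scale subspace_tangent_space parallel_on_tangent[OF assms t])
  fix c assume c: "c \<in> charts_at M (\<gamma> t)"
  interpret local_metric "chart_img c" "metric_coeff M c" by (rule local_metric'[OF c])
  note img = pt_img[OF in_S[OF t c]]
  have "((\<lambda>s. \<Sum>i\<in>K. a i *\<^sub>R coords (F i s) c) has_vector_derivative
     (\<Sum>i\<in>K. a i *\<^sub>R - \<Gamma> (pt c t) (coords (vel t) c) (coords (F i t) c))) (at t within I)"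
    by (intro has_vector_derivative_sum bounded_linear.has_vector_derivative[OF bounded_linear_scaleR_right]
        parallel_onD[OF assms t c])
  then show "((\<lambda>s. coords (\<Sum>i\<in>K. a i *\<^sub>R F i s) c) has_vector_derivative
      - \<Gamma> (pt c t) (coords (vel t) c) (coords (\<Sum>i\<in>K. a i *\<^sub>R F i t) c)) (at t within I)"
    by (simp add: linear_sum[OF levi_civita_linear[OF img]] \<Gamma>_simps[OF img] sum_negf)
qed

text \<open>Read in a chart, f is an endomorphism of \<open>'e\<close>; it is injective because f
  preserves lengths, hence onto, and a tangent vector is determined by its coordinates in one
  chart.\<close>

lemma (in riemannian) surj_of_isometry:
  fixes f :: "'e \<Rightarrow> ('m, 'e) tvec"
  assumes c: "c \<in> charts_at M p" and f: "linear f" "\<And>x. f x \<in> tangent_space M p"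
    and iso: "\<And>x. rmetric M p (f x) (f x) = x \<bullet> x"
  shows "range f = tangent_space M p"
proof
  show "range f \<subseteq> tangent_space M p" using f by blast
  interpret local_metric "chart_img c" "metric_coeff M c" using local_metric_chart c by (simp add: charts_at_def)
  have img: "chart_map c p \<in> chart_img c" using c by (simp add: charts_at_def chart_map_img)
  let ?h = "\<lambda>x. coords (f x) c"
  have lin: "linear ?h" by (rule linearI) (simp_all add: linear_add[OF f(1)] linear_cmul[OF f(1)])
  have "x = 0" if "?h x = 0" for x
    using iso[of x] rmetric_coords[OF c f(2) f(2), of x x] that by (simp add: g_simps[OF img])
  then have "inj ?h" using linear_injective_0[OF lin] by blast
  then have "surj ?h" by (rule linear_inj_imp_surj[OF lin])
  show "tangent_space M p \<subseteq> range f"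
  proof
    fix X assume X: "X \<in> tangent_space M p"
    obtain x where "coords X c = ?h x" using surjD[OF \<open>surj ?h\<close>, of "coords X c"] by blast
    then have "X = f x" by (rule tangent_space_eqI[OF X f(2) c])
    then show "X \<in> range f" by blast
  qed
qed

text \<open>An orthonormal basis at the initial point is transported; inner products of parallel
  fields are constant, so it stays orthonormal.\<close>

lemma (in geodesic) parallel_frame_exists: "\<exists>\<Phi>. parallel_frame M l \<gamma> \<Phi>"
proof -
  have 0: "0 \<in> I" using l_pos by simp
  obtain c where c: "c \<in> charts_at M (\<gamma> 0)" using charts_at_exists[OF 0] by blast
  interpret local_metric "chart_img c" "metric_coeff M c" by (rule local_metric'[OF c])
  obtain f :: "'e \<Rightarrow> 'e" where f: "linear f" "\<And>a b. metric_coeff M c (pt c 0) (f a) (f b) = a \<bullet> b"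
    using orthonormal_frame[OF pt_img[OF in_S[OF 0 c]]] by blast
  have "\<exists>F. F 0 = tangent_of_coords M c (\<gamma> 0) (f b) \<and> parallel_on I F" for b
    by (rule parallel_transport[OF tangent_of_coords_in[OF c]])
  then obtain E where E: "\<And>b. E b 0 = tangent_of_coords M c (\<gamma> 0) (f b)" "\<And>b. parallel_on I (E b)" by metis
  define \<Phi> where "\<Phi> t x = (\<Sum>b\<in>Basis. (x \<bullet> b) *\<^sub>R E b t)" for t x
  have par: "parallel_on I (\<lambda>t. \<Phi> t x)" for x
    unfolding \<Phi>_def by (rule parallel_on_combination[OF E(2)])
  have lin: "linear (\<Phi> t)" for t
    unfolding \<Phi>_def by (rule linearI) (simp_all add: inner_left_distrib scaleR_add_left sum.distrib scaleR_sum_right)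
  have F0: "\<Phi> 0 x = tangent_of_coords M c (\<gamma> 0) (f x)" for x
    unfolding \<Phi>_def E
    using linear_Basis_expand[OF linear_compose[OF f(1) tangent_of_coords_linear[OF c]], of x] by simp
  have iso: "rmetric M (\<gamma> t) (\<Phi> t x) (\<Phi> t y) = x \<bullet> y" if t: "t \<in> I" for t x y
    unfolding parallel_inner_const[OF par par t] F0
    using f(2) by (simp add: rmetric_coords[OF c] tangent_of_coords_in[OF c] coords_tangent_of_coords_self[OF c])
  have "range (\<Phi> t) = tangent_space M (\<gamma> t)" if t: "t \<in> I" for t
  proof -
    obtain c where c: "c \<in> charts_at M (\<gamma> t)" using charts_at_exists[OF t] by blast
    show ?thesis by (rule surj_of_isometry[OF c lin parallel_on_tangent[OF par t] iso[OF t]])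
  qed
  then show ?thesis using lin iso par unfolding parallel_frame_def parallel_on_iff by blast
qed

lemma smooth_on_interval_derivative:
  fixes v :: "real \<Rightarrow> 'a::real_normed_vector"
  assumes ab: "a < b" and v: "smooth_on v {a..b}"
  obtains v' where "smooth_on v' {a..b}" "\<And>t. t \<in> {a..b} \<Longrightarrow> (v has_vector_derivative v' t) (at t within {a..b})"
proof -
  let ?v' = "\<lambda>t. frechet_derivative v (at t within {a..b}) 1"
  have "(v has_vector_derivative ?v' t) (at t within {a..b})" if "t \<in> {a..b}" for t
  proof -
    note d = Ck_on_Suc_has_derivative[OF smooth_onD[OF v] that]
    have "frechet_derivative v (at t within {a..b}) h = h *\<^sub>R ?v' t" for h
      using linear_cmul[OF bounded_linear.linear[OF has_derivative_bounded_linear[OF d]], of h 1] by simp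
    then show ?thesis using d unfolding has_vector_derivative_def by (metis (no_types, lifting) ext)
  qed
  moreover have "smooth_on ?v' {a..b}"
    using smooth_onD[OF v, of "Suc _"] by (simp add: smooth_on_def)
  ultimately show thesis by (rule that[rotated])
qed

lemma cov_deriv_cong:
  assumes "\<And>s. s \<in> {0..u} \<Longrightarrow> X s = Y s" "t \<in> {0..u}"
  shows "cov_deriv M u \<gamma> X t = cov_deriv M u \<gamma> Y t"
proof -
  have "vector_derivative (\<lambda>s. coords (X s) c) (at t within {0..u})
      = vector_derivative (\<lambda>s. coords (Y s) c) (at t within {0..u})" for c
    by (rule vector_derivative_cong_eq) (use assms in auto)
  then show ?thesis by (simp add: cov_deriv_def assms(1)[OF assms(2)] cong: if_cong)
qed

section \<open>Restriction of fields to shorter intervals\<close>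

context geodesic
begin

lemma Ck_on_field:
  "vector_field_along M l \<gamma> X \<Longrightarrow> c \<in> atlas M \<Longrightarrow> Ck_on k (\<lambda>t. coords (X t) c) (S c)"
  unfolding vector_field_along_def S_def smooth_on_def by blast

lemma field_tangent: "vector_field_along M l \<gamma> X \<Longrightarrow> t \<in> I \<Longrightarrow> X t \<in> tangent_space M (\<gamma> t)"
  unfolding vector_field_along_def by blast

lemma field_differentiable:
  assumes "vector_field_along M l \<gamma> X" "t \<in> I" "c \<in> charts_at M (\<gamma> t)"
  shows "((\<lambda>t. coords (X t) c) has_vector_derivative vector_derivative (\<lambda>t. coords (X t) c) (at t within I)) (at t within I)"
  using Ck_on_Suc_has_derivative[OF Ck_on_field[OF assms(1) charts_atD(1)[OF assms(3)]] in_S[OF assms(2,3)]]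
    at_within_S[OF charts_atD(1)[OF assms(3)] in_S[OF assms(2,3)]]
  by (auto simp: vector_derivative_works[symmetric] differentiable_def)

context
  fixes u assumes u: "0 < u" "u \<le> l"
begin

lemma not_bot': "t \<in> {0..u} \<Longrightarrow> at t within {0..u} \<noteq> bot"
  using u by (simp add: trivial_limit_within islimpt_Icc)

lemma subinterval: "t \<in> {0..u} \<Longrightarrow> t \<in> I" "{0..u} \<subseteq> I"
  using u by auto

lemma velocity_restrict:
  assumes t: "t \<in> {0..u}" shows "velocity M u \<gamma> t = vel t"
proof (rule tvec_eqI)
  fix c show "coords (velocity M u \<gamma> t) c = coords (vel t) c"
  proof (cases "c \<in> charts_at M (\<gamma> t)")
    case True
    have "(pt c has_vector_derivative coords (vel t) c) (at t within {0..u})"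
      using has_vector_derivative_within_subset[OF pt_has_vector_derivative[OF charts_atD(1)[OF True] in_S[OF subinterval(1)[OF t] True]] subinterval(2)] .
    from vector_derivative_within[OF not_bot'[OF t] this] True show ?thesis
      by (simp add: velocity_def[of M u] comp_def)
  qed (simp add: velocity_def)
qed

text \<open>Focal points and the rigidity statement live on shorter intervals, where derivatives at
  the new right end become one-sided. For a smooth field on the larger interval this changes
  nothing.\<close>

lemma cov_deriv_restrict:
  assumes X: "vector_field_along M l \<gamma> X" and t: "t \<in> {0..u}"
  shows "cov_deriv M u \<gamma> X t = cov_deriv M l \<gamma> X t"
proof (rule tvec_eqI)
  fix c show "coords (cov_deriv M u \<gamma> X t) c = coords (cov_deriv M l \<gamma> X t) c"
  proof (cases "c \<in> charts_at M (\<gamma> t)")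
    case True
    have "vector_derivative (\<lambda>t. coords (X t) c) (at t within {0..u}) = vector_derivative (\<lambda>t. coords (X t) c) (at t within I)"
      by (rule vector_derivative_within[OF not_bot'[OF t] has_vector_derivative_within_subset[OF
            field_differentiable[OF X subinterval(1)[OF t] True] subinterval(2)]])
    then show ?thesis using True velocity_restrict[OF t] by (simp add: cov_deriv_def)
  qed (simp add: cov_deriv_def)
qed

lemma derivative_set_restrict:
  assumes c: "c \<in> atlas M" shows "derivative_set {t \<in> {0..u}. \<gamma> t \<in> chart_dom c}"
proof -
  obtain N where N: "open N" "S c = I \<inter> N" using S_open[OF c] by blast
  have "\<gamma> t \<in> chart_dom c \<longleftrightarrow> t \<in> N" if "t \<in> {0..u}" for t
    using subinterval(1)[OF that] N(2) unfolding S_def by blast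
  then have "{t \<in> {0..u}. \<gamma> t \<in> chart_dom c} = {0..u} \<inter> N" by blast
  then show ?thesis using derivative_set_Int_open[OF derivative_set_interval[OF u(1)] N(1)] by (simp only:)
qed

lemma vector_field_restrict:
  assumes X: "vector_field_along M l \<gamma> X" shows "vector_field_along M u \<gamma> X"
  unfolding vector_field_along_def
proof (intro conjI ballI)
  show "X t \<in> tangent_space M (\<gamma> t)" if "t \<in> {0..u}" for t
    using field_tangent[OF X subinterval(1)[OF that]] .
  fix c assume c: "c \<in> atlas M"
  let ?T = "{t \<in> {0..u}. \<gamma> t \<in> chart_dom c}"
  note dT = derivative_set_restrict[OF c]
  have "?T \<subseteq> S c" using subinterval(2) unfolding S_def by blast
  then show "smooth_on (\<lambda>t. coords (X t) c) ?T"
    unfolding smooth_on_def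
    by (intro allI Ck_on_subset[OF derivative_set_S[OF c] dT _ Ck_on_field[OF X c]])
qed

end

end

section \<open>Coordinates with respect to a parallel orthonormal frame\<close>

locale framed_geodesic = geodesic M l \<gamma> for M :: "('m, 'e::euclidean_space) riem" and l \<gamma> +
  fixes \<Phi> :: "real \<Rightarrow> 'e \<Rightarrow> ('m, 'e) tvec"
  assumes frame: "parallel_frame M l \<gamma> \<Phi>"
begin

lemma \<Phi>_linear: "t \<in> I \<Longrightarrow> linear (\<Phi> t)"
  and \<Phi>_range: "t \<in> I \<Longrightarrow> range (\<Phi> t) = tangent_space M (\<gamma> t)"
  and \<Phi>_inner: "t \<in> I \<Longrightarrow> rmetric M (\<gamma> t) (\<Phi> t x) (\<Phi> t y) = x \<bullet> y"
  and \<Phi>_parallel: "parallel_on I (\<lambda>t. \<Phi> t x)"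
  using frame unfolding parallel_frame_def parallel_on_iff by blast+

lemma \<Phi>_tangent: "t \<in> I \<Longrightarrow> \<Phi> t x \<in> tangent_space M (\<gamma> t)"
  using \<Phi>_range by blast

definition frame_coords :: "real \<Rightarrow> ('m, 'e) tvec \<Rightarrow> 'e" where
  "frame_coords t X = (\<Sum>b\<in>Basis. rmetric M (\<gamma> t) X (\<Phi> t b) *\<^sub>R b)"

lemma frame_coords_\<Phi>: "t \<in> I \<Longrightarrow> frame_coords t (\<Phi> t x) = x"
  by (simp add: frame_coords_def \<Phi>_inner euclidean_representation)

lemma \<Phi>_frame_coords: assumes "t \<in> I" "X \<in> tangent_space M (\<gamma> t)" shows "\<Phi> t (frame_coords t X) = X"
proof -
  obtain x where "X = \<Phi> t x" using assms \<Phi>_range by blast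
  then show ?thesis using frame_coords_\<Phi>[OF assms(1)] by simp
qed

lemma \<Phi>_inj: "t \<in> I \<Longrightarrow> \<Phi> t x = \<Phi> t y \<longleftrightarrow> x = y"
  by (metis frame_coords_\<Phi>)

text \<open>The velocity of a geodesic is parallel, so its coordinates at time 0 represent it at all
  times. Tangential and perpendicular parts thus refer to one fixed unit vector.\<close>

definition e0 :: 'e where "e0 = frame_coords 0 (vel 0)"

lemma \<Phi>_e0: assumes t: "t \<in> I" shows "\<Phi> t e0 = vel t"
proof -
  have "frame_coords t (vel t) = e0"
    unfolding frame_coords_def e0_def
    by (intro sum.cong refl arg_cong2[where f="(*\<^sub>R)"] parallel_inner_const[OF vel_parallel \<Phi>_parallel t])
  then show ?thesis using \<Phi>_frame_coords[OF t vel_tangent[OF t]] by simp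
qed

lemma e0_unit: "e0 \<bullet> e0 = 1"
proof -
  have 0: "0 \<in> I" using l_pos by simp
  have "rnorm M (\<gamma> 0) (vel 0) = 1" using normal_geodesic 0 by (simp add: normal_geodesic_def)
  then show ?thesis using \<Phi>_inner[OF 0, of e0 e0] \<Phi>_e0[OF 0] by (simp add: rnorm_def)
qed

lemma rnorm_\<Phi>: "t \<in> I \<Longrightarrow> rnorm M (\<gamma> t) (\<Phi> t x) = norm x"
  by (simp add: rnorm_def \<Phi>_inner norm_eq_sqrt_inner)

lemma perp_part_\<Phi>:
  assumes t: "t \<in> I" and V: "V t = \<Phi> t x"
  shows "perp_part M l \<gamma> V t = \<Phi> t (x - (x \<bullet> e0) *\<^sub>R e0)"
  unfolding perp_part_def V \<Phi>_e0[OF t, symmetric] \<Phi>_inner[OF t]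
  using \<Phi>_linear[OF t] by (simp add: linear_diff linear_cmul)

lemma initial_perp_\<Phi>: "initial_perp M l \<gamma> = \<Phi> 0 ` {x. x \<bullet> e0 = 0}"
proof -
  have 0: "0 \<in> I" using l_pos by simp
  show ?thesis
    unfolding initial_perp_def \<Phi>_e0[OF 0, symmetric] \<Phi>_range[OF 0, symmetric]
    using \<Phi>_inner[OF 0] by auto
qed

lemma smooth_inner:
  assumes X: "vector_field_along M l \<gamma> X" and Y: "vector_field_along M l \<gamma> Y"
  shows "smooth_on (\<lambda>t. rmetric M (\<gamma> t) (X t) (Y t)) I"
  unfolding smooth_on_def
proof
  fix k show "Ck_on k (\<lambda>t. rmetric M (\<gamma> t) (X t) (Y t)) I"
  proof (rule Ck_on_local[OF derivative_set_I])
    fix t assume t: "t \<in> I"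
    obtain c where c: "c \<in> charts_at M (\<gamma> t)" using charts_at_exists[OF t] by blast
    note ca = charts_atD(1)[OF c]
    interpret local_metric "chart_img c" "metric_coeff M c" by (rule local_metric_chart[OF ca])
    obtain N where N: "open N" "S c = I \<inter> N" using S_open[OF ca] by blast
    have "Ck_on k (\<lambda>t. metric_coeff M c (pt c t) (coords (X t) c) (coords (Y t) c)) (S c)"
      by (intro Ck_on_g derivative_set_S ca Ck_on_pt pt_image Ck_on_field X Y)
    then have "Ck_on k (\<lambda>t. rmetric M (\<gamma> t) (X t) (Y t)) (S c)"
      by (rule Ck_on_cong_imp[OF derivative_set_S[OF ca], rotated])
         (rule rmetric_coords[symmetric, OF in_charts_at[OF ca] field_tangent[OF X S_I] field_tangent[OF Y S_I]])
    then show "\<exists>N. open N \<and> t \<in> N \<and> Ck_on k (\<lambda>t. rmetric M (\<gamma> t) (X t) (Y t)) (I \<inter> N)"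
      using N in_S[OF t c] by auto
  qed
qed

lemma \<Phi>_field: "vector_field_along M l \<gamma> (\<lambda>t. \<Phi> t x)"
  using \<Phi>_parallel[of x] unfolding parallel_on_iff[symmetric] parallel_along_def by blast

lemma smooth_frame_coords:
  assumes X: "vector_field_along M l \<gamma> X" shows "smooth_on (\<lambda>t. frame_coords t (X t)) I"
  unfolding smooth_on_def frame_coords_def
  by (intro allI Ck_on_sum Ck_on_scaleR Ck_on_const derivative_set_I smooth_onD[OF smooth_inner] X \<Phi>_field)

lemma coords_\<Phi>_sum: "t \<in> I \<Longrightarrow> coords (\<Phi> t x) c = (\<Sum>b\<in>Basis. (x \<bullet> b) *\<^sub>R coords (\<Phi> t b) c)"
  using arg_cong[OF linear_Basis_expand[OF \<Phi>_linear, of t x], of "\<lambda>X. coords X c"] by simp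

lemma field_\<Phi>:
  assumes v: "smooth_on v I" shows "vector_field_along M l \<gamma> (\<lambda>t. \<Phi> t (v t))"
  unfolding vector_field_along_def
proof (intro conjI ballI)
  show "\<Phi> t (v t) \<in> tangent_space M (\<gamma> t)" if "t \<in> I" for t using \<Phi>_tangent[OF that] .
  fix c assume c: "c \<in> atlas M"
  have "Ck_on k (\<lambda>t. coords (\<Phi> t (v t)) c) (S c)" for k
  proof -
    have "Ck_on k v (S c)"
      by (rule Ck_on_subset[OF derivative_set_I derivative_set_S[OF c] _ smooth_onD[OF v]]) (auto dest: S_I)
    then have "Ck_on k (\<lambda>t. \<Sum>b\<in>Basis. (v t \<bullet> b) *\<^sub>R coords (\<Phi> t b) c) (S c)"
      by (intro Ck_on_sum Ck_on_scaleR Ck_on_inner Ck_on_const derivative_set_S c Ck_on_field \<Phi>_field)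
    then show ?thesis
      by (rule Ck_on_cong_imp[OF derivative_set_S[OF c], rotated]) (rule coords_\<Phi>_sum[symmetric], rule S_I)
  qed
  then show "smooth_on (\<lambda>t. coords (\<Phi> t (v t)) c) {t \<in> I. \<gamma> t \<in> chart_dom c}"
    by (simp add: S_def smooth_on_def)
qed

text \<open>The derivatives of the frame vectors cancel the Christoffel term because the frame is
  parallel; only the ordinary derivative of the coordinate vector is left.\<close>

lemma cov_deriv_\<Phi>:
  assumes t: "t \<in> I" and v: "(v has_vector_derivative v') (at t within I)"
    and V: "\<And>s. s \<in> I \<Longrightarrow> V s = \<Phi> s (v s)"
  shows "cov_deriv M l \<gamma> V t = \<Phi> t v'"
proof (rule tvec_eqI)
  fix c show "coords (cov_deriv M l \<gamma> V t) c = coords (\<Phi> t v') c"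
  proof (cases "c \<in> charts_at M (\<gamma> t)")
    case False
    then show ?thesis using tangent_space_coords_0[OF \<Phi>_tangent[OF t]] by (simp add: cov_deriv_def)
  next
    case True
    interpret local_metric "chart_img c" "metric_coeff M c" by (rule local_metric'[OF True])
    note img = pt_img[OF in_S[OF t True]]
    have vb: "((\<lambda>s. v s \<bullet> b) has_vector_derivative v' \<bullet> b) (at t within I)" for b
      by (rule bounded_linear.has_vector_derivative[OF bounded_linear_inner_left v])
    have "((\<lambda>s. \<Sum>b\<in>Basis. (v s \<bullet> b) *\<^sub>R coords (\<Phi> s b) c) has_vector_derivative
       (\<Sum>b\<in>Basis. (v t \<bullet> b) *\<^sub>R - \<Gamma> (pt c t) (coords (vel t) c) (coords (\<Phi> t b) c)
          + (v' \<bullet> b) *\<^sub>R coords (\<Phi> t b) c)) (at t within I)"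
      by (intro has_vector_derivative_sum bounded_bilinear.has_vector_derivative[OF bounded_bilinear_scaleR] vb
          parallel_onD[OF \<Phi>_parallel t True])
    moreover have "(\<Sum>b\<in>Basis. (v t \<bullet> b) *\<^sub>R - \<Gamma> (pt c t) (coords (vel t) c) (coords (\<Phi> t b) c)
          + (v' \<bullet> b) *\<^sub>R coords (\<Phi> t b) c)
        = - \<Gamma> (pt c t) (coords (vel t) c) (coords (\<Phi> t (v t)) c) + coords (\<Phi> t v') c"
      unfolding coords_\<Phi>_sum[OF t, of "v t"] coords_\<Phi>_sum[OF t, of v']
      by (simp add: linear_sum[OF levi_civita_linear[OF img]] \<Gamma>_simps[OF img] sum.distrib sum_negf sum_subtractf)
    ultimately have "((\<lambda>s. \<Sum>b\<in>Basis. (v s \<bullet> b) *\<^sub>R coords (\<Phi> s b) c) has_vector_derivative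
        - \<Gamma> (pt c t) (coords (vel t) c) (coords (\<Phi> t (v t)) c) + coords (\<Phi> t v') c) (at t within I)"
      by (simp only:)
    moreover have "coords (V s) c = (\<Sum>b\<in>Basis. (v s \<bullet> b) *\<^sub>R coords (\<Phi> s b) c)" if "s \<in> I" for s
      unfolding V[OF that] by (rule coords_\<Phi>_sum[OF that])
    ultimately have "((\<lambda>s. coords (V s) c) has_vector_derivative
        - \<Gamma> (pt c t) (coords (vel t) c) (coords (\<Phi> t (v t)) c) + coords (\<Phi> t v') c) (at t within I)"
      by (rule has_vector_derivative_transform[OF t, rotated])
    from vector_derivative_within[OF not_bot[OF t] this]
    show ?thesis using True V[OF t] by (simp add: cov_deriv_def christoffel_eq)
  qed
qed

text \<open>The Jacobi operator along the geodesic, in frame coordinates; the Jacobi equation reads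
  v'' = - \<open>Rop t (v t)\<close>.\<close>

definition Rop :: "real \<Rightarrow> 'e \<Rightarrow> 'e" where
  "Rop t x = frame_coords t (curvature M (\<gamma> t) (\<Phi> t x) (vel t) (vel t))"

lemma \<Phi>_Rop: "t \<in> I \<Longrightarrow> \<Phi> t (Rop t x) = curvature M (\<gamma> t) (\<Phi> t x) (vel t) (vel t)"
  unfolding Rop_def by (intro \<Phi>_frame_coords curvature_in_tangent_space \<Phi>_tangent vel_tangent)

lemma Rop_inner:
  assumes t: "t \<in> I" and c: "c \<in> charts_at M (\<gamma> t)"
  shows "Rop t x \<bullet> y = metric_coeff M c (pt c t)
     (riemann (metric_coeff M c) (pt c t) (coords (\<Phi> t x) c) (coords (vel t) c) (coords (vel t) c)) (coords (\<Phi> t y) c)"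
proof -
  have "Rop t x \<bullet> y = rmetric M (\<gamma> t) (curvature M (\<gamma> t) (\<Phi> t x) (vel t) (vel t)) (\<Phi> t y)"
    by (simp add: \<Phi>_inner[OF t, symmetric] \<Phi>_Rop[OF t])
  also have "\<dots> = metric_coeff M c (pt c t)
     (coords (curvature M (\<gamma> t) (\<Phi> t x) (vel t) (vel t)) c) (coords (\<Phi> t y) c)"
    by (intro rmetric_coords c curvature_in_tangent_space \<Phi>_tangent vel_tangent t)
  finally show ?thesis using c by (simp add: curvature_def curvature_coeff_eq)
qed

lemma Rop_linear: assumes t: "t \<in> I" shows "linear (Rop t)"
proof -
  obtain c where c: "c \<in> charts_at M (\<gamma> t)" using charts_at_exists[OF t] by blast
  interpret local_metric "chart_img c" "metric_coeff M c" by (rule local_metric'[OF c])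
  note img = pt_img[OF in_S[OF t c]]
  show ?thesis
    by (rule linearI; rule euclidean_eqI)
       (simp_all add: inner_left_distrib Rop_inner[OF t c] linear_add[OF \<Phi>_linear[OF t]] linear_cmul[OF \<Phi>_linear[OF t]]
         linear_add[OF riemann_linear[OF img]] linear_cmul[OF riemann_linear[OF img]] g_simps[OF img])
qed

lemma Rop_sym: assumes t: "t \<in> I" shows "Rop t x \<bullet> y = x \<bullet> Rop t y"
proof -
  obtain c where c: "c \<in> charts_at M (\<gamma> t)" using charts_at_exists[OF t] by blast
  interpret local_metric "chart_img c" "metric_coeff M c" by (rule local_metric'[OF c])
  show ?thesis
    using jacobi_operator_sym[OF pt_img[OF in_S[OF t c]]] Rop_inner[OF t c] by (simp add: inner_commute[of x])
qed

lemma Rop_e0: assumes t: "t \<in> I" shows "Rop t e0 = 0"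
proof -
  have "curvature M (\<gamma> t) (vel t) (vel t) (vel t) = 0"
    by (rule tvec_eqI) (simp add: curvature_def curvature_coeff_def)
  then have "\<Phi> t (Rop t e0) = \<Phi> t 0" using \<Phi>_Rop[OF t] \<Phi>_e0[OF t] linear_0[OF \<Phi>_linear[OF t]] by simp
  then show ?thesis using \<Phi>_inj[OF t] by blast
qed

lemma smooth_Rop: "smooth_on (\<lambda>t. Rop t x) I"
proof -
  have 1: "smooth_on (\<lambda>t. Rop t x \<bullet> b) I" for b
    unfolding smooth_on_def
  proof
    fix k show "Ck_on k (\<lambda>t. Rop t x \<bullet> b) I"
    proof (rule Ck_on_local[OF derivative_set_I])
      fix t assume t: "t \<in> I"
      obtain c where c: "c \<in> charts_at M (\<gamma> t)" using charts_at_exists[OF t] by blast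
      note ca = charts_atD(1)[OF c]
      interpret local_metric "chart_img c" "metric_coeff M c" by (rule local_metric_chart[OF ca])
      obtain N where N: "open N" "S c = I \<inter> N" using S_open[OF ca] by blast
      have "Ck_on k (\<lambda>t. metric_coeff M c (pt c t)
          (R (pt c t) (coords (\<Phi> t x) c) (coords (vel t) c) (coords (vel t) c)) (coords (\<Phi> t b) c)) (S c)"
        by (intro Ck_on_g Ck_on_riemann derivative_set_S ca Ck_on_pt pt_image Ck_on_field \<Phi>_field Ck_on_vel)
      then have "Ck_on k (\<lambda>t. Rop t x \<bullet> b) (S c)"
        by (rule Ck_on_cong_imp[OF derivative_set_S[OF ca], rotated])
           (rule Rop_inner[symmetric, OF S_I in_charts_at[OF ca]])
      then show "\<exists>N. open N \<and> t \<in> N \<and> Ck_on k (\<lambda>t. Rop t x \<bullet> b) (I \<inter> N)"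
        using N in_S[OF t c] by auto
    qed
  qed
  have "Ck_on k (\<lambda>t. \<Sum>b\<in>Basis. (Rop t x \<bullet> b) *\<^sub>R b) I" for k
    by (intro Ck_on_sum Ck_on_scaleR Ck_on_const derivative_set_I smooth_onD[OF 1])
  then show ?thesis by (simp add: smooth_on_def euclidean_representation)
qed

text \<open>The definition pairs R(T, X)X with the velocity T. Skewness and antisymmetry turn this
  into R(X, T)T paired with X; the denominator uses that e0 is a unit vector.\<close>

lemma sectional_curvature_\<Phi>:
  assumes t: "t \<in> I"
  shows "sectional_curvature M (\<gamma> t) (vel t) (\<Phi> t x) = (Rop t x \<bullet> x) / (x \<bullet> x - (x \<bullet> e0)\<^sup>2)"
proof -
  obtain c where c: "c \<in> charts_at M (\<gamma> t)" using charts_at_exists[OF t] by blast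
  interpret local_metric "chart_img c" "metric_coeff M c" by (rule local_metric'[OF c])
  note img = pt_img[OF in_S[OF t c]]
  let ?T = "coords (vel t) c" and ?X = "coords (\<Phi> t x) c"
  have "rmetric M (\<gamma> t) (curvature M (\<gamma> t) (vel t) (\<Phi> t x) (\<Phi> t x)) (vel t)
      = metric_coeff M c (pt c t) (coords (curvature M (\<gamma> t) (vel t) (\<Phi> t x) (\<Phi> t x)) c) ?T"
    by (intro rmetric_coords c curvature_in_tangent_space \<Phi>_tangent vel_tangent t)
  also have "\<dots> = metric_coeff M c (pt c t) (R (pt c t) ?T ?X ?X) ?T"
    using c by (simp add: curvature_def curvature_coeff_eq)
  also have "\<dots> = - metric_coeff M c (pt c t) ?X (R (pt c t) ?T ?X ?T)"
    by (rule riemann_skew[OF img])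
  also have "\<dots> = metric_coeff M c (pt c t) ?X (R (pt c t) ?X ?T ?T)"
    unfolding riemann_antisym[of "pt c t" ?T ?X] by (simp add: g_simps[OF img])
  also have "\<dots> = Rop t x \<bullet> x"
    unfolding Rop_inner[OF t c] by (rule g_sym[OF img])
  finally show ?thesis
    using \<Phi>_inner[OF t, of e0 e0] \<Phi>_inner[OF t, of e0 x] \<Phi>_inner[OF t, of x x]
    unfolding \<Phi>_e0[OF t] e0_unit by (simp add: sectional_curvature_def inner_commute[of e0])
qed

lemma jacobi_fieldE:
  assumes "jacobi_field M l \<gamma> V"
  obtains v v' where "\<And>t. t \<in> I \<Longrightarrow> V t = \<Phi> t (v t)"
    "\<And>t. t \<in> I \<Longrightarrow> cov_deriv M l \<gamma> V t = \<Phi> t (v' t)"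
    "\<And>t. t \<in> I \<Longrightarrow> (v has_vector_derivative v' t) (at t within I)"
    "\<And>t. t \<in> I \<Longrightarrow> (v' has_vector_derivative - Rop t (v t)) (at t within I)"
proof -
  have V: "vector_field_along M l \<gamma> V" using assms by (simp add: jacobi_field_def)
  define v where "v t = frame_coords t (V t)" for t
  have Vv: "V t = \<Phi> t (v t)" if "t \<in> I" for t
    unfolding v_def using \<Phi>_frame_coords[OF that field_tangent[OF V that]] by simp
  have "smooth_on v I" unfolding v_def by (rule smooth_frame_coords[OF V])
  then obtain v' where v': "smooth_on v' I" "\<And>t. t \<in> I \<Longrightarrow> (v has_vector_derivative v' t) (at t within I)"
    using smooth_on_interval_derivative[OF l_pos] by blast
  obtain v'' where v'': "smooth_on v'' I" "\<And>t. t \<in> I \<Longrightarrow> (v' has_vector_derivative v'' t) (at t within I)"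
    using smooth_on_interval_derivative[OF l_pos v'(1)] by blast
  have c1: "cov_deriv M l \<gamma> V t = \<Phi> t (v' t)" if "t \<in> I" for t
    by (rule cov_deriv_\<Phi>[OF that v'(2)[OF that] Vv])
  have "v'' t = - Rop t (v t)" if t: "t \<in> I" for t
  proof -
    have "cov_deriv M l \<gamma> (cov_deriv M l \<gamma> V) t = \<Phi> t (v'' t)"
      by (rule cov_deriv_\<Phi>[OF t v''(2)[OF t] c1])
    moreover have "cov_deriv M l \<gamma> (cov_deriv M l \<gamma> V) t + curvature M (\<gamma> t) (V t) (vel t) (vel t) = 0"
      using assms t unfolding jacobi_field_def by blast
    ultimately have "\<Phi> t (v'' t) + \<Phi> t (Rop t (v t)) = 0"
      unfolding Vv[OF t] \<Phi>_Rop[OF t] by simp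
    then have "\<Phi> t (v'' t + Rop t (v t)) = \<Phi> t 0"
      using \<Phi>_linear[OF t] by (simp add: linear_add linear_0)
    then show ?thesis using \<Phi>_inj[OF t] by (simp add: eq_neg_iff_add_eq_0)
  qed
  then show thesis using that[OF Vv c1 v'(2)] v''(2) by simp
qed

text \<open>The converse of \<open>jacobi_fieldE\<close>, on an initial piece of the interval
  because a focal point at u is witnessed by a Jacobi field on \<open>{0..u}\<close>.\<close>

lemma jacobi_field_\<Phi>:
  assumes u: "0 < u" "u \<le> l" and y: "smooth_on y I"
    and y': "\<And>t. t \<in> I \<Longrightarrow> (y has_vector_derivative y' t) (at t within I)" "smooth_on y' I"
    and y'': "\<And>t. t \<in> I \<Longrightarrow> (y' has_vector_derivative - Rop t (y t)) (at t within I)"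
  shows "jacobi_field M u \<gamma> (\<lambda>t. \<Phi> t (y t))" "cov_deriv M u \<gamma> (\<lambda>t. \<Phi> t (y t)) 0 = \<Phi> 0 (y' 0)"
proof -
  have c1: "cov_deriv M u \<gamma> (\<lambda>t. \<Phi> t (y t)) t = \<Phi> t (y' t)" if t: "t \<in> {0..u}" for t
    unfolding cov_deriv_restrict[OF u field_\<Phi>[OF y] t]
    using subinterval(1)[OF u t] by (intro cov_deriv_\<Phi>[OF _ y'(1)] refl)
  then show "cov_deriv M u \<gamma> (\<lambda>t. \<Phi> t (y t)) 0 = \<Phi> 0 (y' 0)" using u by simp
  have c2: "cov_deriv M u \<gamma> (cov_deriv M u \<gamma> (\<lambda>t. \<Phi> t (y t))) t = \<Phi> t (- Rop t (y t))" if t: "t \<in> {0..u}" for t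
  proof -
    have "cov_deriv M u \<gamma> (cov_deriv M u \<gamma> (\<lambda>t. \<Phi> t (y t))) t = cov_deriv M u \<gamma> (\<lambda>t. \<Phi> t (y' t)) t"
      by (rule cov_deriv_cong[OF c1 t])
    also have "\<dots> = cov_deriv M l \<gamma> (\<lambda>t. \<Phi> t (y' t)) t"
      by (rule cov_deriv_restrict[OF u field_\<Phi>[OF y'(2)] t])
    also have "\<dots> = \<Phi> t (- Rop t (y t))"
      using subinterval(1)[OF u t] by (intro cov_deriv_\<Phi>[OF _ y''] refl)
    finally show ?thesis .
  qed
  show "jacobi_field M u \<gamma> (\<lambda>t. \<Phi> t (y t))"
    unfolding jacobi_field_def
  proof (intro conjI ballI)
    show "vector_field_along M u \<gamma> (\<lambda>t. \<Phi> t (y t))"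
      by (rule vector_field_restrict[OF u field_\<Phi>[OF y]])
    fix t assume t: "t \<in> {0..u}"
    then have tI: "t \<in> I" using u by auto
    show "cov_deriv M u \<gamma> (cov_deriv M u \<gamma> (\<lambda>t. \<Phi> t (y t))) t +
         curvature M (\<gamma> t) (\<Phi> t (y t)) (velocity M u \<gamma> t) (velocity M u \<gamma> t) = 0"
      unfolding c2[OF t] velocity_restrict[OF u t] \<Phi>_Rop[OF tI, symmetric]
      by (simp add: linear_neg[OF \<Phi>_linear[OF tI]])
  qed
qed

text \<open>Agreement of \<open>W\<close> with a frame field is asked for on \<open>{0..u}\<close>
  only, as the normalised fields of the equality case are known to be constant in the frame only up
  to the time of equality.\<close>

lemma parallel_along_constant:
  assumes u: "0 < u" "u \<le> l" and W: "\<And>t. t \<in> {0..u} \<Longrightarrow> W t = \<Phi> t x"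
  shows "parallel_along M u \<gamma> W"
proof -
  have "cov_deriv M u \<gamma> W t = 0" if t: "t \<in> {0..u}" for t
  proof -
    have tI: "t \<in> I" using t u by auto
    have "cov_deriv M u \<gamma> W t = cov_deriv M u \<gamma> (\<lambda>t. \<Phi> t x) t" by (rule cov_deriv_cong[OF W t])
    also have "\<dots> = cov_deriv M l \<gamma> (\<lambda>t. \<Phi> t x) t" by (rule cov_deriv_restrict[OF u \<Phi>_field t])
    also have "\<dots> = 0"
      using \<Phi>_parallel[of x] tI unfolding parallel_on_iff[symmetric] parallel_along_def by blast
    finally show ?thesis .
  qed
  moreover have "vector_field_along M u \<gamma> W"
    unfolding vector_field_along_def
  proof (intro conjI ballI)
    note f = vector_field_restrict[OF u \<Phi>_field[of x]]
    show "W t \<in> tangent_space M (\<gamma> t)" if "t \<in> {0..u}" for t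
      using f that W[OF that] by (simp add: vector_field_along_def)
    fix c assume c: "c \<in> atlas M"
    let ?T = "{t \<in> {0..u}. \<gamma> t \<in> chart_dom c}"
    note dT = derivative_set_restrict[OF u c]
    have "Ck_on k (\<lambda>t. coords (\<Phi> t x) c) ?T" for k
      using f c unfolding vector_field_along_def smooth_on_def by blast
    then have "Ck_on k (\<lambda>t. coords (W t) c) ?T" for k
      by (rule Ck_on_cong_imp[OF dT, rotated]) (simp add: W)
    then show "smooth_on (\<lambda>t. coords (W t) c) ?T" by (simp add: smooth_on_def)
  qed
  ultimately show ?thesis by (simp add: parallel_along_def)
qed

end

section \<open>Extreme eigenvalues of symmetric operators\<close>

text \<open>The quadratic form attains its minimum m on the unit sphere of S. At a minimiser x the
  vector \<beta> x - m x is half the gradient of the form minus m times the squared norm; were it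
  nonzero, a step against it would violate minimality.\<close>

lemma symmetric_min_eigenvector:
  fixes \<beta> :: "'e::euclidean_space \<Rightarrow> 'e"
  assumes S: "subspace S" "S \<noteq> {0}" and lin: "linear \<beta>" and inv: "\<And>x. x \<in> S \<Longrightarrow> \<beta> x \<in> S"
    and sym: "\<And>x y. x \<in> S \<Longrightarrow> y \<in> S \<Longrightarrow> \<beta> x \<bullet> y = x \<bullet> \<beta> y"
  obtains m where "m \<in> eigenvalues_on S \<beta>" "\<And>x. x \<in> S \<Longrightarrow> m * (x \<bullet> x) \<le> \<beta> x \<bullet> x"
proof -
  let ?K = "sphere 0 1 \<inter> S"
  have "compact ?K" by (rule compact_Int_closed[OF compact_sphere closed_subspace[OF S(1)]])
  moreover have unit: "(1 / norm x) *\<^sub>R x \<in> ?K" if "x \<in> S" "x \<noteq> 0" for x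
    using that subspace_scale[OF S(1)] by simp
  moreover obtain z where "z \<in> S" "z \<noteq> 0" using S subspace_0 by blast
  moreover have "continuous_on ?K (\<lambda>x. \<beta> x \<bullet> x)"
    by (intro continuous_on_inner linear_continuous_on continuous_on_id lin[unfolded linear_conv_bounded_linear])
  ultimately obtain x where x: "x \<in> ?K" and min: "\<And>y. y \<in> ?K \<Longrightarrow> \<beta> x \<bullet> x \<le> \<beta> y \<bullet> y"
    using continuous_attains_inf[of ?K "\<lambda>x. \<beta> x \<bullet> x"] by blast
  define m where "m = \<beta> x \<bullet> x"
  have xx: "x \<bullet> x = 1" "x \<in> S" using x by (auto simp: dot_square_norm)
  have m: "m * (y \<bullet> y) \<le> \<beta> y \<bullet> y" if y: "y \<in> S" for y
  proof (cases "y = 0")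
    case False
    from min[OF unit[OF y False]] have "m \<le> (1 / norm y) * ((1 / norm y) * (\<beta> y \<bullet> y))"
      by (simp add: m_def linear_cmul[OF lin])
    also have "\<dots> = (\<beta> y \<bullet> y) / (y \<bullet> y)" by (simp add: dot_square_norm power2_eq_square)
    finally show ?thesis using False by (simp add: field_simps)
  qed (simp add: linear_0[OF lin])
  define d where "d = \<beta> x - m *\<^sub>R x"
  have d: "d \<in> S" unfolding d_def using xx inv S(1) by (intro subspace_diff subspace_scale) auto
  have "d = 0"
  proof (rule ccontr)
    assume "d \<noteq> 0"
    \<comment> \<open>The form shifted by m takes the value 2at + Gt^2 at
      \<open>x + t *\<^sub>R d\<close>, which is negative for this t. Dividing by G + 1 also covers
      G = 0.\<close>
    define a G t where "a = d \<bullet> d" and "G = \<beta> d \<bullet> d - m * (d \<bullet> d)" and "t = - a / (G + 1)"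
    have a: "a > 0" using \<open>d \<noteq> 0\<close> by (simp add: a_def)
    have G: "G \<ge> 0" using m[OF d] by (simp add: G_def)
    have "x + t *\<^sub>R d \<in> S" using xx d S(1) by (intro subspace_add subspace_scale) auto
    from m[OF this] have "0 \<le> \<beta> (x + t *\<^sub>R d) \<bullet> (x + t *\<^sub>R d) - m * ((x + t *\<^sub>R d) \<bullet> (x + t *\<^sub>R d))" by simp
    also have "\<dots> = (\<beta> x \<bullet> x - m * (x \<bullet> x)) + t * (\<beta> x \<bullet> d + \<beta> d \<bullet> x - 2 * m * (x \<bullet> d))
        + t * t * (\<beta> d \<bullet> d - m * (d \<bullet> d))"
      by (simp add: linear_add[OF lin] linear_cmul[OF lin] inner_add inner_commute[of d x] algebra_simps)
    also have "\<beta> d \<bullet> x = \<beta> x \<bullet> d" using sym[OF d xx(2)] by (simp add: inner_commute)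
    also have "\<beta> x \<bullet> d + \<beta> x \<bullet> d - 2 * m * (x \<bullet> d) = 2 * a"
      by (simp add: a_def d_def inner_diff_left inner_diff_right algebra_simps)
    also have "(\<beta> x \<bullet> x - m * (x \<bullet> x)) = 0" by (simp add: m_def xx)
    finally have "0 \<le> t * (2 * a) + t * t * G" by (simp add: G_def)
    also have "\<dots> = - (a * a) * (G + 2) / ((G + 1) * (G + 1))"
      using G by (simp add: t_def divide_simps) (simp add: algebra_simps)
    also have "\<dots> < 0" using a G by (simp add: divide_simps mult_pos_pos)
    finally show False by simp
  qed
  then have "m \<in> eigenvalues_on S \<beta>"
    using xx by (auto simp: eigenvalues_on_def d_def intro!: bexI[of _ x])
  then show thesis using that m by blast
qed

text \<open>Eigenvectors for distinct eigenvalues are orthogonal, hence independent, so there are at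
  most as many eigenvalues as dimensions. \<open>Min\<close> and \<open>Max\<close> of the set
  depend on this.\<close>

lemma finite_eigenvalues:
  fixes \<beta> :: "'e::euclidean_space \<Rightarrow> 'e"
  assumes sym: "\<And>x y. x \<in> S \<Longrightarrow> y \<in> S \<Longrightarrow> \<beta> x \<bullet> y = x \<bullet> \<beta> y"
  shows "finite (eigenvalues_on S \<beta>)"
proof -
  let ?E = "eigenvalues_on S \<beta>"
  have "\<forall>a\<in>?E. \<exists>x. x \<in> S \<and> x \<noteq> 0 \<and> \<beta> x = a *\<^sub>R x" by (auto simp: eigenvalues_on_def)
  then obtain f where f: "\<And>a. a \<in> ?E \<Longrightarrow> f a \<in> S \<and> f a \<noteq> 0 \<and> \<beta> (f a) = a *\<^sub>R f a" by metis
  have orth: "f a \<bullet> f b = 0" if "a \<in> ?E" "b \<in> ?E" "a \<noteq> b" for a b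
    using sym[of "f a" "f b"] f[OF that(1)] f[OF that(2)] that(3) by simp
  have "inj_on f ?E" using orth f by (intro inj_onI) (metis inner_eq_zero_iff)
  moreover have "pairwise orthogonal (f ` ?E)"
    unfolding pairwise_def orthogonal_def using orth by blast
  moreover have "0 \<notin> f ` ?E" using f by (metis imageE)
  ultimately show ?thesis using pairwise_orthogonal_independent independent_bound finite_imageD by blast
qed

text \<open>The upper bound is the lower one for -\<beta>: the negative of the eigenvalue found for
  -\<beta> is an eigenvalue of \<beta>.\<close>

lemma symmetric_eigenvalue_bounds:
  fixes \<beta> :: "'e::euclidean_space \<Rightarrow> 'e"
  assumes S: "subspace S" "S \<noteq> {0}" and lin: "linear \<beta>" and inv: "\<And>x. x \<in> S \<Longrightarrow> \<beta> x \<in> S"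
    and sym: "\<And>x y. x \<in> S \<Longrightarrow> y \<in> S \<Longrightarrow> \<beta> x \<bullet> y = x \<bullet> \<beta> y" and x: "x \<in> S"
  shows "Min (eigenvalues_on S \<beta>) * (x \<bullet> x) \<le> \<beta> x \<bullet> x" "\<beta> x \<bullet> x \<le> Max (eigenvalues_on S \<beta>) * (x \<bullet> x)"
proof -
  have fin: "finite (eigenvalues_on S \<beta>)" by (rule finite_eigenvalues[OF sym])
  obtain m where m: "m \<in> eigenvalues_on S \<beta>" "\<And>x. x \<in> S \<Longrightarrow> m * (x \<bullet> x) \<le> \<beta> x \<bullet> x"
    using symmetric_min_eigenvector[OF S lin inv sym] by blast
  have "Min (eigenvalues_on S \<beta>) \<le> m" by (rule Min_le[OF fin m(1)])
  then show "Min (eigenvalues_on S \<beta>) * (x \<bullet> x) \<le> \<beta> x \<bullet> x"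
    using m(2)[OF x] mult_right_mono[of "Min (eigenvalues_on S \<beta>)" m "x \<bullet> x"] by simp
  have inv': "- \<beta> x \<in> S" if "x \<in> S" for x using subspace_neg[OF S(1) inv[OF that]] .
  have sym': "- \<beta> x \<bullet> y = x \<bullet> - \<beta> y" if "x \<in> S" "y \<in> S" for x y using sym[OF that] by simp
  obtain m' where m': "m' \<in> eigenvalues_on S (\<lambda>x. - \<beta> x)" "\<And>x. x \<in> S \<Longrightarrow> m' * (x \<bullet> x) \<le> - \<beta> x \<bullet> x"
    using symmetric_min_eigenvector[OF S linear_compose_neg[OF lin] inv' sym'] by blast
  obtain y where y: "y \<in> S" "y \<noteq> 0" "- \<beta> y = m' *\<^sub>R y" using m'(1) by (auto simp: eigenvalues_on_def)
  have "\<beta> y = - m' *\<^sub>R y" using arg_cong[OF y(3), of uminus] by simp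
  then have "- m' \<in> eigenvalues_on S \<beta>" using y unfolding eigenvalues_on_def by blast
  then have "- m' \<le> Max (eigenvalues_on S \<beta>)" by (rule Max_ge[OF fin])
  then show "\<beta> x \<bullet> x \<le> Max (eigenvalues_on S \<beta>) * (x \<bullet> x)"
    using m'(2)[OF x] mult_right_mono[of "- m'" "Max (eigenvalues_on S \<beta>)" "x \<bullet> x"] by simp
qed

section \<open>The comparison argument in a parallel frame\<close>

lemma inner_has_real_derivative:
  assumes "(f has_vector_derivative f') (at t within S)" "(g has_vector_derivative g') (at t within S)"
  shows "((\<lambda>t. f t \<bullet> g t) has_real_derivative f t \<bullet> g' + f' \<bullet> g t) (at t within S)"
  using bounded_bilinear.has_vector_derivative[OF bounded_bilinear_inner assms]
  by (simp add: has_real_derivative_iff_has_vector_derivative)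

lemma norm_diff_scaleR_expand:
  fixes x y :: "'a::real_inner"
  shows "(x - r *\<^sub>R y) \<bullet> (x - r *\<^sub>R y) = x \<bullet> x - 2 * r * (x \<bullet> y) + r * r * (y \<bullet> y)"
  by (simp add: inner_diff_left inner_diff_right inner_commute[of y x] algebra_simps)

lemma derivative_zero_of_constant:
  fixes f :: "real \<Rightarrow> real"
  assumes f: "(f has_real_derivative D) (at t within {0..l})" and u: "0 < u" "u \<le> l" and t: "t \<in> {0..u}"
    and c: "\<And>s. s \<in> {0..u} \<Longrightarrow> f s = C"
  shows "D = 0"
proof -
  have "(f has_real_derivative D) (at t within {0..u})"
    using f by (rule DERIV_subset) (use u in auto)
  then have 1: "(f has_vector_derivative D) (at t within {0..u})"
    by (simp add: has_real_derivative_iff_has_vector_derivative)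
  have 2: "(f has_vector_derivative 0) (at t within {0..u})"
    by (rule has_vector_derivative_transform[OF t _ has_vector_derivative_const[of C]]) (simp add: c)
  have "at t within {0..u} \<noteq> bot" using u t by (simp add: trivial_limit_within islimpt_Icc)
  from vector_derivative_unique_within[OF this 1 2] show ?thesis .
qed

section \<open>Matrix solutions and their Riccati operator\<close>

locale jacobi_tensor =
  fixes l :: real and A A' R :: "real \<Rightarrow> 'f::euclidean_space \<Rightarrow> 'f" and b :: "'f \<Rightarrow> 'f"
  assumes l: "0 < l"
    and A_linear: "t \<in> {0..l} \<Longrightarrow> linear (A t)" and A'_linear: "t \<in> {0..l} \<Longrightarrow> linear (A' t)"
    and A_inj: "t \<in> {0..l} \<Longrightarrow> inj (A t)"
    and A_der: "t \<in> {0..l} \<Longrightarrow> ((\<lambda>t. A t x) has_vector_derivative A' t x) (at t within {0..l})"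
    and A'_der: "t \<in> {0..l} \<Longrightarrow> ((\<lambda>t. A' t x) has_vector_derivative - R t (A t x)) (at t within {0..l})"
    and R_sym: "t \<in> {0..l} \<Longrightarrow> R t x \<bullet> y = x \<bullet> R t y"
    and A_0: "A 0 x = x" and A'_0: "A' 0 x = b x" and b_sym: "b x \<bullet> y = x \<bullet> b y"
begin

text \<open>Symmetry of \<open>R t\<close> makes the Wronskian of two columns constant, and it
  vanishes at 0 because b is symmetric. In terms of \<open>U\<close> this says that
  \<open>U t\<close> is symmetric.\<close>

lemma wronskian: assumes t: "t \<in> {0..l}" shows "A' t x \<bullet> A t z = A t x \<bullet> A' t z"
proof -
  have *: "((\<lambda>t. A' t x \<bullet> A t z - A t x \<bullet> A' t z) has_vector_derivative 0) (at t within {0..l})" if "t \<in> {0..l}" for t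
    using DERIV_diff[OF inner_has_real_derivative[OF A'_der[OF that] A_der[OF that]]
        inner_has_real_derivative[OF A_der[OF that] A'_der[OF that]], of x z x z] R_sym[OF that, of "A t x" "A t z"]
    by (simp add: has_real_derivative_iff_has_vector_derivative)
  have "A' t x \<bullet> A t z - A t x \<bullet> A' t z = A' 0 x \<bullet> A 0 z - A 0 x \<bullet> A' 0 z"
    by (rule constant_on_interval[OF * t]) (use l in simp_all)
  then show ?thesis by (simp add: A_0 A'_0 b_sym)
qed

lemma A_surj: "t \<in> {0..l} \<Longrightarrow> surj (A t)"
  using linear_inj_imp_surj[OF A_linear A_inj] .

text \<open>\<open>U t\<close> sends the value at t of any column of A to its derivative. Since
  \<open>A t\<close> is bijective, \<open>inv\<close> is a genuine inverse here.\<close>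

definition U :: "real \<Rightarrow> 'f \<Rightarrow> 'f" where "U t c = A' t (inv (A t) c)"

lemma A_inv: "t \<in> {0..l} \<Longrightarrow> A t (inv (A t) c) = c"
  by (rule surj_f_inv_f[OF A_surj])

lemma U_A: "t \<in> {0..l} \<Longrightarrow> U t (A t x) = A' t x"
  by (simp add: U_def inv_f_f[OF A_inj])

lemma U_sym: assumes t: "t \<in> {0..l}" shows "U t x \<bullet> y = x \<bullet> U t y"
  using wronskian[OF t, of "inv (A t) x" "inv (A t) y"] A_inv[OF t] by (simp add: U_def)

lemma U_scale: assumes t: "t \<in> {0..l}" shows "U t (r *\<^sub>R x) = r *\<^sub>R U t x"
proof -
  have "U t (r *\<^sub>R x) = U t (A t (r *\<^sub>R inv (A t) x))"
    using A_inv[OF t] linear_cmul[OF A_linear[OF t]] by simp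
  also have "\<dots> = A' t (r *\<^sub>R inv (A t) x)" by (rule U_A[OF t])
  also have "\<dots> = r *\<^sub>R U t x" by (simp add: linear_cmul[OF A'_linear[OF t]] U_def)
  finally show ?thesis .
qed

text \<open>With z t the preimage of the constant vector c, differentiating A z = c gives A z' = - U
  c, hence A' z' = - U (U c). The remaining term of the product rule is A'' z = - R c.\<close>

lemma riccati:
  assumes t: "t \<in> {0..l}"
  shows "((\<lambda>t. U t c) has_vector_derivative - R t c - U t (U t c)) (at t within {0..l})"
proof -
  let ?z = "\<lambda>t. inv (A t) c"
  have "\<exists>z'. (?z has_derivative z') (at t within {0..l}) \<and> (\<forall>v. A t (z' v) = 0 - v *\<^sub>R A' t (?z t))"
    by (rule has_derivative_linear_solution[where F=A and h="\<lambda>t. c" and D="\<lambda>t b v. v *\<^sub>R A' t b",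
          OF A_linear A_inj A_der[unfolded has_vector_derivative_def] has_derivative_const A_inv t])
  then obtain z' where z': "(?z has_derivative z') (at t within {0..l})" "\<And>v. A t (z' v) = - (v *\<^sub>R U t c)"
    by (auto simp: U_def)
  have "A' t (z' v) = - (v *\<^sub>R U t (U t c))" for v
    using U_A[OF t, of "z' v"] U_scale[OF t, of "- v" "U t c"] by (simp add: z'(2))
  moreover have "((\<lambda>t. A' t (?z t)) has_derivative (\<lambda>v. v *\<^sub>R - R t (A t (?z t)) + A' t (z' v))) (at t within {0..l})"
    by (rule has_derivative_lin_apply[where D="\<lambda>b v. v *\<^sub>R - R t (A t b)",
          OF A'_linear t A'_der[OF t, unfolded has_vector_derivative_def] z'(1)])
  ultimately show ?thesis
    by (simp add: has_vector_derivative_def U_def[symmetric] A_inv[OF t] algebra_simps)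
qed

lemma U_0: "U 0 c = b c"
  using U_A[of 0 c] l by (simp add: A_0 A'_0)

abbreviation q :: "'f \<Rightarrow> real \<Rightarrow> real" where "q c t \<equiv> U t c \<bullet> c"

lemma q_der: "t \<in> {0..l} \<Longrightarrow> (q c has_real_derivative - (R t c \<bullet> c) - U t c \<bullet> U t c) (at t within {0..l})"
  using inner_has_real_derivative[OF riccati has_vector_derivative_const, of t c c] U_sym[of t "U t c" c]
  by (simp add: inner_diff_left)

end

section \<open>Comparison with one fixed unit vector\<close>

locale jacobi_comparison = jacobi_tensor l A A' R0 b for l A A' and R0 :: "real \<Rightarrow> 'f::euclidean_space \<Rightarrow> 'f" and b +
  fixes w w' :: "real \<Rightarrow> 'e::euclidean_space" and R :: "real \<Rightarrow> 'e \<Rightarrow> 'e" and c :: 'f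
  assumes w: "t \<in> {0..l} \<Longrightarrow> (w has_vector_derivative w' t) (at t within {0..l})"
    and w': "t \<in> {0..l} \<Longrightarrow> (w' has_vector_derivative - R t (w t)) (at t within {0..l})"
    and c: "c \<bullet> c = 1" and curv: "t \<in> {0..l} \<Longrightarrow> R t (w t) \<bullet> w t \<le> (R0 t c \<bullet> c) * (w t \<bullet> w t)"
    and init: "(b c \<bullet> c) * (w 0 \<bullet> w 0) \<le> w' 0 \<bullet> w 0"
begin

definition excess :: "real \<Rightarrow> real" where "excess t = w' t \<bullet> w t - q c t * (w t \<bullet> w t)"

definition excess' :: "real \<Rightarrow> real" where
  "excess' t = ((R0 t c \<bullet> c) * (w t \<bullet> w t) - R t (w t) \<bullet> w t)
    + (w' t - q c t *\<^sub>R w t) \<bullet> (w' t - q c t *\<^sub>R w t) + (U t c - q c t *\<^sub>R c) \<bullet> (U t c - q c t *\<^sub>R c) * (w t \<bullet> w t)"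

text \<open>Completing squares. As c is a unit vector and q = U c . c, the squared norm of U c - q c
  is that of U c minus q^2; multiplied by the squared norm of w, this q^2 cancels the one from the
  square of w' - q w.\<close>

lemma excess_der: assumes t: "t \<in> {0..l}" shows "(excess has_real_derivative excess' t) (at t within {0..l})"
proof -
  have "(excess has_real_derivative (w' t \<bullet> w' t + - R t (w t) \<bullet> w t) -
     ((- (R0 t c \<bullet> c) - U t c \<bullet> U t c) * (w t \<bullet> w t) + (w t \<bullet> w' t + w' t \<bullet> w t) * q c t)) (at t within {0..l})"
    unfolding excess_def[abs_def]
    by (intro DERIV_diff DERIV_mult inner_has_real_derivative w w' q_der t)
  moreover have "(w' t \<bullet> w' t + - R t (w t) \<bullet> w t) -
     ((- (R0 t c \<bullet> c) - U t c \<bullet> U t c) * (w t \<bullet> w t) + (w t \<bullet> w' t + w' t \<bullet> w t) * q c t) = excess' t"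
    unfolding excess'_def norm_diff_scaleR_expand c inner_commute[of "w t" "w' t"] inner_minus_left
    by algebra
  ultimately show ?thesis by (simp only:)
qed

lemma excess'_nonneg: "t \<in> {0..l} \<Longrightarrow> excess' t \<ge> 0"
  unfolding excess'_def using curv[of t] by (intro add_nonneg_nonneg mult_nonneg_nonneg) auto

lemma excess_0: "excess 0 \<ge> 0"
  using init by (simp add: excess_def U_0)

lemma excess_nonneg: "t \<in> {0..l} \<Longrightarrow> excess t \<ge> 0"
  using nondecreasing_within[OF excess_der excess'_nonneg, of 0 t] excess_0 by simp

text \<open>Nonvanishing of w is itself a result of the comparison: a nonnegative excess bounds the
  derivative of the squared norm below by 2q times that norm, and q is bounded, so the squared norm
  times \<open>exp (2 * C * s)\<close> does not decrease.\<close>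

lemma w_nonzero:
  assumes w0: "w 0 \<noteq> 0" and t: "t \<in> {0..l}" shows "w t \<noteq> 0"
proof -
  have "continuous_on {0..l} (q c)" by (rule DERIV_continuous_on[OF q_der])
  then have "bounded (q c ` {0..l})" by (intro compact_imp_bounded compact_continuous_image) auto
  then obtain C where "\<forall>x\<in>q c ` {0..l}. norm x \<le> C" unfolding bounded_iff by blast
  then have C: "\<bar>q c s\<bar> \<le> C" if "s \<in> {0..l}" for s using that by (metis imageI real_norm_def)
  let ?g = "\<lambda>s. exp (2 * C * s) * (w s \<bullet> w s)"
  have g: "(?g has_real_derivative (exp (2 * C * s) * (2 * C)) * (w s \<bullet> w s) + (w s \<bullet> w' s + w' s \<bullet> w s) * exp (2 * C * s)) (at s within {0..l})"
    if "s \<in> {0..l}" for s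
    by (intro DERIV_mult inner_has_real_derivative w that) (auto intro!: derivative_eq_intros)
  have g': "(exp (2 * C * s) * (2 * C)) * (w s \<bullet> w s) + (w s \<bullet> w' s + w' s \<bullet> w s) * exp (2 * C * s) \<ge> 0"
    if s: "s \<in> {0..l}" for s
  proof -
    have "- C * (w s \<bullet> w s) \<le> q c s * (w s \<bullet> w s)" using C[OF s] by (intro mult_right_mono) auto
    also have "\<dots> \<le> w' s \<bullet> w s" using excess_nonneg[OF s] by (simp add: excess_def)
    finally have "0 \<le> exp (2 * C * s) * (2 * (C * (w s \<bullet> w s) + w' s \<bullet> w s))" by (intro mult_nonneg_nonneg) auto
    then show ?thesis by (simp add: inner_commute[of "w s" "w' s"] algebra_simps)
  qed
  have "?g 0 \<le> ?g t" by (rule nondecreasing_within[where f="?g", OF g g']) (use t in auto)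
  then have "w t = 0 \<Longrightarrow> w 0 \<bullet> w 0 \<le> 0" by simp
  then show ?thesis using w0 inner_gt_zero_iff[of "w 0"] by linarith
qed

text \<open>The excess is nonnegative and nondecreasing, so if it vanishes at u it vanishes on all
  of \<open>{0..u}\<close>. Its derivative is then 0, and with it each of three nonnegative
  summands.\<close>

lemma excess_rigid:
  assumes u: "0 < u" "u \<le> l" and eq: "excess u = 0" and t: "t \<in> {0..u}" and nz: "w t \<noteq> 0"
  shows "R t (w t) \<bullet> w t = (R0 t c \<bullet> c) * (w t \<bullet> w t)" "w' t = q c t *\<^sub>R w t" "U t c = q c t *\<^sub>R c"
proof -
  have z: "excess s = 0" if "s \<in> {0..u}" for s
    using nondecreasing_within[OF excess_der excess'_nonneg, of s u] excess_nonneg[of s] that u eq by auto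
  have tl: "t \<in> {0..l}" using t u by auto
  have 0: "excess' t = 0" by (rule derivative_zero_of_constant[OF excess_der[OF tl] u t z])
  have nn: "0 \<le> (R0 t c \<bullet> c) * (w t \<bullet> w t) - R t (w t) \<bullet> w t" using curv[OF tl] by simp
  have nn3: "0 \<le> (U t c - q c t *\<^sub>R c) \<bullet> (U t c - q c t *\<^sub>R c) * (w t \<bullet> w t)" by simp
  have "(R0 t c \<bullet> c) * (w t \<bullet> w t) - R t (w t) \<bullet> w t = 0"
    using 0 nn nn3 inner_ge_zero[of "w' t - q c t *\<^sub>R w t"] unfolding excess'_def by linarith
  then show "R t (w t) \<bullet> w t = (R0 t c \<bullet> c) * (w t \<bullet> w t)" by simp
  have "(w' t - q c t *\<^sub>R w t) \<bullet> (w' t - q c t *\<^sub>R w t) = 0"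
    using 0 nn nn3 inner_ge_zero[of "w' t - q c t *\<^sub>R w t"] unfolding excess'_def by linarith
  then show "w' t = q c t *\<^sub>R w t" by simp
  have "(U t c - q c t *\<^sub>R c) \<bullet> (U t c - q c t *\<^sub>R c) * (w t \<bullet> w t) = 0"
    using 0 nn nn3 inner_ge_zero[of "w' t - q c t *\<^sub>R w t"] unfolding excess'_def by linarith
  then show "U t c = q c t *\<^sub>R c" using nz by simp
qed

end

section \<open>Monotonicity of the ratio of norms, and rigidity\<close>

lemma inverse_sqrt_has_derivative:
  assumes "(y::real) > 0"
  shows "((\<lambda>y. inverse (sqrt y)) has_real_derivative - (inverse (sqrt y) / (2 * y))) (at y)"
proof -
  have "sqrt y * sqrt y = y" using assms by simp
  then show ?thesis using assms
    by (auto intro!: derivative_eq_intros simp: field_simps)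
qed

text \<open>In the equality case the differential equations for w and v are obtained only at
  positive times; continuity at 0 closes the gap.\<close>

lemma constant_on_interval_off_0:
  fixes f :: "real \<Rightarrow> 'a::banach"
  assumes u: "0 < u" and f: "continuous_on {0..u} f"
    and d: "\<And>t. 0 < t \<Longrightarrow> t \<le> u \<Longrightarrow> (f has_vector_derivative 0) (at t within {0..u})" and t: "t \<in> {0..u}"
  shows "f t = f 0"
  by (rule has_derivative_zero_unique_strong_interval[of "{0}" 0 u f])
     (use u f d t in \<open>auto simp: has_vector_derivative_def\<close>)

text \<open>\<open>H\<close> is the space from which the comparison vectors c may be taken, later
  the complement of the velocity, and \<open>A t a\<close> is the perpendicular Jacobi field of the
  second manifold. The ratio g of squared norms starts at 1 or above when a is nonzero.\<close>

lemma (in jacobi_tensor)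
  fixes w w' :: "real \<Rightarrow> 'e::euclidean_space" and K :: "real \<Rightarrow> 'e \<Rightarrow> 'e"
  assumes w: "\<And>t. t \<in> {0..l} \<Longrightarrow> (w has_vector_derivative w' t) (at t within {0..l})"
    and w': "\<And>t. t \<in> {0..l} \<Longrightarrow> (w' has_vector_derivative - K t (w t)) (at t within {0..l})"
    and H: "subspace H" "H \<noteq> {0}"
    and curv: "\<And>t c. t \<in> {0..l} \<Longrightarrow> c \<in> H \<Longrightarrow> c \<bullet> c = 1 \<Longrightarrow> K t (w t) \<bullet> w t \<le> (R t c \<bullet> c) * (w t \<bullet> w t)"
    and init: "\<And>c. c \<in> H \<Longrightarrow> c \<bullet> c = 1 \<Longrightarrow> (b c \<bullet> c) * (w 0 \<bullet> w 0) \<le> w' 0 \<bullet> w 0"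
    and a: "\<And>t. t \<in> {0..l} \<Longrightarrow> A t a \<in> H" "norm a \<le> norm (w 0)" and w0: "w 0 \<noteq> 0"
  shows norm_comparison_le: "t \<in> {0..l} \<Longrightarrow> norm (A t a) \<le> norm (w t)"
    and norm_comparison_eq: "0 < u \<Longrightarrow> u \<le> l \<Longrightarrow> norm (A u a) = norm (w u) \<Longrightarrow>
      \<exists>x y. \<forall>t\<in>{0..u}. w t \<noteq> 0 \<and> norm (A t a) = norm (w t) \<and> w t = norm (w t) *\<^sub>R x \<and>
        A t a = norm (w t) *\<^sub>R y \<and> K t (w t) \<bullet> w t = R t (A t a) \<bullet> A t a"
proof -
  have cmp: "jacobi_comparison l A A' R b w w' K c" if "c \<in> H" "c \<bullet> c = 1" for c
    by (intro jacobi_comparison.intro jacobi_tensor_axioms jacobi_comparison_axioms.intro w w' curv init that)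
  have unit: "(1 / norm x) *\<^sub>R x \<in> H" "((1 / norm x) *\<^sub>R x) \<bullet> ((1 / norm x) *\<^sub>R x) = 1" if "x \<in> H" "x \<noteq> 0" for x
    using that subspace_scale[OF H(1)] by (simp_all add: dot_square_norm power2_eq_square)
  \<comment> \<open>The vector a may be 0, so nonvanishing of w is derived from an arbitrary unit
    vector of H.\<close>
  obtain z where "z \<in> H" "z \<noteq> 0" using H subspace_0 by blast
  then obtain c0 where c0: "c0 \<in> H" "c0 \<bullet> c0 = 1" using unit by blast
  have nz: "w t \<noteq> 0" if "t \<in> {0..l}" for t
    by (rule jacobi_comparison.w_nonzero[OF cmp[OF c0] w0 that])
  define v v' where "v t = A t a" and "v' t = A' t a" for t
  have v: "(v has_vector_derivative v' t) (at t within {0..l})" if "t \<in> {0..l}" for t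
    unfolding v_def v'_def by (rule A_der[OF that])
  define N N0 g where "N t = w t \<bullet> w t" and "N0 t = v t \<bullet> v t" and "g t = N t / N0 t" for t
  have N: "N t > 0" if "t \<in> {0..l}" for t using nz[OF that] by (simp add: N_def)
  have norms: "norm (w t) = sqrt (N t)" "norm (A t a) = sqrt (N0 t)" for t
    by (simp_all add: N_def N0_def v_def norm_eq_sqrt_inner)
  have vnz: "v t \<noteq> 0" if "a \<noteq> 0" "t \<in> {0..l}" for t
    using linear_injective_0[OF A_linear[OF that(2)]] A_inj[OF that(2)] that(1) by (auto simp: v_def)
  have N0: "N0 t > 0" if "a \<noteq> 0" "t \<in> {0..l}" for t using vnz[OF that] by (simp add: N0_def)
  define c where "c t = (1 / norm (v t)) *\<^sub>R v t" for t
  have c: "c t \<in> H" "c t \<bullet> c t = 1" if "a \<noteq> 0" "t \<in> {0..l}" for t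
    using unit[OF a(1)[OF that(2)]] vnz[OF that] by (simp_all add: c_def v_def)
  have Uc: "U t (c t) = (1 / norm (v t)) *\<^sub>R v' t" if "t \<in> {0..l}" for t
    unfolding c_def U_scale[OF that] by (simp add: v_def v'_def U_A[OF that])
  \<comment> \<open>Because U maps v to v', the number q for \<open>c t\<close> at the time t is the
    logarithmic derivative of the norm of v. A nonnegative excess at t then says that the norm of w
    grows at least as fast in the logarithmic sense.\<close>
  have qc: "q (c t) t = (v' t \<bullet> v t) / N0 t" if "t \<in> {0..l}" for t
    unfolding Uc[OF that] by (simp add: c_def N0_def dot_square_norm power2_eq_square)
  have ex: "jacobi_comparison.excess A A' w w' (c t) t = w' t \<bullet> w t - q (c t) t * N t"
    if "a \<noteq> 0" "t \<in> {0..l}" for t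
    using jacobi_comparison.excess_def[OF cmp[OF c[OF that]]] by (simp add: N_def)
  have key: "(v' t \<bullet> v t) * N t \<le> (w' t \<bullet> w t) * N0 t" if "a \<noteq> 0" "t \<in> {0..l}" for t
    using jacobi_comparison.excess_nonneg[OF cmp[OF c[OF that]] that(2)] N0[OF that]
    unfolding ex[OF that] qc[OF that(2)] by (simp add: N_def field_simps)
  define g' where "g' t = 2 * ((w' t \<bullet> w t) * N0 t - (v' t \<bullet> v t) * N t) / (N0 t * N0 t)" for t
  have g: "(g has_real_derivative g' t) (at t within {0..l})" if "a \<noteq> 0" "t \<in> {0..l}" for t
  proof -
    have "((\<lambda>t. N t / N0 t) has_real_derivative ((w t \<bullet> w' t + w' t \<bullet> w t) * N0 t - N t * (v t \<bullet> v' t + v' t \<bullet> v t)) / (N0 t * N0 t))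
        (at t within {0..l})"
      using N0[OF that] unfolding N_def N0_def
      by (intro DERIV_divide inner_has_real_derivative w v that) auto
    moreover have "(w t \<bullet> w' t + w' t \<bullet> w t) * N0 t - N t * (v t \<bullet> v' t + v' t \<bullet> v t)
        = 2 * ((w' t \<bullet> w t) * N0 t - (v' t \<bullet> v t) * N t)"
      unfolding inner_commute[of "w t" "w' t"] inner_commute[of "v t" "v' t"] by algebra
    ultimately show ?thesis unfolding g_def[abs_def] g'_def by (simp only:)
  qed
  have g'_nonneg: "g' t \<ge> 0" if "a \<noteq> 0" "t \<in> {0..l}" for t
    using key[OF that] N0[OF that] by (simp add: g'_def)
  have g_mono: "g s \<le> g t" if "a \<noteq> 0" "0 \<le> s" "s \<le> t" "t \<le> l" for s t
    by (rule nondecreasing_within[OF g g'_nonneg]) (use that in auto)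
  have g0: "g 0 \<ge> 1" if "a \<noteq> 0"
  proof -
    have "N0 0 \<le> N 0" using a(2) norms[of 0] A_0[of a] by simp
    then show ?thesis using N0[OF that, of 0] l by (simp add: g_def)
  qed
  show "norm (A t a) \<le> norm (w t)" if t: "t \<in> {0..l}" for t
  proof (cases "a = 0")
    case True
    then show ?thesis using linear_0[OF A_linear[OF t]] by simp
  next
    case False
    have "1 \<le> g t" using g0[OF False] g_mono[OF False, of 0 t] t by simp
    then show ?thesis unfolding norms using N0[OF False t] by (simp add: g_def)
  qed
  assume u: "0 < u" "u \<le> l" and eq: "norm (A u a) = norm (w u)"
  have ul: "u \<in> {0..l}" using u by simp
  have a0: "a \<noteq> 0" using eq nz[OF ul] linear_0[OF A_linear[OF ul]] by auto
  have sub: "t \<in> {0..l}" if "t \<in> {0..u}" for t using that u by auto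
  have "g u = 1" using eq N[OF ul] unfolding norms g_def by simp
  then have g1: "g t = 1" if "t \<in> {0..u}" for t
    using g0[OF a0] g_mono[OF a0, of 0 t] g_mono[OF a0, of t u] that u by auto
  have NN: "N0 t = N t" if "t \<in> {0..u}" for t
    using g1[OF that] N0[OF a0 sub[OF that]] by (simp add: g_def)
  have g'0: "g' t = 0" if "t \<in> {0..u}" for t
    by (rule derivative_zero_of_constant[OF g[OF a0 sub[OF that]] u that g1])
  \<comment> \<open>The ratio is constantly 1 on \<open>{0..u}\<close>, so its derivative vanishes
    there; up to a positive factor this derivative is the excess for \<open>c t\<close> at its own
    time t.\<close>
  have ex0: "jacobi_comparison.excess A A' w w' (c t) t = 0" if t: "t \<in> {0..u}" for t
    using g'0[OF t] N0[OF a0 sub[OF t]] NN[OF t]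
    unfolding ex[OF a0 sub[OF t]] qc[OF sub[OF t]] by (simp add: g'_def N_def)
  define r where "r t = q (c t) t" for t
  have ws: "w' t = r t *\<^sub>R w t" and vs: "v' t = r t *\<^sub>R v t" if t: "0 < t" "t \<le> u" for t
  proof -
    have tu: "t \<in> {0..u}" "t \<le> l" "t \<in> {0..t}" using t u by auto
    \<comment> \<open>Rigidity is used on \<open>{0..t}\<close> with the vector \<open>c t\<close>
      and evaluated at the right end, which requires t > 0.\<close>
    note rigid = jacobi_comparison.excess_rigid[OF cmp[OF c[OF a0 sub[OF tu(1)]]] t(1) tu(2) ex0[OF tu(1)] tu(3) nz[OF sub[OF tu(1)]]]
    show "w' t = r t *\<^sub>R w t" using rigid(2) by (simp add: r_def)
    have "(1 / norm (v t)) *\<^sub>R v' t = (1 / norm (v t)) *\<^sub>R (r t *\<^sub>R v t)"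
    proof -
      have "U t (c t) = r t *\<^sub>R c t" unfolding r_def by (rule rigid(3))
      then show ?thesis unfolding Uc[OF sub[OF tu(1)]] by (simp add: c_def)
    qed
    then show "v' t = r t *\<^sub>R v t"
      unfolding scaleR_cancel_left using vnz[OF a0 sub[OF tu(1)]] by simp
  qed
  \<comment> \<open>w and v satisfy the same equation x' = r x, whereas the reciprocal h of the norm
    of w satisfies h' = - r h. Hence the products of h with w and with v are constant.\<close>
  define h where "h t = inverse (sqrt (N t))" for t
  have h: "(h has_real_derivative - (inverse (sqrt (N t)) / (2 * N t)) * (w t \<bullet> w' t + w' t \<bullet> w t)) (at t within {0..u})"
    if t: "t \<in> {0..u}" for t
    unfolding h_def N_def
    by (rule DERIV_chain'[OF DERIV_subset[OF inner_has_real_derivative[OF w w]] inverse_sqrt_has_derivative])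
       (use sub[OF t] N[OF sub[OF t]] u in \<open>auto simp: N_def\<close>)
  have hr: "(h has_real_derivative - r t * h t) (at t within {0..u})" if t: "0 < t" "t \<le> u" for t
  proof -
    have tu: "t \<in> {0..u}" using t by simp
    have "- (inverse (sqrt (N t)) / (2 * N t)) * (w t \<bullet> w' t + w' t \<bullet> w t) = - r t * h t"
      using N[OF sub[OF tu]] unfolding ws[OF t] by (simp add: h_def N_def[symmetric])
    then show ?thesis using h[OF tu] by (simp only:)
  qed
  have hd: "((\<lambda>t. h t *\<^sub>R x t) has_vector_derivative 0) (at t within {0..u})"
    if t: "0 < t" "t \<le> u" and x: "(x has_vector_derivative r t *\<^sub>R x t) (at t within {0..l})"
    for t and x :: "real \<Rightarrow> 'b::real_normed_vector"
    using has_vector_derivative_scaleR[OF hr[OF t] has_vector_derivative_within_subset[OF x, of "{0..u}"]] u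
    by (simp add: mult.commute)
  have hc: "continuous_on {0..u} h" by (rule DERIV_continuous_on[OF h])
  have wc: "continuous_on {0..u} w" "continuous_on {0..u} v"
    using continuous_on_subset[OF has_derivative_continuous_on[OF w[unfolded has_vector_derivative_def]], of "{0..u}"]
      continuous_on_subset[OF has_derivative_continuous_on[OF v[unfolded has_vector_derivative_def]], of "{0..u}"] u by auto
  have wr: "(w has_vector_derivative r t *\<^sub>R w t) (at t within {0..l})"
    and vr: "(v has_vector_derivative r t *\<^sub>R v t) (at t within {0..l})" if "0 < t" "t \<le> u" for t
    using w[of t] v[of t] ws[OF that] vs[OF that] that u by simp_all
  define x y where "x = h 0 *\<^sub>R w 0" and "y = h 0 *\<^sub>R v 0"
  have hx: "h t *\<^sub>R w t = x" if "t \<in> {0..u}" for t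
    unfolding x_def
    by (rule constant_on_interval_off_0[OF u(1) continuous_on_scaleR[OF hc wc(1)] hd[OF _ _ wr] that])
  have hy: "h t *\<^sub>R v t = y" if "t \<in> {0..u}" for t
    unfolding y_def
    by (rule constant_on_interval_off_0[OF u(1) continuous_on_scaleR[OF hc wc(2)] hd[OF _ _ vr] that])
  have wx: "w t = norm (w t) *\<^sub>R x" and vy: "v t = norm (w t) *\<^sub>R y" if t: "t \<in> {0..u}" for t
    using nz[OF sub[OF t]] unfolding hx[OF t, symmetric] hy[OF t, symmetric] by (simp_all add: h_def norms(1)[symmetric])
  \<comment> \<open>The direction of v is constant, so the vector \<open>c u\<close> of the final
    time describes v on the whole interval. Rigidity for this single vector gives the equality of
    curvatures at every time, including 0.\<close>
  have yc: "y = c u"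
    using hy[of u] u NN[of u] norms(2)[of u] by (simp add: h_def c_def v_def divide_inverse)
  have Keq: "K t (w t) \<bullet> w t = R t (A t a) \<bullet> A t a" if t: "t \<in> {0..u}" for t
  proof -
    have uu: "u \<in> {0..u}" using u by simp
    have R_scale: "R t (s *\<^sub>R z) \<bullet> (s *\<^sub>R z) = s * s * (R t z \<bullet> z)" for s z
      using R_sym[OF sub[OF t], of "s *\<^sub>R z" "s *\<^sub>R z"] R_sym[OF sub[OF t], of "s *\<^sub>R z" z] by (simp add: inner_commute)
    have "K t (w t) \<bullet> w t = (R t (c u) \<bullet> c u) * (w t \<bullet> w t)"
      by (rule jacobi_comparison.excess_rigid(1)[OF cmp[OF c[OF a0 ul]] u ex0[OF uu] t nz[OF sub[OF t]]])
    also have "\<dots> = R t (v t) \<bullet> v t"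
      unfolding vy[OF t] R_scale yc by (simp add: dot_square_norm power2_eq_square)
    finally show ?thesis by (simp add: v_def)
  qed
  show "\<exists>x y. \<forall>t\<in>{0..u}. w t \<noteq> 0 \<and> norm (A t a) = norm (w t) \<and> w t = norm (w t) *\<^sub>R x \<and>
        A t a = norm (w t) *\<^sub>R y \<and> K t (w t) \<bullet> w t = R t (A t a) \<bullet> A t a"
  proof (intro exI ballI conjI)
    fix t assume t: "t \<in> {0..u}"
    show "w t \<noteq> 0" by (rule nz[OF sub[OF t]])
    show "norm (A t a) = norm (w t)" unfolding norms NN[OF t] ..
    show "w t = norm (w t) *\<^sub>R x" by (rule wx[OF t])
    show "A t a = norm (w t) *\<^sub>R y" using vy[OF t] unfolding v_def .
    show "K t (w t) \<bullet> w t = R t (A t a) \<bullet> A t a" by (rule Keq[OF t])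
  qed
qed

section \<open>Jacobi fields in a parallel frame\<close>

lemma Ck_on_Pair:
  assumes S: "derivative_set S" and f: "Ck_on k f S" and g: "Ck_on k g S"
  shows "Ck_on k (\<lambda>x. (f x, g x)) S"
proof -
  have "Ck_on k (\<lambda>x. (f x, 0) + (0, g x)) S"
    by (intro Ck_on_add S Ck_on_linear[OF S _ f, of "\<lambda>y. (y, 0)"] Ck_on_linear[OF S _ g, of "\<lambda>y. (0, y)"])
       (auto intro: bounded_linear_Pair bounded_linear_ident bounded_linear_zero)
  then show ?thesis by simp
qed

context framed_geodesic
begin

lemma Rop_perp: "t \<in> I \<Longrightarrow> Rop t x \<bullet> e0 = 0"
  using Rop_sym[of t x e0] Rop_e0[of t] by simp

text \<open>Pairing a solution with its derivative turns the Jacobi equation into a first-order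
  linear system, to which existence, uniqueness and regularity apply.\<close>

definition jacobi_system :: "real \<Rightarrow> 'e \<times> 'e \<Rightarrow> 'e \<times> 'e" where
  "jacobi_system t p = (snd p, - Rop t (fst p))"

lemma jacobi_system_linear: "t \<in> I \<Longrightarrow> linear (jacobi_system t)"
  unfolding jacobi_system_def
  by (rule linearI) (simp_all add: linear_add[OF Rop_linear] linear_cmul[OF Rop_linear])

lemma Ck_on_jacobi_system: "Ck_on k (\<lambda>t. jacobi_system t p) I"
  unfolding jacobi_system_def
  by (intro Ck_on_Pair Ck_on_minus Ck_on_const derivative_set_I smooth_onD[OF smooth_Rop])

lemma continuous_jacobi_system: "continuous_on I (\<lambda>t. jacobi_system t p)"
  by (rule Ck_on_imp_continuous_on[OF Ck_on_jacobi_system])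

lemma jacobi_zero:
  assumes y: "\<And>t. t \<in> I \<Longrightarrow> (y has_vector_derivative y' t) (at t within I)"
    and y': "\<And>t. t \<in> I \<Longrightarrow> (y' has_vector_derivative - Rop t (y t)) (at t within I)"
    and init: "y 0 = 0" "y' 0 = 0" and t: "t \<in> I"
  shows "y t = 0"
proof -
  have "((\<lambda>t. (y t, y' t)) has_vector_derivative jacobi_system t (y t, y' t)) (at t within I)" if "t \<in> I" for t
    using has_vector_derivative_Pair[OF y[OF that] y'[OF that]] by (simp add: jacobi_system_def)
  from linear_ode_zero[OF jacobi_system_linear continuous_jacobi_system this _ t] init
  have "(y t, y' t) = 0" by (simp add: zero_prod_def)
  then show ?thesis by (simp add: zero_prod_def)
qed

lemma jacobi_solution:
  "\<exists>y y'. y 0 = y0 \<and> y' 0 = y1 \<and> smooth_on y I \<and> smooth_on y' I \<and>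
    (\<forall>t\<in>I. (y has_vector_derivative y' t) (at t within I) \<and> (y' has_vector_derivative - Rop t (y t)) (at t within I))"
proof -
  have "0 \<le> l" using l_pos by simp
  from linear_ode_solution[OF this jacobi_system_linear continuous_jacobi_system, of "(y0, y1)"]
  obtain Y where Y: "Y 0 = (y0, y1)"
    "\<And>t. t \<in> I \<Longrightarrow> (Y has_vector_derivative jacobi_system t (Y t)) (at t within I)" by blast
  have Ck: "Ck_on k Y I" for k
    by (rule linear_ode_Ck[OF derivative_set_I jacobi_system_linear Ck_on_jacobi_system Y(2)])
  show ?thesis
  proof (intro exI conjI ballI)
    show "smooth_on (\<lambda>t. fst (Y t)) I" "smooth_on (\<lambda>t. snd (Y t)) I"
      unfolding smooth_on_def
      by (auto intro: Ck_on_linear[OF derivative_set_I bounded_linear_fst Ck]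
          Ck_on_linear[OF derivative_set_I bounded_linear_snd Ck])
    fix t assume "t \<in> I"
    from bounded_linear.has_vector_derivative[OF bounded_linear_fst Y(2)[OF this]]
      bounded_linear.has_vector_derivative[OF bounded_linear_snd Y(2)[OF this]]
    show "((\<lambda>t. fst (Y t)) has_vector_derivative snd (Y t)) (at t within I)"
      "((\<lambda>t. snd (Y t)) has_vector_derivative - Rop t (fst (Y t))) (at t within I)"
      by (simp_all add: jacobi_system_def)
  qed (simp_all add: Y(1))
qed

definition perp :: "'e set" where "perp = {x. x \<bullet> e0 = 0}"

lemma subspace_perp: "subspace perp"
  unfolding perp_def by (rule subspaceI) (simp_all add: inner_add_left)

text \<open>Here the assumption on the dimension enters: a nonzero complement is what provides
  eigenvalues of the transformations and unit vectors c for the comparison.\<close>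

lemma perp_nontrivial:
  assumes "DIM('e) \<ge> 2" shows "perp \<noteq> {0}"
proof -
  obtain y where "y \<noteq> 0" "orthogonal e0 y" using orthogonal_to_vector_exists[OF assms] by blast
  then show ?thesis by (auto simp: perp_def orthogonal_def inner_commute)
qed

text \<open>The transformation \<open>B\<close> of \<open>\<gamma>'(0)\<^sup>\<bottom>\<close> in the frame, extended by \<open>0\<close> to the tangent direction.\<close>

definition frame_op :: "(('m, 'e) tvec \<Rightarrow> ('m, 'e) tvec) \<Rightarrow> 'e \<Rightarrow> 'e" where
  "frame_op B x = frame_coords 0 (B (\<Phi> 0 (x - (x \<bullet> e0) *\<^sub>R e0)))"

context
  fixes B assumes B: "symmetric_transformation_on (initial_perp M l \<gamma>) (rmetric M (\<gamma> 0)) B"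
begin

lemma zero_I: "0 \<in> I" using l_pos by simp

lemma initial_perp_iff: "X \<in> initial_perp M l \<gamma> \<longleftrightarrow> (\<exists>x\<in>perp. X = \<Phi> 0 x)"
  by (auto simp: initial_perp_\<Phi> perp_def)

lemma proj_perp: "x - (x \<bullet> e0) *\<^sub>R e0 \<in> perp"
  by (simp add: perp_def inner_diff_left e0_unit)

lemma \<Phi>_frame_op_proj: "\<Phi> 0 (frame_op B x) = B (\<Phi> 0 (x - (x \<bullet> e0) *\<^sub>R e0))" and frame_op_perp: "frame_op B x \<in> perp"
proof -
  have "\<Phi> 0 (x - (x \<bullet> e0) *\<^sub>R e0) \<in> initial_perp M l \<gamma>" using proj_perp initial_perp_iff by blast
  then have "B (\<Phi> 0 (x - (x \<bullet> e0) *\<^sub>R e0)) \<in> initial_perp M l \<gamma>"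
    using B unfolding symmetric_transformation_on_def by blast
  then obtain z where z: "z \<in> perp" "B (\<Phi> 0 (x - (x \<bullet> e0) *\<^sub>R e0)) = \<Phi> 0 z" using initial_perp_iff by blast
  then show "\<Phi> 0 (frame_op B x) = B (\<Phi> 0 (x - (x \<bullet> e0) *\<^sub>R e0))" "frame_op B x \<in> perp"
    using frame_coords_\<Phi>[OF zero_I] by (simp_all add: frame_op_def)
qed

lemma \<Phi>_frame_op: "x \<in> perp \<Longrightarrow> \<Phi> 0 (frame_op B x) = B (\<Phi> 0 x)"
  using \<Phi>_frame_op_proj[of x] by (simp add: perp_def)

lemma frame_op_linear: "linear (frame_op B)"
proof (rule linearI)
  note lin = \<Phi>_linear[OF zero_I]
  have in_perp: "\<Phi> 0 (x - (x \<bullet> e0) *\<^sub>R e0) \<in> initial_perp M l \<gamma>" for x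
    using proj_perp initial_perp_iff by blast
  have add: "B (X + Y) = B X + B Y" if "X \<in> initial_perp M l \<gamma>" "Y \<in> initial_perp M l \<gamma>" for X Y
    using B that unfolding symmetric_transformation_on_def by blast
  have scale: "B (r *\<^sub>R X) = r *\<^sub>R B X" if "X \<in> initial_perp M l \<gamma>" for X r
    using B that unfolding symmetric_transformation_on_def by blast
  show "frame_op B (x + y) = frame_op B x + frame_op B y" for x y
  proof -
    have eq: "x + y - ((x + y) \<bullet> e0) *\<^sub>R e0 = (x - (x \<bullet> e0) *\<^sub>R e0) + (y - (y \<bullet> e0) *\<^sub>R e0)"
      by (simp add: inner_add_left algebra_simps)
    have "\<Phi> 0 (frame_op B (x + y)) = \<Phi> 0 (frame_op B x + frame_op B y)"
      unfolding \<Phi>_frame_op_proj linear_add[OF lin] eq by (rule add[OF in_perp in_perp])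
    then show ?thesis using \<Phi>_inj[OF zero_I] by blast
  qed
  show "frame_op B (r *\<^sub>R x) = r *\<^sub>R frame_op B x" for r x
  proof -
    have eq: "r *\<^sub>R x - ((r *\<^sub>R x) \<bullet> e0) *\<^sub>R e0 = r *\<^sub>R (x - (x \<bullet> e0) *\<^sub>R e0)"
      by (simp add: algebra_simps)
    have "\<Phi> 0 (frame_op B (r *\<^sub>R x)) = \<Phi> 0 (r *\<^sub>R frame_op B x)"
      unfolding \<Phi>_frame_op_proj linear_cmul[OF lin] eq by (rule scale[OF in_perp])
    then show ?thesis using \<Phi>_inj[OF zero_I] by blast
  qed
qed

lemma frame_op_sym: "frame_op B x \<bullet> y = x \<bullet> frame_op B y"
proof -
  have proj: "frame_op B (x - (x \<bullet> e0) *\<^sub>R e0) = frame_op B x" for x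
    unfolding frame_op_def by (simp add: inner_diff_left e0_unit)
  have "frame_op B x \<bullet> y = x \<bullet> frame_op B y" if "x \<in> perp" "y \<in> perp" for x y
  proof -
    have "\<Phi> 0 x \<in> initial_perp M l \<gamma>" "\<Phi> 0 y \<in> initial_perp M l \<gamma>" using that initial_perp_iff by blast+
    then have "rmetric M (\<gamma> 0) (B (\<Phi> 0 x)) (\<Phi> 0 y) = rmetric M (\<gamma> 0) (\<Phi> 0 x) (B (\<Phi> 0 y))"
      using B unfolding symmetric_transformation_on_def by blast
    then show ?thesis
      unfolding \<Phi>_frame_op[OF that(1), symmetric] \<Phi>_frame_op[OF that(2), symmetric] \<Phi>_inner[OF zero_I] .
  qed
  from this[OF proj_perp[of x] proj_perp[of y]]
  have "frame_op B x \<bullet> (y - (y \<bullet> e0) *\<^sub>R e0) = (x - (x \<bullet> e0) *\<^sub>R e0) \<bullet> frame_op B y" unfolding proj .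
  moreover have "frame_op B x \<bullet> e0 = 0" "e0 \<bullet> frame_op B y = 0" using frame_op_perp by (auto simp: perp_def inner_commute)
  ultimately show ?thesis by (simp add: inner_diff_left inner_diff_right)
qed

lemma eigenvalues_frame_op: "eigenvalues_on (initial_perp M l \<gamma>) B = eigenvalues_on perp (frame_op B)"
proof -
  have 1: "B (\<Phi> 0 x) = a *\<^sub>R \<Phi> 0 x \<longleftrightarrow> frame_op B x = a *\<^sub>R x" if "x \<in> perp" for a x
    unfolding \<Phi>_frame_op[OF that, symmetric] linear_cmul[OF \<Phi>_linear[OF zero_I], symmetric] by (rule \<Phi>_inj[OF zero_I])
  have 2: "\<Phi> 0 x = 0 \<longleftrightarrow> x = 0" for x
    using \<Phi>_inj[OF zero_I, of x 0] linear_0[OF \<Phi>_linear[OF zero_I]] by simp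
  show ?thesis
  proof (intro set_eqI iffI)
    fix a assume "a \<in> eigenvalues_on (initial_perp M l \<gamma>) B"
    then obtain X where X: "X \<in> initial_perp M l \<gamma>" "X \<noteq> 0" "B X = a *\<^sub>R X"
      unfolding eigenvalues_on_def by blast
    then obtain x where "x \<in> perp" "X = \<Phi> 0 x" using initial_perp_iff by blast
    then show "a \<in> eigenvalues_on perp (frame_op B)"
      using X 1[of x a] 2[of x] by (auto simp: eigenvalues_on_def)
  next
    fix a assume "a \<in> eigenvalues_on perp (frame_op B)"
    then obtain x where x: "x \<in> perp" "x \<noteq> 0" "frame_op B x = a *\<^sub>R x" unfolding eigenvalues_on_def by blast
    have "\<Phi> 0 x \<in> initial_perp M l \<gamma>" using x(1) initial_perp_iff by blast
    then show "a \<in> eigenvalues_on (initial_perp M l \<gamma>) B"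
      using x 1[of x a] 2[of x] unfolding eigenvalues_on_def by blast
  qed
qed

text \<open>A nonzero kernel vector x of \<open>A t\<close> would be the initial value of a Jacobi
  field with J'(0) = B(J(0)) and J(t) = 0, that is, would produce a focal point at t. Everything
  except perpendicularity of x to the velocity is built into the initial conditions.\<close>

lemma jacobi_tensor_exists:
  assumes nofocal: "\<not> (\<exists>t. focal_point_at M l \<gamma> B t)"
  shows "\<exists>A A'. jacobi_tensor l A A' Rop (frame_op B)"
proof -
  have "\<forall>b. \<exists>y y'. y 0 = b \<and> y' 0 = frame_op B b \<and> smooth_on y I \<and> smooth_on y' I \<and>
    (\<forall>t\<in>I. (y has_vector_derivative y' t) (at t within I) \<and> (y' has_vector_derivative - Rop t (y t)) (at t within I))"
    using jacobi_solution by blast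
  then obtain Y Y' where Y: "\<And>b. Y b 0 = b" "\<And>b. Y' b 0 = frame_op B b" "\<And>b. smooth_on (Y b) I" "\<And>b. smooth_on (Y' b) I"
    "\<And>b t. t \<in> I \<Longrightarrow> (Y b has_vector_derivative Y' b t) (at t within I)"
    "\<And>b t. t \<in> I \<Longrightarrow> (Y' b has_vector_derivative - Rop t (Y b t)) (at t within I)" by metis
  define A A' where "A t x = (\<Sum>b\<in>Basis. (x \<bullet> b) *\<^sub>R Y b t)" and "A' t x = (\<Sum>b\<in>Basis. (x \<bullet> b) *\<^sub>R Y' b t)" for t x
  have lin: "linear (A t)" "linear (A' t)" for t
    unfolding A_def A'_def
    by (rule linearI; simp add: inner_left_distrib scaleR_add_left sum.distrib scaleR_sum_right)+
  have A_der: "((\<lambda>t. A t x) has_vector_derivative A' t x) (at t within I)" if "t \<in> I" for t x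
    unfolding A_def A'_def
    by (intro has_vector_derivative_sum bounded_linear.has_vector_derivative[OF bounded_linear_scaleR_right] Y that)
  have "((\<lambda>t. A' t x) has_vector_derivative (\<Sum>b\<in>Basis. (x \<bullet> b) *\<^sub>R - Rop t (Y b t))) (at t within I)" if "t \<in> I" for t x
    unfolding A'_def
    by (intro has_vector_derivative_sum bounded_linear.has_vector_derivative[OF bounded_linear_scaleR_right] Y that)
  moreover have "(\<Sum>b\<in>Basis. (x \<bullet> b) *\<^sub>R - Rop t (Y b t)) = - Rop t (A t x)" if "t \<in> I" for t x
    by (simp add: A_def linear_sum[OF Rop_linear[OF that]] linear_cmul[OF Rop_linear[OF that]] sum_negf)
  ultimately have A'_der: "((\<lambda>t. A' t x) has_vector_derivative - Rop t (A t x)) (at t within I)" if "t \<in> I" for t x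
    using that by metis
  have A_0: "A 0 x = x" and A'_0: "A' 0 x = frame_op B x" for x
    using linear_Basis_expand[OF frame_op_linear, of x] by (simp_all add: A_def A'_def Y euclidean_representation)
  have smooth: "smooth_on (\<lambda>t. A t x) I" "smooth_on (\<lambda>t. A' t x) I" for x
    unfolding smooth_on_def A_def A'_def
    by (intro allI Ck_on_sum Ck_on_scaleR Ck_on_const derivative_set_I smooth_onD[OF Y(3)] smooth_onD[OF Y(4)])+
  have ip: "((\<lambda>t. f t \<bullet> e0) has_vector_derivative f' \<bullet> e0) (at t within I)"
    if "(f has_vector_derivative f') (at t within I)" for f f' t
    by (rule bounded_linear.has_vector_derivative[OF bounded_linear_inner_left that])
  have A'_e0: "A' t x \<bullet> e0 = 0" if t: "t \<in> I" for t x
  proof -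
    have "A' t x \<bullet> e0 = A' 0 x \<bullet> e0"
      by (rule constant_on_interval[where f="\<lambda>t. A' t x \<bullet> e0", OF _ t zero_I])
         (use ip[OF A'_der] Rop_perp in force)
    then show ?thesis using frame_op_perp[of x] by (simp add: A'_0 perp_def)
  qed
  have A_e0: "A t x \<bullet> e0 = x \<bullet> e0" if t: "t \<in> I" for t x
  proof -
    have "A t x \<bullet> e0 = A 0 x \<bullet> e0"
      by (rule constant_on_interval[where f="\<lambda>t. A t x \<bullet> e0", OF _ t zero_I])
         (use ip[OF A_der] A'_e0 in force)
    then show ?thesis by (simp add: A_0)
  qed
  have inj: "inj (A t)" if t: "t \<in> I" for t
  proof -
    have "x = 0" if z: "A t x = 0" for x
    proof (rule ccontr)
      assume x: "x \<noteq> 0"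
      \<comment> \<open>\<open>A 0\<close> is the identity, so a kernel can occur only at positive
        times.\<close>
      have t0: "0 < t" "t \<le> l" using t z x A_0[of x] by (auto simp: less_le)
      \<comment> \<open>The component of \<open>A s x\<close> along e0 does not change with s,
        because neither \<open>frame_op B\<close> nor \<open>Rop\<close> has values with such a
        component. Vanishing at t therefore forces it to vanish initially.\<close>
      have xp: "x \<in> perp" using A_e0[OF t, of x] z by (simp add: perp_def)
      let ?J = "\<lambda>s. \<Phi> s (A s x)"
      have J: "jacobi_field M t \<gamma> ?J" "cov_deriv M t \<gamma> ?J 0 = \<Phi> 0 (A' 0 x)"
        by (rule jacobi_field_\<Phi>[where y="\<lambda>s. A s x" and y'="\<lambda>s. A' s x", OF t0 smooth(1) A_der smooth(2) A'_der]; assumption)+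
      have "?J t = 0" using z linear_0[OF \<Phi>_linear[OF t]] by simp
      moreover have "?J 0 \<noteq> 0"
        using \<Phi>_inj[OF zero_I, of x 0] linear_0[OF \<Phi>_linear[OF zero_I]] x by (simp add: A_0)
      moreover have "?J 0 \<in> initial_perp M l \<gamma>" using initial_perp_iff xp by (auto simp: A_0)
      moreover have "cov_deriv M t \<gamma> ?J 0 = B (?J 0)" unfolding J(2) by (simp add: A_0 A'_0 \<Phi>_frame_op[OF xp])
      ultimately have "focal_point_at M l \<gamma> B t"
        using J(1) t0 unfolding focal_point_at_def by (intro conjI exI[of _ ?J]) auto
      then show False using nofocal by blast
    qed
    then show ?thesis using linear_injective_0[OF lin(1)] by blast
  qed
  have "jacobi_tensor l A A' Rop (frame_op B)"
    by (intro jacobi_tensor.intro l_pos lin inj A_der A'_der Rop_sym A_0 A'_0 frame_op_sym)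
  then show ?thesis by blast
qed

end

text \<open>\<open>Rop\<close> annihilates e0 and takes perpendicular values. Hence the projection
  of a solution is a solution, and the component along e0 has second derivative 0. Its affine
  coefficients are stated as inner products at time 0, so that equal data of two fields give
  literally equal coefficients.\<close>

lemma jacobi_perp_partE:
  assumes V: "jacobi_field M l \<gamma> V"
  obtains w w' where
    "\<And>t. t \<in> I \<Longrightarrow> (w has_vector_derivative w' t) (at t within I)"
    "\<And>t. t \<in> I \<Longrightarrow> (w' has_vector_derivative - Rop t (w t)) (at t within I)"
    "\<And>t. w t \<in> perp"
    "\<And>t. t \<in> I \<Longrightarrow> V t = \<Phi> t (w t + (rmetric M (\<gamma> 0) (vel 0) (V 0)
        + t * rmetric M (\<gamma> 0) (vel 0) (cov_deriv M l \<gamma> V 0)) *\<^sub>R e0)"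
    "\<And>t. t \<in> I \<Longrightarrow> perp_part M l \<gamma> V t = \<Phi> t (w t)"
    "perp_part M l \<gamma> (cov_deriv M l \<gamma> V) 0 = \<Phi> 0 (w' 0)"
proof -
  obtain v v' where v: "\<And>t. t \<in> I \<Longrightarrow> V t = \<Phi> t (v t)"
    "\<And>t. t \<in> I \<Longrightarrow> cov_deriv M l \<gamma> V t = \<Phi> t (v' t)"
    "\<And>t. t \<in> I \<Longrightarrow> (v has_vector_derivative v' t) (at t within I)"
    "\<And>t. t \<in> I \<Longrightarrow> (v' has_vector_derivative - Rop t (v t)) (at t within I)"
    using jacobi_fieldE[OF V] by blast
  define P where "P x = x - (x \<bullet> e0) *\<^sub>R e0" for x
  have P: "bounded_linear P"
    unfolding P_def by (intro bounded_linear_sub bounded_linear_ident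
        bounded_linear_scaleR_const bounded_linear_inner_left)
  have 0: "0 \<in> I" using l_pos by simp
  have RP: "Rop t (P x) = Rop t x" "P (- Rop t x) = - Rop t x" if "t \<in> I" for t x
    using Rop_linear[OF that] Rop_e0[OF that] Rop_perp[OF that, of x]
    by (simp_all add: P_def linear_diff linear_cmul)
  have ip: "((\<lambda>t. f t \<bullet> e0) has_vector_derivative f' \<bullet> e0) (at t within I)"
    if "(f has_vector_derivative f') (at t within I)" for f f' t
    by (rule bounded_linear.has_vector_derivative[OF bounded_linear_inner_left that])
  have v'e: "v' t \<bullet> e0 = v' 0 \<bullet> e0" if t: "t \<in> I" for t
    by (rule constant_on_interval[where f="\<lambda>t. v' t \<bullet> e0", OF _ t 0])
       (use ip[OF v(4)] Rop_perp in force)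
  have ve: "v t \<bullet> e0 = v 0 \<bullet> e0 + t * (v' 0 \<bullet> e0)" if t: "t \<in> I" for t
  proof -
    have d: "((\<lambda>t. v t \<bullet> e0 - t * (v' 0 \<bullet> e0)) has_vector_derivative 0) (at s within I)" if s: "s \<in> I" for s
    proof -
      have "((\<lambda>t. v t \<bullet> e0 - t * (v' 0 \<bullet> e0)) has_vector_derivative v' s \<bullet> e0 - 1 * (v' 0 \<bullet> e0)) (at s within I)"
        by (intro has_vector_derivative_diff ip v(3) s has_vector_derivative_mult_left has_vector_derivative_id)
      then show ?thesis using v'e[OF s] by simp
    qed
    have "v t \<bullet> e0 - t * (v' 0 \<bullet> e0) = v 0 \<bullet> e0 - 0 * (v' 0 \<bullet> e0)"
      by (rule constant_on_interval[where f="\<lambda>t. v t \<bullet> e0 - t * (v' 0 \<bullet> e0)", OF d t 0])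
    then show ?thesis by simp
  qed
  have \<alpha>: "rmetric M (\<gamma> 0) (vel 0) (V 0) = v 0 \<bullet> e0"
    "rmetric M (\<gamma> 0) (vel 0) (cov_deriv M l \<gamma> V 0) = v' 0 \<bullet> e0"
    unfolding v(1)[OF 0] v(2)[OF 0] \<Phi>_e0[OF 0, symmetric] \<Phi>_inner[OF 0] by (simp_all add: inner_commute)
  show thesis
  proof (rule that[of "\<lambda>t. P (v t)" "\<lambda>t. P (v' t)"])
    fix t assume t: "t \<in> I"
    show "((\<lambda>t. P (v t)) has_vector_derivative P (v' t)) (at t within I)"
      by (rule bounded_linear.has_vector_derivative[OF P v(3)[OF t]])
    show "((\<lambda>t. P (v' t)) has_vector_derivative - Rop t (P (v t))) (at t within I)"
      using bounded_linear.has_vector_derivative[OF P v(4)[OF t]] unfolding RP[OF t] .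
    show "V t = \<Phi> t (P (v t) + (rmetric M (\<gamma> 0) (vel 0) (V 0)
        + t * rmetric M (\<gamma> 0) (vel 0) (cov_deriv M l \<gamma> V 0)) *\<^sub>R e0)"
      unfolding \<alpha> ve[OF t, symmetric] v(1)[OF t] by (simp add: P_def)
    show "perp_part M l \<gamma> V t = \<Phi> t (P (v t))"
      unfolding P_def by (rule perp_part_\<Phi>[where V=V and x="v t", OF t v(1)[OF t]])
  next
    show "P (v t) \<in> perp" for t by (simp add: P_def perp_def inner_diff_left e0_unit)
    show "perp_part M l \<gamma> (cov_deriv M l \<gamma> V) 0 = \<Phi> 0 (P (v' 0))"
      unfolding P_def by (rule perp_part_\<Phi>[where V="cov_deriv M l \<gamma> V" and x="v' 0", OF 0 v(2)[OF 0]])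
  qed
qed

lemma rnorm_perp_sum:
  assumes "t \<in> I" "w \<in> perp" shows "rnorm M (\<gamma> t) (\<Phi> t (w + s *\<^sub>R e0)) = sqrt ((norm w)\<^sup>2 + s\<^sup>2)"
  using assms
  by (simp add: rnorm_\<Phi> norm_eq_sqrt_inner inner_add_left inner_add_right inner_commute[of e0 w] perp_def e0_unit
      power2_eq_square)

text \<open>A multiple of the velocity changes neither the numerator, as \<open>Rop\<close>
  annihilates e0, nor the denominator, where its square is subtracted. So the curvature for V itself
  can be computed from its perpendicular part.\<close>

lemma sectional_curvature_perp:
  assumes t: "t \<in> I" and w: "w \<in> perp"
  shows "sectional_curvature M (\<gamma> t) (vel t) (\<Phi> t (w + s *\<^sub>R e0)) = (Rop t w \<bullet> w) / (w \<bullet> w)"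
proof -
  have "Rop t (w + s *\<^sub>R e0) = Rop t w"
    using Rop_linear[OF t] Rop_e0[OF t] by (simp add: linear_add linear_cmul)
  then show ?thesis
    using w e0_unit Rop_perp[OF t, of w]
    by (simp add: sectional_curvature_\<Phi>[OF t] inner_add_left inner_add_right inner_commute[of e0 w] perp_def power2_eq_square)
qed

lemma not_in_span_vel:
  assumes t: "t \<in> I" and x: "x \<in> perp" "x \<noteq> 0" shows "\<Phi> t x \<notin> span {vel t}"
proof
  assume "\<Phi> t x \<in> span {vel t}"
  then obtain r where "\<Phi> t x = r *\<^sub>R vel t" by (auto simp: span_singleton)
  then have "\<Phi> t x = \<Phi> t (r *\<^sub>R e0)" using \<Phi>_e0[OF t] linear_cmul[OF \<Phi>_linear[OF t]] by simp
  then have "x = r *\<^sub>R e0" using \<Phi>_inj[OF t] by blast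
  then show False using x e0_unit by (simp add: perp_def)
qed

end

lemma framed_geodesic_exists:
  assumes "riemannian_manifold M" "normal_geodesic M l \<gamma>"
  shows "\<exists>\<Phi>. framed_geodesic M l \<gamma> \<Phi>"
proof -
  have g: "geodesic M l \<gamma>" by (intro geodesic.intro riemannian.intro geodesic_axioms.intro assms)
  show ?thesis
    using geodesic.parallel_frame_exists[OF g] framed_geodesic.intro[OF g framed_geodesic_axioms.intro] by blast
qed

section \<open>The comparison theorem\<close>

theorem theoremB:
  fixes M :: "('m, 'e::euclidean_space) riem"
    and M0 :: "('n, 'f::euclidean_space) riem"
    and \<gamma> :: "real \<Rightarrow> 'm" and \<gamma>0 :: "real \<Rightarrow> 'n" and l :: real
    and V :: "real \<Rightarrow> ('m, 'e) tvec" and V0 :: "real \<Rightarrow> ('n, 'f) tvec"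
    and B :: "('m, 'e) tvec \<Rightarrow> ('m, 'e) tvec" and B0 :: "('n, 'f) tvec \<Rightarrow> ('n, 'f) tvec"
  assumes "riemannian_manifold M" and "riemannian_manifold M0"
    and "DIM('e) \<ge> 2" and "DIM('f) \<ge> 2"
    and "normal_geodesic M l \<gamma>" and "normal_geodesic M0 l \<gamma>0"
    and "\<And>t X X0. t \<in> {0..l} \<Longrightarrow>
           X \<in> tangent_space M (\<gamma> t) \<Longrightarrow> X \<notin> span {velocity M l \<gamma> t} \<Longrightarrow>
           X0 \<in> tangent_space M0 (\<gamma>0 t) \<Longrightarrow> X0 \<notin> span {velocity M0 l \<gamma>0 t} \<Longrightarrow>
           sectional_curvature M (\<gamma> t) (velocity M l \<gamma> t) X
             \<le> sectional_curvature M0 (\<gamma>0 t) (velocity M0 l \<gamma>0 t) X0"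
    and "jacobi_field M l \<gamma> V" and "jacobi_field M0 l \<gamma>0 V0"
    and "rnorm M (\<gamma> 0) (V 0) \<ge> rnorm M0 (\<gamma>0 0) (V0 0)" and "rnorm M0 (\<gamma>0 0) (V0 0) > 0"
    and "rmetric M (\<gamma> 0) (velocity M l \<gamma> 0) (V 0)
           = rmetric M0 (\<gamma>0 0) (velocity M0 l \<gamma>0 0) (V0 0)"
    and "rmetric M (\<gamma> 0) (velocity M l \<gamma> 0) (cov_deriv M l \<gamma> V 0)
           = rmetric M0 (\<gamma>0 0) (velocity M0 l \<gamma>0 0) (cov_deriv M0 l \<gamma>0 V0 0)"
    and "symmetric_transformation_on (initial_perp M l \<gamma>) (rmetric M (\<gamma> 0)) B"
    and "symmetric_transformation_on (initial_perp M0 l \<gamma>0) (rmetric M0 (\<gamma>0 0)) B0"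
    and "Min (eigenvalues_on (initial_perp M l \<gamma>) B)
           \<ge> Max (eigenvalues_on (initial_perp M0 l \<gamma>0) B0)"
    and "perp_part M l \<gamma> (cov_deriv M l \<gamma> V) 0 = B (perp_part M l \<gamma> V 0)"
    and "perp_part M0 l \<gamma>0 (cov_deriv M0 l \<gamma>0 V0) 0 = B0 (perp_part M0 l \<gamma>0 V0 0)"
    and "\<not> (\<exists>t. focal_point_at M0 l \<gamma>0 B0 t)"
  shows "(\<forall>t\<in>{0..l}. rnorm M (\<gamma> t) (V t) \<ge> rnorm M0 (\<gamma>0 t) (V0 t)) \<and>
    (\<forall>t0\<in>{0<..l}. rnorm M (\<gamma> t0) (V t0) = rnorm M0 (\<gamma>0 t0) (V0 t0) \<longrightarrow>
       (\<forall>t\<in>{0..t0}.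
          rnorm M (\<gamma> t) (perp_part M l \<gamma> V t) = rnorm M0 (\<gamma>0 t) (perp_part M0 l \<gamma>0 V0 t) \<and>
          rnorm M (\<gamma> t) (V t) = rnorm M0 (\<gamma>0 t) (V0 t)) \<and>
       (rnorm M (\<gamma> 0) (perp_part M l \<gamma> V 0) \<noteq> 0 \<longrightarrow>
          (\<forall>t\<in>{0..t0}. sectional_curvature M (\<gamma> t) (velocity M l \<gamma> t) (V t)
                        = sectional_curvature M0 (\<gamma>0 t) (velocity M0 l \<gamma>0 t) (V0 t)) \<and>
          parallel_along M t0 \<gamma>
            (\<lambda>t. (1 / rnorm M (\<gamma> t) (perp_part M l \<gamma> V t)) *\<^sub>R perp_part M l \<gamma> V t) \<and>
          parallel_along M0 t0 \<gamma>0
            (\<lambda>t. (1 / rnorm M (\<gamma> t) (perp_part M l \<gamma> V t)) *\<^sub>R perp_part M0 l \<gamma>0 V0 t)))"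
proof -
  obtain \<Phi> where F: "framed_geodesic M l \<gamma> \<Phi>" using framed_geodesic_exists[OF assms(1,5)] by blast
  obtain \<Phi>0 where F0: "framed_geodesic M0 l \<gamma>0 \<Phi>0" using framed_geodesic_exists[OF assms(2,6)] by blast
  interpret F: framed_geodesic M l \<gamma> \<Phi> by (rule F)
  interpret F0: framed_geodesic M0 l \<gamma>0 \<Phi>0 by (rule F0)
  have 0: "0 \<in> {0..l}" using F.l_pos by simp
  \<comment> \<open>The hypotheses on the inner products at time 0 say that V has the same two
    numbers, so \<alpha> + t\<beta> is the tangential coefficient of both fields.\<close>
  define \<alpha> \<beta> where "\<alpha> = rmetric M0 (\<gamma>0 0) (velocity M0 l \<gamma>0 0) (V0 0)"
    and "\<beta> = rmetric M0 (\<gamma>0 0) (velocity M0 l \<gamma>0 0) (cov_deriv M0 l \<gamma>0 V0 0)"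
  obtain w w' where w: "\<And>t. t \<in> {0..l} \<Longrightarrow> (w has_vector_derivative w' t) (at t within {0..l})"
    "\<And>t. t \<in> {0..l} \<Longrightarrow> (w' has_vector_derivative - F.Rop t (w t)) (at t within {0..l})"
    and wp: "\<And>t. w t \<in> F.perp"
    and V: "\<And>t. t \<in> {0..l} \<Longrightarrow> V t = \<Phi> t (w t + (\<alpha> + t * \<beta>) *\<^sub>R F.e0)"
    and Vp: "\<And>t. t \<in> {0..l} \<Longrightarrow> perp_part M l \<gamma> V t = \<Phi> t (w t)"
    and V'p: "perp_part M l \<gamma> (cov_deriv M l \<gamma> V) 0 = \<Phi> 0 (w' 0)"
    using F.jacobi_perp_partE[OF assms(8)] unfolding assms(12,13) \<alpha>_def \<beta>_def by blast
  obtain u u' where u: "\<And>t. t \<in> {0..l} \<Longrightarrow> (u has_vector_derivative u' t) (at t within {0..l})"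
    "\<And>t. t \<in> {0..l} \<Longrightarrow> (u' has_vector_derivative - F0.Rop t (u t)) (at t within {0..l})"
    and up: "\<And>t. u t \<in> F0.perp"
    and V0: "\<And>t. t \<in> {0..l} \<Longrightarrow> V0 t = \<Phi>0 t (u t + (\<alpha> + t * \<beta>) *\<^sub>R F0.e0)"
    and V0p: "\<And>t. t \<in> {0..l} \<Longrightarrow> perp_part M0 l \<gamma>0 V0 t = \<Phi>0 t (u t)"
    and V0'p: "perp_part M0 l \<gamma>0 (cov_deriv M0 l \<gamma>0 V0) 0 = \<Phi>0 0 (u' 0)"
    using F0.jacobi_perp_partE[OF assms(9)] unfolding \<alpha>_def \<beta>_def by blast
  have w'0: "w' 0 = F.frame_op B (w 0)"
    using assms(17) unfolding V'p Vp[OF 0] F.\<Phi>_frame_op[OF assms(14) wp, symmetric] F.\<Phi>_inj[OF 0] .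
  have u'0: "u' 0 = F0.frame_op B0 (u 0)"
    using assms(18) unfolding V0'p V0p[OF 0] F0.\<Phi>_frame_op[OF assms(15) up, symmetric] F0.\<Phi>_inj[OF 0] .
  obtain A A' where AJ: "jacobi_tensor l A A' F0.Rop (F0.frame_op B0)"
    using F0.jacobi_tensor_exists[OF assms(15,19)] by blast
  interpret A: jacobi_tensor l A A' F0.Rop "F0.frame_op B0" by (rule AJ)
  \<comment> \<open>The difference solves the Jacobi equation with zero data at 0: both start at
    \<open>u 0\<close>, with derivative \<open>F0.frame_op B0 (u 0)\<close>.\<close>
  have uA: "u t = A t (u 0)" if t: "t \<in> {0..l}" for t
  proof -
    have "u t - A t (u 0) = 0"
    proof (rule F0.jacobi_zero[where y="\<lambda>t. u t - A t (u 0)" and y'="\<lambda>t. u' t - A' t (u 0)", OF _ _ _ _ t])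
      fix t assume t: "t \<in> {0..l}"
      show "((\<lambda>t. u t - A t (u 0)) has_vector_derivative u' t - A' t (u 0)) (at t within {0..l})"
        by (intro has_vector_derivative_diff u A.A_der t)
      show "((\<lambda>t. u' t - A' t (u 0)) has_vector_derivative - F0.Rop t (u t - A t (u 0))) (at t within {0..l})"
        using has_vector_derivative_diff[OF u(2)[OF t] A.A'_der[OF t, of "u 0"]]
        by (simp add: linear_diff[OF F0.Rop_linear[OF t]])
    qed (simp_all add: A.A_0 A.A'_0 u'0)
    then show ?thesis by simp
  qed
  have normV: "rnorm M (\<gamma> t) (V t) = sqrt ((norm (w t))\<^sup>2 + (\<alpha> + t * \<beta>)\<^sup>2)" if "t \<in> {0..l}" for t
    unfolding V[OF that] by (rule F.rnorm_perp_sum[OF that wp])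
  have normV0: "rnorm M0 (\<gamma>0 t) (V0 t) = sqrt ((norm (u t))\<^sup>2 + (\<alpha> + t * \<beta>)\<^sup>2)" if "t \<in> {0..l}" for t
    unfolding V0[OF that] by (rule F0.rnorm_perp_sum[OF that up])
  \<comment> \<open>The tangential contributions coincide, so inequality and equality of the full
    norms are the same as for the perpendicular parts.\<close>
  have le_iff: "rnorm M0 (\<gamma>0 t) (V0 t) \<le> rnorm M (\<gamma> t) (V t) \<longleftrightarrow> norm (u t) \<le> norm (w t)"
    and eq_iff: "rnorm M (\<gamma> t) (V t) = rnorm M0 (\<gamma>0 t) (V0 t) \<longleftrightarrow> norm (u t) = norm (w t)" if "t \<in> {0..l}" for t
    unfolding normV[OF that] normV0[OF that] by (auto simp: power_mono_iff)
  have init: "norm (u 0) \<le> norm (w 0)" using assms(10) le_iff[OF 0] by simp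
  have perp_norms: "rnorm M (\<gamma> t) (perp_part M l \<gamma> V t) = norm (w t)"
    "rnorm M0 (\<gamma>0 t) (perp_part M0 l \<gamma>0 V0 t) = norm (u t)" if "t \<in> {0..l}" for t
    unfolding Vp[OF that] V0p[OF that] by (rule F.rnorm_\<Phi>[OF that], rule F0.rnorm_\<Phi>[OF that])
  \<comment> \<open>The hypothesis on sectional curvatures is applied to w and to an arbitrary
    perpendicular unit vector c in the other manifold. For w t = 0 there is no plane in
    \<open>M\<close>, and both sides are 0.\<close>
  have curv: "F.Rop t (w t) \<bullet> w t \<le> (F0.Rop t c \<bullet> c) * (w t \<bullet> w t)"
    if t: "t \<in> {0..l}" and c: "c \<in> F0.perp" "c \<bullet> c = 1" for t c
  proof (cases "w t = 0")
    case True
    then show ?thesis using linear_0[OF F.Rop_linear[OF t]] by simp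
  next
    case False
    have "c \<noteq> 0" using c by auto
    have "(F.Rop t (w t) \<bullet> w t) / (w t \<bullet> w t) \<le> (F0.Rop t c \<bullet> c) / (c \<bullet> c)"
      using assms(7)[OF t F.\<Phi>_tangent[OF t] F.not_in_span_vel[OF t wp False]
          F0.\<Phi>_tangent[OF t] F0.not_in_span_vel[OF t c(1) \<open>c \<noteq> 0\<close>]]
        F.sectional_curvature_perp[OF t wp, of t 0] F0.sectional_curvature_perp[OF t c(1), of 0] by simp
    then show ?thesis using False c by (simp add: divide_le_eq)
  qed
  \<comment> \<open>Rayleigh quotients: that of B0 at c is at most the largest eigenvalue of B0,
    which is at most the smallest one of B, which bounds the quotient of B at w(0) from
    below.\<close>
  have eig: "(F0.frame_op B0 c \<bullet> c) * (w 0 \<bullet> w 0) \<le> w' 0 \<bullet> w 0" if c: "c \<in> F0.perp" "c \<bullet> c = 1" for c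
  proof -
    let ?m = "Min (eigenvalues_on F.perp (F.frame_op B))" and ?M = "Max (eigenvalues_on F0.perp (F0.frame_op B0))"
    have "F0.frame_op B0 c \<bullet> c \<le> ?M * (c \<bullet> c)"
      by (rule symmetric_eigenvalue_bounds(2)[OF F0.subspace_perp F0.perp_nontrivial[OF assms(4)]
            F0.frame_op_linear[OF assms(15)] F0.frame_op_perp[OF assms(15)] F0.frame_op_sym[OF assms(15)] c(1)])
    also have "\<dots> \<le> ?m"
      using assms(16) c unfolding F.eigenvalues_frame_op[OF assms(14)] F0.eigenvalues_frame_op[OF assms(15)] by simp
    finally have "(F0.frame_op B0 c \<bullet> c) * (w 0 \<bullet> w 0) \<le> ?m * (w 0 \<bullet> w 0)" by (intro mult_right_mono) auto
    also have "\<dots> \<le> F.frame_op B (w 0) \<bullet> w 0"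
      by (rule symmetric_eigenvalue_bounds(1)[OF F.subspace_perp F.perp_nontrivial[OF assms(3)]
            F.frame_op_linear[OF assms(14)] F.frame_op_perp[OF assms(14)] F.frame_op_sym[OF assms(14)] wp])
    finally show ?thesis unfolding w'0 .
  qed
  have A_perp: "A t (u 0) \<in> F0.perp" if "t \<in> {0..l}" for t using up[of t] uA[OF that] by simp
  note nontriv = F0.perp_nontrivial[OF assms(4)]
  show ?thesis
  proof (cases "w 0 = 0")
    case True
    \<comment> \<open>The derivative w'(0) = B(w(0)) vanishes as well, so w is identically 0; so is
      u, whose initial norm is no larger. The norm statements become trivial, and the last claim is
      void since its premise fails.\<close>
    have w'z: "w' 0 = 0" unfolding w'0 True by (rule linear_0[OF F.frame_op_linear[OF assms(14)]])
    have w0: "w t = 0" if "t \<in> {0..l}" for t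
      by (rule F.jacobi_zero[OF w True w'z that])
    have u0: "u t = 0" if "t \<in> {0..l}" for t
      using uA[OF that] init True linear_0[OF A.A_linear[OF that]] by simp
    show ?thesis
    proof (intro conjI ballI impI)
      fix t assume "t \<in> {0..l}"
      then show "rnorm M0 (\<gamma>0 t) (V0 t) \<le> rnorm M (\<gamma> t) (V t)" using le_iff w0 u0 by simp
    next
      fix t0 t assume "t0 \<in> {0<..l}" "t \<in> {0..t0}"
      then have t: "t \<in> {0..l}" by auto
      show "rnorm M (\<gamma> t) (perp_part M l \<gamma> V t) = rnorm M0 (\<gamma>0 t) (perp_part M0 l \<gamma>0 V0 t)"
        "rnorm M (\<gamma> t) (V t) = rnorm M0 (\<gamma>0 t) (V0 t)"
        unfolding perp_norms[OF t] eq_iff[OF t] by (simp_all add: w0[OF t] u0[OF t])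
    qed (use perp_norms[OF 0] True in simp_all)
  next
    case False
    note comparison = w F0.subspace_perp nontriv curv eig A_perp init False
    have le: "norm (u t) \<le> norm (w t)" if "t \<in> {0..l}" for t
      unfolding uA[OF that] by (rule A.norm_comparison_le[where w=w and w'=w' and K=F.Rop and H=F0.perp and a="u 0", OF comparison that])
    have rigid: "\<exists>x y. \<forall>t\<in>{0..s}. w t \<noteq> 0 \<and> norm (u t) = norm (w t) \<and> w t = norm (w t) *\<^sub>R x \<and>
        u t = norm (w t) *\<^sub>R y \<and> F.Rop t (w t) \<bullet> w t = F0.Rop t (u t) \<bullet> u t"
      if s: "s \<in> {0<..l}" and e: "rnorm M (\<gamma> s) (V s) = rnorm M0 (\<gamma>0 s) (V0 s)" for s
    proof -
      have sl: "0 < s" "s \<le> l" using s by auto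
      have As: "norm (A s (u 0)) = norm (w s)" using e eq_iff[of s] uA[of s] sl by simp
      have uA': "A t (u 0) = u t" if "t \<in> {0..s}" for t
        by (rule uA[symmetric]) (use that sl in auto)
      have "\<exists>x y. \<forall>t\<in>{0..s}. w t \<noteq> 0 \<and> norm (A t (u 0)) = norm (w t) \<and> w t = norm (w t) *\<^sub>R x \<and>
        A t (u 0) = norm (w t) *\<^sub>R y \<and> F.Rop t (w t) \<bullet> w t = F0.Rop t (A t (u 0)) \<bullet> A t (u 0)"
        by (rule A.norm_comparison_eq[where w=w and w'=w' and K=F.Rop and H=F0.perp and a="u 0",
            OF comparison sl As])
      then show ?thesis by (simp only: uA' cong: ball_cong)
    qed
    have main: "(\<forall>t\<in>{0..s}.
          rnorm M (\<gamma> t) (perp_part M l \<gamma> V t) = rnorm M0 (\<gamma>0 t) (perp_part M0 l \<gamma>0 V0 t) \<and>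
          rnorm M (\<gamma> t) (V t) = rnorm M0 (\<gamma>0 t) (V0 t)) \<and>
        (\<forall>t\<in>{0..s}. sectional_curvature M (\<gamma> t) (velocity M l \<gamma> t) (V t)
                        = sectional_curvature M0 (\<gamma>0 t) (velocity M0 l \<gamma>0 t) (V0 t)) \<and>
          parallel_along M s \<gamma>
            (\<lambda>t. (1 / rnorm M (\<gamma> t) (perp_part M l \<gamma> V t)) *\<^sub>R perp_part M l \<gamma> V t) \<and>
          parallel_along M0 s \<gamma>0
            (\<lambda>t. (1 / rnorm M (\<gamma> t) (perp_part M l \<gamma> V t)) *\<^sub>R perp_part M0 l \<gamma>0 V0 t)"
      if s: "s \<in> {0<..l}" and e: "rnorm M (\<gamma> s) (V s) = rnorm M0 (\<gamma>0 s) (V0 s)" for s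
    proof -
      obtain x y where xy: "\<And>t. t \<in> {0..s} \<Longrightarrow> w t \<noteq> 0 \<and> norm (u t) = norm (w t) \<and> w t = norm (w t) *\<^sub>R x \<and>
        u t = norm (w t) *\<^sub>R y \<and> F.Rop t (w t) \<bullet> w t = F0.Rop t (u t) \<bullet> u t"
        using rigid[OF s e] by blast
      have sl: "0 < s" "s \<le> l" using s by auto
      have tl: "t \<in> {0..l}" if "t \<in> {0..s}" for t using that sl by auto
      have nz: "w t \<noteq> 0" and nn: "norm (u t) = norm (w t)" and wx: "w t = norm (w t) *\<^sub>R x"
        and uy: "u t = norm (w t) *\<^sub>R y" and Req: "F.Rop t (w t) \<bullet> w t = F0.Rop t (u t) \<bullet> u t"
        if "t \<in> {0..s}" for t using xy[OF that] by blast+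
      show ?thesis
      proof (intro conjI ballI)
        fix t assume t: "t \<in> {0..s}"
        show "rnorm M (\<gamma> t) (perp_part M l \<gamma> V t) = rnorm M0 (\<gamma>0 t) (perp_part M0 l \<gamma>0 V0 t)"
          "rnorm M (\<gamma> t) (V t) = rnorm M0 (\<gamma>0 t) (V0 t)"
          unfolding perp_norms[OF tl[OF t]] eq_iff[OF tl[OF t]] nn[OF t] by (rule refl)+
        have "w t \<bullet> w t = u t \<bullet> u t" by (simp add: dot_square_norm nn[OF t])
        then show "sectional_curvature M (\<gamma> t) (velocity M l \<gamma> t) (V t)
            = sectional_curvature M0 (\<gamma>0 t) (velocity M0 l \<gamma>0 t) (V0 t)"
          unfolding V[OF tl[OF t]] V0[OF tl[OF t]] F.sectional_curvature_perp[OF tl[OF t] wp]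
            F0.sectional_curvature_perp[OF tl[OF t] up] Req[OF t] by simp
      next
        show "parallel_along M s \<gamma> (\<lambda>t. (1 / rnorm M (\<gamma> t) (perp_part M l \<gamma> V t)) *\<^sub>R perp_part M l \<gamma> V t)"
        proof (rule F.parallel_along_constant[OF sl])
          fix t assume t: "t \<in> {0..s}"
          \<comment> \<open>The normalised field has the constant frame coordinates x, which is
            parallelism in a parallel frame.\<close>
          have "(1 / norm (w t)) *\<^sub>R w t = (1 / norm (w t)) *\<^sub>R (norm (w t) *\<^sub>R x)" by (rule arg_cong[OF wx[OF t]])
          then have "(1 / norm (w t)) *\<^sub>R w t = x" using nz[OF t] by simp
          then show "(1 / rnorm M (\<gamma> t) (perp_part M l \<gamma> V t)) *\<^sub>R perp_part M l \<gamma> V t = \<Phi> t x"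
            unfolding perp_norms[OF tl[OF t]] unfolding Vp[OF tl[OF t]] linear_cmul[OF F.\<Phi>_linear[OF tl[OF t]], symmetric]
            by (rule arg_cong)
        qed
        show "parallel_along M0 s \<gamma>0 (\<lambda>t. (1 / rnorm M (\<gamma> t) (perp_part M l \<gamma> V t)) *\<^sub>R perp_part M0 l \<gamma>0 V0 t)"
        proof (rule F0.parallel_along_constant[OF sl])
          fix t assume t: "t \<in> {0..s}"
          have "(1 / norm (w t)) *\<^sub>R u t = (1 / norm (w t)) *\<^sub>R (norm (w t) *\<^sub>R y)" by (rule arg_cong[OF uy[OF t]])
          then have "(1 / norm (w t)) *\<^sub>R u t = y" using nz[OF t] by simp
          then show "(1 / rnorm M (\<gamma> t) (perp_part M l \<gamma> V t)) *\<^sub>R perp_part M0 l \<gamma>0 V0 t = \<Phi>0 t y"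
            unfolding perp_norms[OF tl[OF t]] unfolding V0p[OF tl[OF t]] linear_cmul[OF F0.\<Phi>_linear[OF tl[OF t]], symmetric]
            by (rule arg_cong)
        qed
      qed
    qed
    show ?thesis
      using le le_iff main by blast
  qed
qed

end
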